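(* Let $\alpha\in(0,1)\setminus\mathbb{Q}$, let $1\le r\le\infty$ be an integer or $\infty$, or $r=\omega$, and let $A\in C^r(\mathbb{R}/\mathbb{Z},\mathrm{SL}(2,\mathbb{R}))$. If $(\alpha,A)$ is $L^2$-conjugate to rotations, then for almost every $x_*\in\mathbb{R}/\mathbb{Z}$ there exist $B(x_* )\in\mathrm{SL}(2,\mathbb{R})$ and sequences of affine functions $\phi^{(n,0)},\phi^{(n,1)}:\mathbb{R}\to\mathbb{R}$ with bounded (uniformly in $n$) linear coefficients such that $$R_{-\phi^{(n,0)}(x)}B(x_* )A^{(n,0)}(x)B(x_* )^{-1}\to\mathrm{id}\quad\text{and}\quad R_{-\phi^{(n,1)}(x)}B(x_* )A^{(n,1)}(x)B(x_* )^{-1}\to\mathrm{id}$$ in $C^r$ as $n\to\infty$, where $A^{(n,0)},A^{(n,1)}$ are the renormalizations of $(\alpha,A)$ around $x_*$.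
   Context: $(\alpha,A)$ denotes the cocycle $(x,w)\mapsto(x+\alpha,A(x)\cdot w)$ on $\mathbb{R}/\mathbb{Z}\times\mathbb{R}^2$. For $n\ge1$, $A_n(x)=A(x+(n-1)\alpha)\cdots A(x)$, $A_0=\mathrm{id}$, $A_{-n}(x)=A_n(x-n\alpha)^{-1}$. $R_\theta\in\mathrm{SO}(2,\mathbb{R})$ is the rotation of angle $2\pi\theta$. $(\alpha,A)$ is $L^2$-conjugate to rotations if there is a measurable $B:\mathbb{R}/\mathbb{Z}\to\mathrm{SL}(2,\mathbb{R})$ with $\int\|B(x)\|^2dx<\infty$ and $B(x+\alpha)A(x)B(x)^{-1}\in\mathrm{SO}(2,\mathbb{R})$ for almost every $x$. Let $p_n/q_n$ be the continued fraction approximants of $\alpha$ and $\beta_n=(-1)^n(q_n\alpha-p_n)$. For $x_*\in\mathbb{R}/\mathbb{Z}$, the $n$-th renormalization of $(\alpha,A)$ around $x_*$ is given by the functions of $x\in\mathbb{R}$: $A^{(n,0)}(x)=A_{(-1)^{n-1}q_{n-1}}(x_*+\beta_{n-1}x)$ and $A^{(n,1)}(x)=A_{(-1)^nq_n}(x_*+\beta_{n-1}x)$. Convergence in $C^r$ of functions on $\mathbb{R}$ is on compact subsets; $C^\omega$ means real-analytic (convergence meaning uniform convergence of holomorphic extensions on a complex neighborhood of each compact set). *)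

theory Defs
  imports "HOL-Complex_Analysis.Complex_Analysis" "HOL-Library.Extended_Nat"
begin

text \<open>
  A map on the circle R/Z is represented by its 1-periodic lift to the reals; a property of points
  of R/Z holds almost everywhere iff its (periodic) lift holds Lebesgue-almost everywhere.
\<close>

definition on_circle :: "(real \<Rightarrow> 'a) \<Rightarrow> bool" where
  "on_circle f \<longleftrightarrow> (\<forall>x. f (x + 1) = f x)"

definition SL2 :: "(real^2^2) set" where
  "SL2 = {M. det M = 1}"

definition Rot :: "real \<Rightarrow> real^2^2" where
  "Rot \<theta> = vector [vector [cos (2 * pi * \<theta>), - sin (2 * pi * \<theta>)],
                   vector [sin (2 * pi * \<theta>), cos (2 * pi * \<theta>)]]"


subsection \<open>Regularity classes\<close>

text \<open>\<open>Diff k\<close> stands for \<open>C\<^sup>k\<close> (with \<open>Diff \<infinity>\<close> for smooth), \<open>Analytic\<close> for real-analytic.\<close>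

datatype regularity = Diff enat | Analytic

definition nth_vderiv :: "nat \<Rightarrow> (real \<Rightarrow> 'a::real_normed_vector) \<Rightarrow> real \<Rightarrow> 'a" where
  "nth_vderiv k f = ((\<lambda>g x. vector_derivative g (at x)) ^^ k) f"

definition times_cont_diff :: "enat \<Rightarrow> (real \<Rightarrow> 'a::real_normed_vector) \<Rightarrow> bool" where
  "times_cont_diff r f \<longleftrightarrow>
     (\<forall>k. enat k < r \<longrightarrow> (\<forall>x. nth_vderiv k f differentiable (at x))) \<and>
     (\<forall>k. enat k \<le> r \<longrightarrow> continuous_on UNIV (nth_vderiv k f))"

definition real_analytic :: "(real \<Rightarrow> 'a::real_normed_vector) \<Rightarrow> bool" where
  "real_analytic f \<longleftrightarrow>
     (\<forall>x. \<exists>\<delta>>0. \<exists>c. \<forall>y. \<bar>y - x\<bar> < \<delta> \<longrightarrow> (\<lambda>m. (y - x) ^ m *\<^sub>R c m) sums f y)"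

fun of_class :: "regularity \<Rightarrow> (real \<Rightarrow> 'a::real_normed_vector) \<Rightarrow> bool" where
  "of_class (Diff r) f = times_cont_diff r f"
| "of_class Analytic f = real_analytic f"

definition holomorphic_extension ::
    "complex set \<Rightarrow> (real \<Rightarrow> real^2^2) \<Rightarrow> (complex \<Rightarrow> complex^2^2) \<Rightarrow> bool" where
  "holomorphic_extension U f F \<longleftrightarrow>
     (\<forall>i j. (\<lambda>z. F z $ i $ j) holomorphic_on U) \<and>
     (\<forall>x. of_real x \<in> U \<longrightarrow> (\<forall>i j. F (of_real x) $ i $ j = of_real (f x $ i $ j)))"

text \<open>
  Convergence on compact subsets of the line. In the analytic case the complex neighbourhood may
  depend on the compact set, but not on the index of the sequence.
\<close>

fun converges_in_class ::
    "regularity \<Rightarrow> (nat \<Rightarrow> real \<Rightarrow> real^2^2) \<Rightarrow> (real \<Rightarrow> real^2^2) \<Rightarrow> bool" where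
  "converges_in_class (Diff r) f g \<longleftrightarrow>
     (\<forall>n. times_cont_diff r (f n)) \<and> times_cont_diff r g \<and>
     (\<forall>k K. enat k \<le> r \<longrightarrow> compact K \<longrightarrow>
        uniform_limit K (\<lambda>n. nth_vderiv k (f n)) (nth_vderiv k g) sequentially)"
| "converges_in_class Analytic f g \<longleftrightarrow>
     (\<forall>K. compact K \<longrightarrow> (\<exists>U F G. open U \<and> of_real ` K \<subseteq> U \<and>
        (\<forall>\<^sub>F n in sequentially. holomorphic_extension U (f n) (F n)) \<and>
        holomorphic_extension U g G \<and> uniform_limit U F G sequentially))"


subsection \<open>Cocycles\<close>

primrec cocycle_pow :: "real \<Rightarrow> (real \<Rightarrow> real^2^2) \<Rightarrow> nat \<Rightarrow> real \<Rightarrow> real^2^2" where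
  "cocycle_pow \<alpha> A 0 x = mat 1"
| "cocycle_pow \<alpha> A (Suc n) x = A (x + real n * \<alpha>) ** cocycle_pow \<alpha> A n x"

definition cocycle_iter :: "real \<Rightarrow> (real \<Rightarrow> real^2^2) \<Rightarrow> int \<Rightarrow> real \<Rightarrow> real^2^2" where
  "cocycle_iter \<alpha> A k x =
     (if 0 \<le> k then cocycle_pow \<alpha> A (nat k) x
      else matrix_inv (cocycle_pow \<alpha> A (nat (- k)) (x + of_int k * \<alpha>)))"

definition L2_conj_rotations :: "real \<Rightarrow> (real \<Rightarrow> real^2^2) \<Rightarrow> bool" where
  "L2_conj_rotations \<alpha> A \<longleftrightarrow>
     (\<exists>B. on_circle B \<and> (\<forall>x. B x \<in> SL2) \<and> B \<in> borel_measurable lebesgue \<and>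
        integrable (lebesgue_on {0..1}) (\<lambda>x. (norm (B x))\<^sup>2) \<and>
        (AE x in lebesgue. rotation_matrix (B (x + \<alpha>) ** A x ** matrix_inv (B x))))"


subsection \<open>Continued fractions and renormalization\<close>

primrec cf_remainder :: "real \<Rightarrow> nat \<Rightarrow> real" where
  "cf_remainder \<alpha> 0 = \<alpha>"
| "cf_remainder \<alpha> (Suc n) = 1 / frac (cf_remainder \<alpha> n)"

definition cf_digit :: "real \<Rightarrow> nat \<Rightarrow> int" where
  "cf_digit \<alpha> n = \<lfloor>cf_remainder \<alpha> n\<rfloor>"

text \<open>
  The auxiliary sequences are shifted by one so that they start with the usual values
  \<open>p\<^sub>-\<^sub>1 = 1\<close> and \<open>q\<^sub>-\<^sub>1 = 0\<close>; the convergents \<open>cf_p \<alpha> k / cf_q \<alpha> k\<close> are then indexed by integers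
  \<open>k \<ge> -1\<close>.
\<close>

fun cf_p_shifted :: "real \<Rightarrow> nat \<Rightarrow> int" where
  "cf_p_shifted \<alpha> 0 = 1"
| "cf_p_shifted \<alpha> (Suc 0) = cf_digit \<alpha> 0"
| "cf_p_shifted \<alpha> (Suc (Suc m)) =
     cf_digit \<alpha> (Suc m) * cf_p_shifted \<alpha> (Suc m) + cf_p_shifted \<alpha> m"

fun cf_q_shifted :: "real \<Rightarrow> nat \<Rightarrow> int" where
  "cf_q_shifted \<alpha> 0 = 0"
| "cf_q_shifted \<alpha> (Suc 0) = 1"
| "cf_q_shifted \<alpha> (Suc (Suc m)) =
     cf_digit \<alpha> (Suc m) * cf_q_shifted \<alpha> (Suc m) + cf_q_shifted \<alpha> m"

definition cf_p :: "real \<Rightarrow> int \<Rightarrow> int" where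
  "cf_p \<alpha> k = cf_p_shifted \<alpha> (nat (k + 1))"

definition cf_q :: "real \<Rightarrow> int \<Rightarrow> int" where
  "cf_q \<alpha> k = cf_q_shifted \<alpha> (nat (k + 1))"

definition alt_sign :: "int \<Rightarrow> int" where
  "alt_sign k = (if even k then 1 else - 1)"

definition cf_beta :: "real \<Rightarrow> int \<Rightarrow> real" where
  "cf_beta \<alpha> k = of_int (alt_sign k) * (of_int (cf_q \<alpha> k) * \<alpha> - of_int (cf_p \<alpha> k))"

definition renorm0 :: "real \<Rightarrow> (real \<Rightarrow> real^2^2) \<Rightarrow> real \<Rightarrow> nat \<Rightarrow> real \<Rightarrow> real^2^2" where
  "renorm0 \<alpha> A xs n x =
     cocycle_iter \<alpha> A (alt_sign (int n - 1) * cf_q \<alpha> (int n - 1))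
       (xs + cf_beta \<alpha> (int n - 1) * x)"

definition renorm1 :: "real \<Rightarrow> (real \<Rightarrow> real^2^2) \<Rightarrow> real \<Rightarrow> nat \<Rightarrow> real \<Rightarrow> real^2^2" where
  "renorm1 \<alpha> A xs n x =
     cocycle_iter \<alpha> A (alt_sign (int n) * cf_q \<alpha> (int n))
       (xs + cf_beta \<alpha> (int n - 1) * x)"

end

theory Submission imports Defs begin

text \<open>
  Let \<open>x\<close> be the base point, \<open>A\<^sub>k\<close> the iterates, and consider times \<open>m\<close> and scales \<open>\<beta>\<close> with
  \<open>m \<bar>\<beta>\<bar> \<le> 1\<close>. Up to a constant, the conjugacy bounds the norm of \<open>A\<^sub>k(x)\<close> by the product of the norms
  of \<open>B(x)\<close> and \<open>B(x + k\<alpha>)\<close>, so for almost every \<open>x\<close> the maximal ergodic inequality (\<open>AE_bounded_averages\<close>)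
  bounds the sum of the first \<open>m\<close> squared norms of the iterates by \<open>S m\<close>.

  Now \<open>A\<^sub>m(x + \<beta>t)\<close> is \<open>A\<^sub>m(x)\<close> times an ordered product of \<open>m\<close> factors close to the identity. To
  first order in \<open>\<beta>\<close> these are linear in \<open>t\<close>, and by the bound on averages both the sum of the
  linear parts is bounded and the sum of the remainders tends to 0, in every norm allowed by the
  class of \<open>A\<close> (\<open>near_prod_exact_tangent\<close>). Hence the renormalized iterates are asymptotic to
  polynomials in \<open>t\<close> with a bound \<open>C exp (K \<bar>t\<bar>)\<close> on the complex plane
  (\<open>norm_near_prod_tangent_le\<close>). Even when \<open>A\<close> is only continuously differentiable, all limits are
  entire functions of exponential type, and locally uniform convergence of the polynomials on the
  complex plane controls all derivatives.

  It remains to identify the limits. Almost every \<open>x\<close> is a point of approximate continuity of \<open>B\<close>.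
  If \<open>m\<alpha>\<close> is within \<open>\<bar>\<beta>\<bar>\<close> of an integer, then near every \<open>t\<close> there is an \<open>s\<close> such that \<open>B\<close> is close
  to \<open>B(x)\<close> both at \<open>x + \<beta>s\<close> and at \<open>x + \<beta>s + m\<alpha>\<close>, and so \<open>B(x) A\<^sub>m(x + \<beta>s) B(x)\<^sup>-\<^sup>1\<close> is close to a
  rotation (\<open>renormalized_near_rotation\<close>). The limits, conjugated by \<open>B(x)\<close>, are thus rotations on
  the line. Diagonalizing the complex rotations turns a limit into a zero-free entire function
  of exponential type and modulus 1 on the line, which must be \<open>exp (\<i> (a t + b))\<close>
  (\<open>entire_zero_free_exp_type\<close>). Since the phase can be read off from value and derivative at 0,
  one choice of affine phases works for the whole sequence (\<open>asymptotic_rotations_affine_phase\<close>).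

  The renormalizations are of this kind, with \<open>\<beta> = \<beta>\<^sub>n\<^sub>-\<^sub>1\<close> and times \<open>q\<^sub>n\<^sub>-\<^sub>1\<close> and \<open>q\<^sub>n\<close>, except that they
  alternate between positive and negative iterates. The negative ones are iterates of the inverse
  cocycle over the opposite rotation, which \<open>B\<close> conjugates to rotations as well.
\<close>

no_notation fps_nth (infixl "$" 75)

section \<open>Convergents and return times\<close>

text \<open>
  The distances \<open>\<beta>\<^sub>n\<^sub>-\<^sub>1\<close>, indexed by natural numbers from \<open>\<beta>\<^sub>-\<^sub>1 = 1\<close> on.
\<close>

definition cf_gap :: "real \<Rightarrow> nat \<Rightarrow> real" where
  "cf_gap \<alpha> n = cf_beta \<alpha> (int n - 1)"

lemma cf_gap_shifted:
  "cf_gap \<alpha> n = (if even n then -1 else 1) * (of_int (cf_q_shifted \<alpha> n) * \<alpha> - of_int (cf_p_shifted \<alpha> n))"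
  by (simp add: cf_gap_def cf_beta_def cf_q_def cf_p_def alt_sign_def)

lemma cf_gap_rec:
  "cf_gap \<alpha> (Suc (Suc n)) = cf_gap \<alpha> n - of_int (cf_digit \<alpha> (Suc n)) * cf_gap \<alpha> (Suc n)"
  by (simp add: cf_gap_shifted algebra_simps)

lemma cf_remainder_irrational: "\<alpha> \<notin> \<rat> \<Longrightarrow> cf_remainder \<alpha> n \<notin> \<rat>"
proof (induction n)
  case (Suc n)
  have "frac (cf_remainder \<alpha> n) \<notin> \<rat>"
  proof
    assume "frac (cf_remainder \<alpha> n) \<in> \<rat>"
    then have "frac (cf_remainder \<alpha> n) + of_int \<lfloor>cf_remainder \<alpha> n\<rfloor> \<in> \<rat>"
      by (intro Rats_add Rats_of_int)
    then show False using Suc by (simp add: frac_def)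
  qed
  then have "1 / frac (cf_remainder \<alpha> n) \<notin> \<rat>"
    using Rats_divide[OF Rats_1, of "1 / frac (cf_remainder \<alpha> n)"] by auto
  then show ?case by simp
qed simp

text \<open>
  The ratio of consecutive gaps is the fractional part from which the next digit is read off;
  positivity then follows because no remainder is rational.
\<close>

lemma cf_gap_pos_step:
  assumes "0 < \<alpha>" "\<alpha> < 1" "\<alpha> \<notin> \<rat>"
  shows "0 < cf_gap \<alpha> n \<and> cf_gap \<alpha> (Suc n) = frac (cf_remainder \<alpha> n) * cf_gap \<alpha> n"
proof (induction n)
  case 0
  show ?case using assms
    by (simp add: cf_gap_shifted cf_digit_def frac_def)
next
  case (Suc n)
  have fp: "0 < frac (cf_remainder \<alpha> n)"
    using cf_remainder_irrational[OF assms(3), of n] by (metis Ints_subset_Rats frac_gt_0_iff subsetD)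
  have pos: "0 < cf_gap \<alpha> (Suc n)" using Suc fp by simp
  have "cf_gap \<alpha> n = cf_remainder \<alpha> (Suc n) * cf_gap \<alpha> (Suc n)"
    using Suc fp by (simp add: field_simps)
  then have "cf_gap \<alpha> (Suc (Suc n)) = frac (cf_remainder \<alpha> (Suc n)) * cf_gap \<alpha> (Suc n)"
    unfolding cf_gap_rec cf_digit_def frac_def by (simp add: algebra_simps)
  with pos show ?case by blast
qed

lemma
  assumes "0 < \<alpha>" "\<alpha> < 1" "\<alpha> \<notin> \<rat>"
  shows cf_gap_pos: "0 < cf_gap \<alpha> n"
    and cf_gap_Suc_le: "cf_gap \<alpha> (Suc n) \<le> cf_gap \<alpha> n"
    and cf_digit_ge_1: "1 \<le> cf_digit \<alpha> (Suc n)"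
proof -
  show pos: "0 < cf_gap \<alpha> n" for n using cf_gap_pos_step[OF assms] by blast
  have "frac (cf_remainder \<alpha> n) * cf_gap \<alpha> n \<le> 1 * cf_gap \<alpha> n"
    using pos[of n] by (intro mult_right_mono) (auto intro: less_imp_le frac_lt_1)
  then show "cf_gap \<alpha> (Suc n) \<le> cf_gap \<alpha> n" using cf_gap_pos_step[OF assms, of n] by simp
  have "0 < frac (cf_remainder \<alpha> n)"
    using pos[of n] pos[of "Suc n"] cf_gap_pos_step[OF assms, of n] by (simp add: zero_less_mult_iff)
  then have "1 \<le> cf_remainder \<alpha> (Suc n)" using frac_lt_1[of "cf_remainder \<alpha> n"] by simp
  then show "1 \<le> cf_digit \<alpha> (Suc n)" unfolding cf_digit_def by linarith
qed

lemma cf_gap_tendsto_0: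
  assumes "0 < \<alpha>" "\<alpha> < 1" "\<alpha> \<notin> \<rat>"
  shows "cf_gap \<alpha> \<longlonglongrightarrow> 0"
proof -
  note pos = cf_gap_pos[OF assms] and le = cf_gap_Suc_le[OF assms]
  \<comment> \<open>Two steps halve the gap, because every digit after the first is at least 1.\<close>
  have half: "cf_gap \<alpha> (Suc (Suc n)) \<le> cf_gap \<alpha> n / 2" for n
  proof -
    have "1 * cf_gap \<alpha> (Suc n) \<le> of_int (cf_digit \<alpha> (Suc n)) * cf_gap \<alpha> (Suc n)"
      using pos[of "Suc n"] cf_digit_ge_1[OF assms, of n] by (intro mult_right_mono) auto
    then show ?thesis using cf_gap_rec[of \<alpha> n] le[of "Suc n"] by linarith
  qed
  have "decseq (cf_gap \<alpha>)" using le by (simp add: decseq_Suc_iff)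
  then obtain L where L: "cf_gap \<alpha> \<longlonglongrightarrow> L"
    by (rule decseq_convergent[of "cf_gap \<alpha>" 0]) (use pos in \<open>auto intro: less_imp_le\<close>)
  have "(\<lambda>n. cf_gap \<alpha> (Suc (Suc n))) \<longlonglongrightarrow> L"
    using LIMSEQ_ignore_initial_segment[OF L, of 2] by simp
  then have "L \<le> L / 2" using half tendsto_divide[OF L tendsto_const, of 2]
    by (intro LIMSEQ_le[of "\<lambda>n. cf_gap \<alpha> (Suc (Suc n))" _ "\<lambda>n. cf_gap \<alpha> n / 2"]) auto
  moreover have "0 \<le> L" using pos L by (intro LIMSEQ_le_const[OF L]) (auto intro: less_imp_le)
  ultimately have "L = 0" by simp
  with L show ?thesis by simp
qed

lemma cf_q_shifted_mono:
  assumes "0 < \<alpha>" "\<alpha> < 1" "\<alpha> \<notin> \<rat>"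
  shows "0 \<le> cf_q_shifted \<alpha> n \<and> cf_q_shifted \<alpha> n \<le> cf_q_shifted \<alpha> (Suc n)"
proof (induction n)
  case (Suc n)
  have "1 * cf_q_shifted \<alpha> (Suc n) \<le> cf_digit \<alpha> (Suc n) * cf_q_shifted \<alpha> (Suc n)"
    using Suc cf_digit_ge_1[OF assms, of n] by (intro mult_right_mono) auto
  then show ?case using Suc by simp
qed simp

text \<open>
  The determinant identity for consecutive convergents. It is the source of the two bounds that
  follow: at scale \<open>\<beta>\<^sub>n\<^sub>-\<^sub>1\<close> both renormalization times have length at most 1.
\<close>

lemma cf_gap_q_identity:
  assumes "0 < \<alpha>" "\<alpha> < 1"
  shows "of_int (cf_q_shifted \<alpha> (Suc n)) * cf_gap \<alpha> n + of_int (cf_q_shifted \<alpha> n) * cf_gap \<alpha> (Suc n) = 1"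
proof (induction n)
  case (Suc n)
  then show ?case by (simp add: cf_gap_rec algebra_simps)
qed (simp add: cf_gap_shifted)

lemma cf_q_gap_le_1:
  assumes "0 < \<alpha>" "\<alpha> < 1" "\<alpha> \<notin> \<rat>"
  shows "of_int (cf_q_shifted \<alpha> n) * cf_gap \<alpha> n \<le> 1"
    and "of_int (cf_q_shifted \<alpha> (Suc n)) * cf_gap \<alpha> n \<le> 1"
proof -
  have "0 \<le> of_int (cf_q_shifted \<alpha> n) * cf_gap \<alpha> (Suc n)"
    using cf_q_shifted_mono[OF assms, of n] cf_gap_pos[OF assms, of "Suc n"] by simp
  then show 2: "of_int (cf_q_shifted \<alpha> (Suc n)) * cf_gap \<alpha> n \<le> 1"
    using cf_gap_q_identity[OF assms(1,2), of n] by linarith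
  have "of_int (cf_q_shifted \<alpha> n) * cf_gap \<alpha> n \<le> of_int (cf_q_shifted \<alpha> (Suc n)) * cf_gap \<alpha> n"
    using cf_q_shifted_mono[OF assms, of n] cf_gap_pos[OF assms, of n] by (intro mult_right_mono) auto
  with 2 show "of_int (cf_q_shifted \<alpha> n) * cf_gap \<alpha> n \<le> 1" by linarith
qed

lemma cf_q_dist_int:
  assumes "0 < \<alpha>" "\<alpha> < 1" "\<alpha> \<notin> \<rat>"
  shows "\<bar>of_int (cf_q_shifted \<alpha> n) * \<alpha> - of_int (cf_p_shifted \<alpha> n)\<bar> = cf_gap \<alpha> n"
  using cf_gap_pos[OF assms, of n] by (auto simp: cf_gap_shifted split: if_splits)

section \<open>Density points and approximate continuity\<close>

text \<open>
  Lebesgue density by the Vitali covering theorem. Choosing an open \<open>U\<close> around \<open>E\<close> with \<open>U - E\<close>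
  small bounds the outer measure of the exceptional set.
\<close>

lemma negligible_low_density_points:
  fixes E :: "real set"
  assumes E: "E \<in> sets lebesgue" and \<eta>: "0 < \<eta>"
  shows "negligible {x \<in> E. \<forall>d>0. \<exists>r. 0 < r \<and> r < d \<and> \<eta> * r \<le> measure lebesgue (cball x r - E)}"
    (is "negligible ?N")
  unfolding negligible_outer_le
proof (intro allI impI)
  fix e :: real assume e: "0 < e"
  define \<delta> where "\<delta> = e * \<eta> / 2"
  have "0 < \<delta>" using e \<eta> by (simp add: \<delta>_def)
  then obtain U where U: "open U" "E \<subseteq> U" "U - E \<in> lmeasurable" "emeasure lebesgue (U - E) < ennreal \<delta>"
    using sets_lebesgue_outer_open[OF E] by metis
  \<comment> \<open>Every low-density point is covered by arbitrarily small intervals that lose a fixed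
    proportion to the thin set \<open>U - E\<close>, so a disjoint subfamily has total length at most \<open>e\<close>.\<close>
  define K where "K = {(x, r). x \<in> ?N \<and> 0 < r \<and> cball x r \<subseteq> U \<and> \<eta> * r \<le> measure lebesgue (cball x r - E)}"
  have cover: "\<exists>i. i \<in> K \<and> x \<in> cball (fst i) (snd i) \<and> snd i < d" if x: "x \<in> ?N" and d: "0 < d" for x d
  proof -
    have "x \<in> U" using x U(2) by auto
    then obtain d' where d': "0 < d'" "cball x d' \<subseteq> U"
      using U(1) open_contains_cball[of U] by blast
    have "0 < min d d'" using d d'(1) by simp
    with x have "\<exists>r. 0 < r \<and> r < min d d' \<and> \<eta> * r \<le> measure lebesgue (cball x r - E)"
      by blast
    then obtain r where r: "0 < r" "r < min d d'" "\<eta> * r \<le> measure lebesgue (cball x r - E)"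
      by blast
    have "cball x r \<subseteq> cball x d'" using r(2) by (intro subset_cball) auto
    then have "(x, r) \<in> K" using r d' x unfolding K_def by auto
    then show ?thesis using r by (intro exI[of _ "(x, r)"]) auto
  qed
  obtain C where C: "countable C" "C \<subseteq> K"
    "pairwise (\<lambda>i j. disjnt (cball (fst i) (snd i)) (cball (fst j) (snd j))) C"
    "negligible (?N - (\<Union>i \<in> C. cball (fst i) (snd i)))"
  proof (rule Vitali_covering_theorem_cballs[of K snd ?N fst])
    show "0 < snd i" if "i \<in> K" for i using that by (auto simp: K_def)
  qed (use cover in blast)+
  let ?B = "\<lambda>i::real \<times> real. cball (fst i) (snd i)"
  have disj: "disjoint_family_on ?B C"
    using C(3) by (auto simp: disjoint_family_on_def pairwise_def disjnt_def)
  have disj2: "disjoint_family_on (\<lambda>i. ?B i - E) C"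
    using disj unfolding disjoint_family_on_def by blast
  have "emeasure lebesgue (\<Union>i\<in>C. ?B i) = (\<integral>\<^sup>+i. emeasure lebesgue (?B i) \<partial>count_space C)"
    using C(1) disj by (intro emeasure_UN_countable) auto
  also have "\<dots> \<le> (\<integral>\<^sup>+i. ennreal (2 / \<eta>) * emeasure lebesgue (?B i - E) \<partial>count_space C)"
  proof (rule nn_integral_mono)
    fix i assume "i \<in> space (count_space C)"
    then have i: "i \<in> K" using C(2) by auto
    have "emeasure lebesgue (?B i) = ennreal (2 * snd i)"
      using i by (simp add: K_def cball_eq_atLeastAtMost split: prod.splits)
    also have "\<dots> \<le> ennreal ((2 / \<eta>) * measure lebesgue (?B i - E))"
      using i \<eta> by (intro ennreal_leI) (auto simp: K_def field_simps)
    also have "\<dots> = ennreal (2 / \<eta>) * emeasure lebesgue (?B i - E)"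
    proof -
      have "?B i - E \<in> lmeasurable" using E by (intro fmeasurable_Diff) auto
      then show ?thesis using \<eta>
        by (subst ennreal_mult) (auto simp: emeasure_eq_measure2)
    qed
    finally show "emeasure lebesgue (?B i) \<le> \<dots>" .
  qed
  also have "\<dots> = ennreal (2 / \<eta>) * (\<integral>\<^sup>+i. emeasure lebesgue (?B i - E) \<partial>count_space C)"
    by (rule nn_integral_cmult) auto
  also have "(\<integral>\<^sup>+i. emeasure lebesgue (?B i - E) \<partial>count_space C) = emeasure lebesgue (\<Union>i\<in>C. ?B i - E)"
    using C(1) disj2 E by (intro emeasure_UN_countable[symmetric]) auto
  also have "\<dots> \<le> emeasure lebesgue (U - E)"
  proof (rule emeasure_mono)
    have "?B i \<subseteq> U" if "i \<in> C" for i
    proof -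
      have "i \<in> K" using C(2) that by blast
      then show ?thesis by (simp add: K_def case_prod_unfold)
    qed
    then show "(\<Union>i\<in>C. ?B i - E) \<subseteq> U - E" by blast
  qed (use U(3) in auto)
  also have "\<dots> \<le> ennreal \<delta>" using U(4) by simp
  also have "ennreal (2 / \<eta>) * ennreal \<delta> = ennreal e"
    using \<eta> e by (simp add: \<delta>_def ennreal_mult[symmetric])
  finally have le: "emeasure lebesgue (\<Union>i\<in>C. ?B i) \<le> ennreal e"
    by (simp add: mult_left_mono)
  let ?T = "(\<Union>i\<in>C. ?B i) \<union> (?N - (\<Union>i\<in>C. ?B i))"
  have meas: "(\<Union>i\<in>C. ?B i) \<in> sets lebesgue" using C(1) by (intro sets.countable_UN') auto
  have null: "?N - (\<Union>i\<in>C. ?B i) \<in> null_sets lebesgue" using C(4) by (simp add: negligible_iff_null_sets)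
  have eq: "emeasure lebesgue ?T = emeasure lebesgue (\<Union>i\<in>C. ?B i)"
    using meas null by (rule emeasure_Un_null_set)
  show "\<exists>T. ?N \<subseteq> T \<and> T \<in> lmeasurable \<and> measure lebesgue T \<le> e"
  proof (intro exI[of _ ?T] conjI)
    show "?T \<in> lmeasurable"
    proof (rule fmeasurableI)
      show "?T \<in> sets lebesgue" by (intro sets.Un meas null_setsD2[OF null])
      show "emeasure lebesgue ?T < \<infinity>" unfolding eq using le by (rule le_less_trans) simp
    qed
    show "measure lebesgue ?T \<le> e"
      using eq le e by (simp add: measure_def enn2real_leI)
  qed auto
qed

theorem AE_density_point:
  fixes E :: "real set"
  assumes E: "E \<in> sets lebesgue"
  shows "AE x in lebesgue. x \<in> E \<longrightarrow>
    (\<forall>\<eta>>0. \<exists>d>0. \<forall>r. 0 < r \<and> r < d \<longrightarrow> measure lebesgue (cball x r - E) < \<eta> * r)"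
proof -
  have "AE x in lebesgue. \<forall>k::nat. x \<notin> {x \<in> E. \<forall>d>0. \<exists>r. 0 < r \<and> r < d \<and>
      inverse (real (Suc k)) * r \<le> measure lebesgue (cball x r - E)}"
    unfolding AE_all_countable
    using negligible_low_density_points[OF E]
    by (intro allI AE_not_in) (auto simp: negligible_iff_null_sets)
  then show ?thesis
  proof eventually_elim
    case (elim x)
    show ?case
    proof (intro impI allI)
      fix \<eta> :: real assume "x \<in> E" "0 < \<eta>"
      obtain k where k: "inverse (real (Suc k)) < \<eta>" using reals_Archimedean[OF \<open>0 < \<eta>\<close>] by blast
      obtain d where d: "0 < d" "\<And>r. 0 < r \<Longrightarrow> r < d \<Longrightarrow> measure lebesgue (cball x r - E) < inverse (real (Suc k)) * r"
        using elim \<open>x \<in> E\<close> by (auto simp: not_le dest!: spec[of _ k])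
      show "\<exists>d>0. \<forall>r. 0 < r \<and> r < d \<longrightarrow> measure lebesgue (cball x r - E) < \<eta> * r"
      proof (intro exI[of _ d] conjI allI impI)
        fix r assume r: "0 < r \<and> r < d"
        then have "inverse (real (Suc k)) * r < \<eta> * r" using k by (intro mult_strict_right_mono) auto
        with d(2)[of r] r show "measure lebesgue (cball x r - E) < \<eta> * r" by linarith
      qed (rule d)
    qed
  qed
qed

text \<open>
  Density points of the preimages of a countable base: there the values of the map are close to
  its value at the point, except on a set of density zero.
\<close>

theorem AE_approx_continuous:
  fixes f :: "real \<Rightarrow> 'a::{metric_space, second_countable_topology}"
  assumes f: "f \<in> borel_measurable lebesgue"
  shows "AE x in lebesgue. \<forall>\<epsilon>>0. \<forall>\<eta>>0. \<exists>d>0. \<forall>r. 0 < r \<and> r < d \<longrightarrow>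
    measure lebesgue (cball x r - {y. dist (f y) (f x) < \<epsilon>}) < \<eta> * r"
proof -
  obtain \<B> :: "'a set set" where \<B>: "countable \<B>" "topological_basis \<B>"
    using ex_countable_basis by blast
  have op: "open S" if "S \<in> \<B>" for S using \<B>(2) that by (simp add: topological_basis_open)
  have ms: "f -` S \<in> sets lebesgue" if "open S" for S
    using measurable_sets[OF f, of S] that by simp
  have "AE x in lebesgue. \<forall>S\<in>\<B>. x \<in> f -` S \<longrightarrow>
    (\<forall>\<eta>>0. \<exists>d>0. \<forall>r. 0 < r \<and> r < d \<longrightarrow> measure lebesgue (cball x r - f -` S) < \<eta> * r)"
    using AE_density_point[OF ms[OF op]] \<B>(1) by (subst AE_ball_countable) auto
  then show ?thesis
  proof eventually_elim
    case (elim x)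
    show ?case
    proof (intro allI impI)
      fix \<epsilon> \<eta> :: real assume "0 < \<epsilon>" "0 < \<eta>"
      obtain S where S: "S \<in> \<B>" "f x \<in> S" "S \<subseteq> ball (f x) \<epsilon>"
        using \<B>(2) \<open>0 < \<epsilon>\<close> by (metis centre_in_ball open_ball topological_basisE)
      have "x \<in> f -` S" using S(2) by simp
      with elim S(1) \<open>0 < \<eta>\<close> obtain d where d: "0 < d"
        "\<And>r. 0 < r \<Longrightarrow> r < d \<Longrightarrow> measure lebesgue (cball x r - f -` S) < \<eta> * r"
        by meson
      show "\<exists>d>0. \<forall>r. 0 < r \<and> r < d \<longrightarrow> measure lebesgue (cball x r - {y. dist (f y) (f x) < \<epsilon>}) < \<eta> * r"
      proof (intro exI[of _ d] conjI allI impI)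
        fix r assume r: "0 < r \<and> r < d"
        have 1: "cball x r - f -` S \<in> lmeasurable"
          using ms[OF op[OF S(1)]] by (intro fmeasurable_Diff) auto
        have "{y. dist (f y) (f x) < \<epsilon>} = f -` ball (f x) \<epsilon>" by (auto simp: dist_commute)
        then have "measure lebesgue (cball x r - {y. dist (f y) (f x) < \<epsilon>}) \<le> measure lebesgue (cball x r - f -` S)"
          using S(3) ms[of "ball (f x) \<epsilon>"] by (intro measure_mono_fmeasurable[OF _ _ 1]) auto
        with d(2)[of r] r show "measure lebesgue (cball x r - {y. dist (f y) (f x) < \<epsilon>}) < \<eta> * r" by linarith
      qed (rule d)
    qed
  qed
qed

section \<open>Bounded ergodic averages over a rotation\<close>

lemma nn_integral_lebesgue_shift:
  fixes h :: "real \<Rightarrow> ennreal"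
  assumes "h \<in> borel_measurable lebesgue"
  shows "(\<integral>\<^sup>+x. h (x + a) \<partial>lebesgue) = (\<integral>\<^sup>+x. h x \<partial>lebesgue)"
  using nn_integral_real_affine_lebesgue[of h 1 a] assms by (simp add: add.commute)

lemma lebesgue_measurable_times_indicator:
  fixes h :: "real \<Rightarrow> ennreal"
  assumes "h \<in> borel_measurable lebesgue"
  shows "(\<lambda>x. h x * indicator {a..<b} x) \<in> borel_measurable lebesgue"
proof -
  have "{a..<b} \<in> sets lebesgue" by simp
  then show ?thesis using assms by (intro borel_measurable_times_ennreal borel_measurable_indicator)
qed

lemma measurable_lebesgue_shift:
  fixes h :: "real \<Rightarrow> 'a::topological_space"
  assumes "h \<in> borel_measurable lebesgue"
  shows "(\<lambda>x. h (x + a)) \<in> borel_measurable lebesgue"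
proof -
  have "(\<lambda>x::real. a + 1 * x) \<in> lebesgue \<rightarrow>\<^sub>M lebesgue"
    using lebesgue_affine_measurable[of "\<lambda>_. 1::real" a] by simp
  from measurable_compose[OF this assms] show ?thesis by (simp add: add.commute)
qed

lemma periodic_int:
  assumes "on_circle f" shows "f (x + of_int j) = f x"
proof -
  have nat: "f (x + real n) = f x" for x n
  proof (induction n)
    case (Suc n)
    have "f (x + real n + 1) = f (x + real n)" using assms unfolding on_circle_def by blast
    then show ?case using Suc by (simp add: add_ac)
  qed simp
  show ?thesis
  proof (cases "0 \<le> j")
    case True
    then show ?thesis using nat[of x "nat j"] by simp
  next
    case False
    then show ?thesis using nat[of "x + of_int j" "nat (- j)"] by simp
  qed
qed

lemma AE_periodicI:
  assumes ae: "AE x in lebesgue. 0 \<le> x \<and> x < 1 \<longrightarrow> P x" and per: "on_circle P"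
  shows "AE x::real in lebesgue. P x"
proof -
  obtain N where N: "N \<in> null_sets lebesgue" "{x. \<not> (0 \<le> x \<and> x < 1 \<longrightarrow> P x)} \<subseteq> N"
    using ae by (auto simp: eventually_ae_filter)
  have "(\<Union>j::int. (+) (of_int j) ` N) \<in> null_sets lebesgue"
    using N(1) negligible_translation by (intro null_sets_UN) (auto simp: negligible_iff_null_sets[symmetric])
  moreover have "{x. \<not> P x} \<subseteq> (\<Union>j::int. (+) (of_int j) ` N)"
  proof
    fix x assume "x \<in> {x. \<not> P x}"
    then have "\<not> P (frac x)"
      using periodic_int[OF per, of "frac x" "\<lfloor>x\<rfloor>"] by (simp add: frac_def)
    then have "frac x \<in> N" using N(2) frac_lt_1[of x] by auto
    moreover have "x = of_int \<lfloor>x\<rfloor> + frac x" by (simp add: frac_def)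
    ultimately show "x \<in> (\<Union>j::int. (+) (of_int j) ` N)" by blast
  qed
  ultimately show ?thesis by (intro AE_I'[of "\<Union>j::int. (+) (of_int j) ` N"]) auto
qed

text \<open>
  A shift of the fundamental domain is undone by moving its overhanging part back by one period.
\<close>

lemma nn_integral_periodic_shift:
  fixes h :: "real \<Rightarrow> ennreal"
  assumes h: "h \<in> borel_measurable lebesgue" and per: "on_circle h"
  shows "(\<integral>\<^sup>+x. h (x + a) * indicator {0..<1} x \<partial>lebesgue) = (\<integral>\<^sup>+x. h x * indicator {0..<1} x \<partial>lebesgue)"
proof -
  define b where "b = frac a"
  have b: "0 \<le> b" "b < 1" by (auto simp: b_def frac_lt_1)
  have hb: "h (x + a) = h (x + b)" for x
    using periodic_int[OF per, of "x + b" "\<lfloor>a\<rfloor>"] by (simp add: b_def frac_def)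
  have "(\<integral>\<^sup>+x. h (x + a) * indicator {0..<1} x \<partial>lebesgue)
      = (\<integral>\<^sup>+x. h (x + b) * indicator {b..<1+b} (x + b) \<partial>lebesgue)"
    unfolding hb by (intro nn_integral_cong) (auto simp: indicator_def)
  also have "\<dots> = (\<integral>\<^sup>+x. h x * indicator {b..<1+b} x \<partial>lebesgue)"
    by (intro nn_integral_lebesgue_shift[of "\<lambda>x. h x * indicator {b..<1+b} x"] lebesgue_measurable_times_indicator h)
  also have "\<dots> = (\<integral>\<^sup>+x. h x * indicator {b..<1} x + h x * indicator {1..<1+b} x \<partial>lebesgue)"
    using b by (intro nn_integral_cong) (auto simp: indicator_def)
  also have "\<dots> = (\<integral>\<^sup>+x. h x * indicator {b..<1} x \<partial>lebesgue) + (\<integral>\<^sup>+x. h x * indicator {1..<1+b} x \<partial>lebesgue)"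
    by (intro nn_integral_add lebesgue_measurable_times_indicator h)
  also have "(\<integral>\<^sup>+x. h x * indicator {1..<1+b} x \<partial>lebesgue) = (\<integral>\<^sup>+x. h (x + 1) * indicator {1..<1+b} (x + 1) \<partial>lebesgue)"
    by (intro nn_integral_lebesgue_shift[of "\<lambda>x. h x * indicator {1..<1+b} x", symmetric] lebesgue_measurable_times_indicator h)
  also have "\<dots> = (\<integral>\<^sup>+x. h x * indicator {0..<b} x \<partial>lebesgue)"
    using per by (intro nn_integral_cong) (auto simp: indicator_def on_circle_def)
  also have "(\<integral>\<^sup>+x. h x * indicator {b..<1} x \<partial>lebesgue) + (\<integral>\<^sup>+x. h x * indicator {0..<b} x \<partial>lebesgue)
      = (\<integral>\<^sup>+x. h x * indicator {b..<1} x + h x * indicator {0..<b} x \<partial>lebesgue)"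
    by (intro nn_integral_add[symmetric] lebesgue_measurable_times_indicator h)
  also have "\<dots> = (\<integral>\<^sup>+x. h x * indicator {0..<1} x \<partial>lebesgue)"
    using b by (intro nn_integral_cong) (auto simp: indicator_def)
  finally show ?thesis .
qed

text \<open>
  The maximum of 0 and the sums of \<open>f - l\<close> over the first \<open>k \<le> n\<close> points of the orbit, in the
  recursive form used in Garsia's proof of the maximal ergodic theorem.
\<close>

primrec excess :: "real \<Rightarrow> (real \<Rightarrow> real) \<Rightarrow> real \<Rightarrow> nat \<Rightarrow> real \<Rightarrow> real" where
  "excess \<alpha> f l 0 x = 0"
| "excess \<alpha> f l (Suc n) x = max 0 (f x - l + excess \<alpha> f l n (x + \<alpha>))"

lemma excess_nonneg: "0 \<le> excess \<alpha> f l n x"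
  by (induction n) simp_all

lemma excess_mono: "excess \<alpha> f l n x \<le> excess \<alpha> f l (Suc n) x"
proof (induction n arbitrary: x)
  case (Suc n)
  from Suc[of "x + \<alpha>"] show ?case by (simp only: excess.simps(2))
qed simp

lemma excess_ge_sum: "(\<Sum>k<n. f (x + real k * \<alpha>) - l) \<le> excess \<alpha> f l n x"
proof (induction n arbitrary: x)
  case (Suc n)
  have "(\<Sum>k<Suc n. f (x + real k * \<alpha>) - l) = f x - l + (\<Sum>k<n. f ((x + \<alpha>) + real k * \<alpha>) - l)"
    by (simp only: sum.lessThan_Suc_shift) (simp add: algebra_simps)
  with Suc[of "x + \<alpha>"] show ?case by simp
qed simp

lemma excess_measurable:
  assumes "f \<in> borel_measurable lebesgue"
  shows "excess \<alpha> f l n \<in> borel_measurable lebesgue"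
proof (induction n)
  case (Suc n)
  then have [measurable]: "(\<lambda>x. excess \<alpha> f l n (x + \<alpha>)) \<in> borel_measurable lebesgue"
    by (rule measurable_lebesgue_shift)
  note assms[measurable]
  show ?case by simp
qed simp

lemma excess_periodic:
  assumes "on_circle f" shows "on_circle (excess \<alpha> f l n)"
proof (induction n)
  case (Suc n)
  have "excess \<alpha> f l n (x + 1 + \<alpha>) = excess \<alpha> f l n (x + \<alpha>)" for x
    using Suc unfolding on_circle_def by (metis add.assoc add.commute)
  then show ?case using assms by (simp add: on_circle_def)
qed (simp add: on_circle_def)

text \<open>
  Garsia's argument: where the excess is positive, it is at most \<open>f - l\<close> plus the excess at the
  next point of the orbit. Integration over a period cancels the two excess terms and leaves the
  measure of the set, multiplied by \<open>l\<close>, against the integral of \<open>f\<close>.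
\<close>

lemma maximal_inequality:
  fixes f :: "real \<Rightarrow> real"
  assumes f: "f \<in> borel_measurable lebesgue" "on_circle f" "\<And>x. 0 \<le> f x" and l: "0 < l"
    and fin: "(\<integral>\<^sup>+x. ennreal (f x) * indicator {0..<1} x \<partial>lebesgue) < \<infinity>"
  shows "ennreal l * emeasure lebesgue {x. 0 \<le> x \<and> x < 1 \<and> 0 < excess \<alpha> f l n x}
    \<le> (\<integral>\<^sup>+x. ennreal (f x) * indicator {0..<1} x \<partial>lebesgue)"
proof -
  let ?I = "\<lambda>h :: real \<Rightarrow> real. \<integral>\<^sup>+x. ennreal (h x) * indicator {0..<1} x \<partial>lebesgue"
  let ?M = "excess \<alpha> f l"
  let ?E = "{x. 0 \<le> x \<and> x < 1 \<and> 0 < ?M n x}"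
  note [measurable] = f(1) excess_measurable[OF f(1)] measurable_lebesgue_shift[OF excess_measurable[OF f(1)]]
  have shift: "?I (\<lambda>x. ?M n (x + \<alpha>)) = ?I (?M n)" for n
    using excess_periodic[OF f(2)] by (intro nn_integral_periodic_shift) (auto simp: on_circle_def)
  have finM: "?I (?M n) < \<infinity>" for n
  proof (induction n)
    case (Suc n)
    have "?I (?M (Suc n)) \<le> (\<integral>\<^sup>+x. ennreal (f x) * indicator {0..<1} x + ennreal (?M n (x + \<alpha>)) * indicator {0..<1} x \<partial>lebesgue)"
    proof (intro nn_integral_mono)
      fix x :: real
      have "?M (Suc n) x \<le> f x + ?M n (x + \<alpha>)"
        using f(3)[of x] excess_nonneg[of \<alpha> f l n "x + \<alpha>"] l by simp
      then have "ennreal (?M (Suc n) x) \<le> ennreal (f x) + ennreal (?M n (x + \<alpha>))"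
        using f(3)[of x] excess_nonneg[of \<alpha> f l n "x + \<alpha>"] by (simp add: ennreal_plus[symmetric] ennreal_leI del: ennreal_plus)
      then show "ennreal (?M (Suc n) x) * indicator {0..<1} x \<le> ennreal (f x) * indicator {0..<1} x + ennreal (?M n (x + \<alpha>)) * indicator {0..<1} x"
        by (auto simp: indicator_def)
    qed
    also have "\<dots> = ?I f + ?I (\<lambda>x. ?M n (x + \<alpha>))"
      by (intro nn_integral_add lebesgue_measurable_times_indicator) auto
    also have "\<dots> < \<infinity>" using Suc fin unfolding shift by simp
    finally show ?case .
  qed simp
  \<comment> \<open>The threshold is moved to the left, so that all integrands are nonnegative and the finite
    integral of \<open>?M n\<close> can be cancelled at the end.\<close>
  have "?I (?M n) + ennreal l * emeasure lebesgue ?E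
      = (\<integral>\<^sup>+x. ennreal (?M n x) * indicator {0..<1} x + ennreal l * indicator ?E x \<partial>lebesgue)"
  proof -
    have E: "?E \<in> sets lebesgue"
    proof -
      have "{x. 0 < ?M n x} \<in> sets lebesgue" using measurable_sets[OF excess_measurable[OF f(1)], of "{0<..}"]
        by (simp add: vimage_def)
      then have "{0..<1} \<inter> {x. 0 < ?M n x} \<in> sets lebesgue" by auto
      also have "{0..<1} \<inter> {x. 0 < ?M n x} = ?E" by auto
      finally show ?thesis .
    qed
    then have "(\<lambda>x. ennreal l * indicator ?E x) \<in> borel_measurable lebesgue"
      by (intro borel_measurable_times_ennreal borel_measurable_indicator) auto
    moreover have "(\<lambda>x. ennreal (?M n x)) \<in> borel_measurable lebesgue" by simp
    ultimately have "(\<integral>\<^sup>+x. ennreal (?M n x) * indicator {0..<1} x + ennreal l * indicator ?E x \<partial>lebesgue)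
        = ?I (?M n) + (\<integral>\<^sup>+x. ennreal l * indicator ?E x \<partial>lebesgue)"
      by (intro nn_integral_add lebesgue_measurable_times_indicator)
    then show ?thesis by (simp only: nn_integral_cmult_indicator[OF E])
  qed
  also have "\<dots> \<le> (\<integral>\<^sup>+x. ennreal (f x) * indicator {0..<1} x + ennreal (?M n (x + \<alpha>)) * indicator {0..<1} x \<partial>lebesgue)"
  proof (intro nn_integral_mono)
    fix x :: real
    have "?M n x + (if 0 < ?M n x then l else 0) \<le> f x + ?M n (x + \<alpha>)"
    proof (cases n)
      case 0
      then show ?thesis using f(3)[of x] by simp
    next
      case (Suc k)
      have "?M k (x + \<alpha>) \<le> ?M n (x + \<alpha>)" unfolding Suc by (rule excess_mono)
      moreover have "?M n x = max 0 (f x - l + ?M k (x + \<alpha>))" unfolding Suc by simp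
      ultimately show ?thesis using f(3)[of x] excess_nonneg[of \<alpha> f l n "x + \<alpha>"]
        by (simp only: max_def split: if_split) linarith
    qed
    then have "ennreal (?M n x + (if 0 < ?M n x then l else 0)) \<le> ennreal (f x + ?M n (x + \<alpha>))"
      by (rule ennreal_leI)
    then have "ennreal (?M n x) + ennreal (if 0 < ?M n x then l else 0) \<le> ennreal (f x) + ennreal (?M n (x + \<alpha>))"
      using f(3)[of x] excess_nonneg[of \<alpha> f l n x] excess_nonneg[of \<alpha> f l n "x + \<alpha>"] l
      by (cases "0 < ?M n x") auto
    then show "ennreal (?M n x) * indicator {0..<1} x + ennreal l * indicator ?E x
        \<le> ennreal (f x) * indicator {0..<1} x + ennreal (?M n (x + \<alpha>)) * indicator {0..<1} x"
      by (auto simp: indicator_def split: if_splits)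
  qed
  also have "\<dots> = ?I f + ?I (\<lambda>x. ?M n (x + \<alpha>))"
    by (intro nn_integral_add lebesgue_measurable_times_indicator) auto
  finally have "?I (?M n) + ennreal l * emeasure lebesgue ?E \<le> ?I (?M n) + ?I f"
    unfolding shift by (simp add: add.commute)
  then show ?thesis using finM[of n] by (auto simp: ennreal_add_left_cancel_le)
qed

text \<open>
  The set where some average exceeds \<open>l\<close> has measure at most the integral of \<open>f\<close> divided by \<open>l\<close>;
  the points where averages are unbounded lie in all of these sets.
\<close>

theorem AE_bounded_averages:
  fixes f :: "real \<Rightarrow> real"
  assumes f: "f \<in> borel_measurable lebesgue" "on_circle f" "\<And>x. 0 \<le> f x"
    and int: "integrable (lebesgue_on {0..1}) f"
  shows "AE x in lebesgue. \<exists>S. \<forall>n. (\<Sum>k<n. f (x + real k * \<alpha>)) \<le> S * real n"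
proof (rule AE_periodicI)
  let ?J = "\<integral>\<^sup>+x. ennreal (f x) * indicator {0..<1} x \<partial>lebesgue"
  have "?J \<le> (\<integral>\<^sup>+x. ennreal (f x) * indicator {0..1} x \<partial>lebesgue)"
    by (intro nn_integral_mono) (auto simp: indicator_def)
  also have "\<dots> = (\<integral>\<^sup>+x. ennreal (f x) \<partial>lebesgue_on {0..1})"
    by (subst nn_integral_restrict_space) auto
  also have "\<dots> < \<infinity>"
    using int f(3) by (simp add: integrable_iff_bounded)
  finally have fin: "?J < \<infinity>" .
  define E where "E l n = {x. 0 \<le> x \<and> x < 1 \<and> 0 < excess \<alpha> f (real (Suc l)) n x}" for l n
  note [measurable] = excess_measurable[OF f(1)]
  have Em: "E l n \<in> sets lebesgue" for l n
  proof -
    have "{x. 0 < excess \<alpha> f (real (Suc l)) n x} \<in> sets lebesgue"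
      using measurable_sets[OF excess_measurable[OF f(1)], of "{0<..}"] by (simp add: vimage_def del: of_nat_Suc)
    then have "{0..<1} \<inter> {x. 0 < excess \<alpha> f (real (Suc l)) n x} \<in> sets lebesgue" by auto
    also have "{0..<1} \<inter> {x. 0 < excess \<alpha> f (real (Suc l)) n x} = E l n" by (auto simp: E_def)
    finally show ?thesis .
  qed
  have bound: "ennreal (real (Suc l)) * emeasure lebesgue (\<Union>n. E l n) \<le> ?J" for l
  proof -
    have inc: "incseq (E l)"
      by (auto simp: E_def incseq_Suc_iff intro: less_le_trans[OF _ excess_mono] simp del: excess.simps)
    have "ennreal (real (Suc l)) * emeasure lebesgue (\<Union>n. E l n) = (SUP n. ennreal (real (Suc l)) * emeasure lebesgue (E l n))"
      unfolding SUP_mult_left_ennreal[symmetric]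
      using SUP_emeasure_incseq[OF _ inc, of lebesgue] Em by (simp add: image_subset_iff del: of_nat_Suc emeasure_completion)
    also have "\<dots> \<le> ?J"
      unfolding E_def by (intro SUP_least maximal_inequality f fin) simp
    finally show ?thesis .
  qed
  have "(\<Inter>l. \<Union>n. E l n) \<in> null_sets lebesgue"
  proof -
    have meas: "(\<Inter>l. \<Union>n. E l n) \<in> sets lebesgue" using Em by auto
    define e where "e = emeasure lebesgue (\<Inter>l. \<Union>n. E l n)"
    have le: "ennreal (real (Suc l)) * e \<le> ?J" for l
      unfolding e_def by (rule order_trans[OF mult_left_mono[OF emeasure_mono] bound]) (use Em in auto)
    have "e = 0"
    proof (rule ccontr)
      assume "e \<noteq> 0"
      have "e \<le> ?J" using le[of 0] by simp
      then have "e < \<infinity>" using fin by (rule le_less_trans)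
      then obtain r where r: "e = ennreal r" "0 < r" using \<open>e \<noteq> 0\<close> by (cases e) (auto simp: less_le)
      obtain s where s: "?J = ennreal s" "0 \<le> s" using fin by (cases ?J) auto
      have "real (Suc l) * r \<le> s" for l
        using le[of l] r s by (simp add: ennreal_mult[symmetric] del: of_nat_Suc)
      moreover obtain l where "s < real l * r" using reals_Archimedean3[OF r(2)] by blast
      moreover have "real l * r \<le> real (Suc l) * r" using r(2) by simp
      ultimately show False by (meson leD order.trans)
    qed
    then show ?thesis using meas by (auto simp: e_def)
  qed
  then have "AE x in lebesgue. x \<notin> (\<Inter>l. \<Union>n. E l n)" by (rule AE_not_in)
  then show "AE x in lebesgue. 0 \<le> x \<and> x < 1 \<longrightarrow> (\<exists>S. \<forall>n. (\<Sum>k<n. f (x + real k * \<alpha>)) \<le> S * real n)"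
  proof eventually_elim
    case (elim x)
    show ?case
    proof
      assume "0 \<le> x \<and> x < 1"
      then obtain l where l: "\<And>n. \<not> 0 < excess \<alpha> f (real (Suc l)) n x"
        using elim by (auto simp: E_def simp del: of_nat_Suc)
      have "(\<Sum>k<n. f (x + real k * \<alpha>)) \<le> real (Suc l) * real n" for n
      proof -
        have "(\<Sum>k<n. f (x + real k * \<alpha>) - real (Suc l)) \<le> 0"
          using l[of n] excess_ge_sum[where f = f and x = x and \<alpha> = \<alpha> and n = n and l = "real (Suc l)"] by linarith
        then show ?thesis by (simp add: sum_subtractf mult.commute del: of_nat_Suc)
      qed
      then show "\<exists>S. \<forall>n. (\<Sum>k<n. f (x + real k * \<alpha>)) \<le> S * real n" by blast
    qed
  qed
  show "on_circle (\<lambda>x. \<exists>S. \<forall>n. (\<Sum>k<n. f (x + real k * \<alpha>)) \<le> S * real n)"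
  proof -
    have "f (x + 1 + real k * \<alpha>) = f (x + real k * \<alpha>)" for x k
      using f(2) unfolding on_circle_def by (metis add.assoc add.commute)
    then show ?thesis by (simp add: on_circle_def)
  qed
qed

section \<open>Entire functions of exponential type\<close>

definition loc_bounded :: "(nat \<Rightarrow> complex \<Rightarrow> complex) \<Rightarrow> bool" where
  "loc_bounded f \<longleftrightarrow> (\<forall>R. \<exists>C. \<forall>n z. norm z \<le> R \<longrightarrow> norm (f n z) \<le> C)"

lemma loc_bounded_Montel:
  assumes holo: "\<And>n. f n holomorphic_on UNIV" and bdd: "loc_bounded f"
  obtains g r where "g holomorphic_on UNIV" "strict_mono (r :: nat \<Rightarrow> nat)"
    "\<And>x. (\<lambda>n. f (r n) x) \<longlonglongrightarrow> g x" "\<And>K. compact K \<Longrightarrow> uniform_limit K (f \<circ> r) g sequentially"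
proof (rule Montel[of UNIV "range f" f])
  show "\<exists>B. \<forall>h\<in>range f. \<forall>z\<in>K. norm (h z) \<le> B" if "compact K" for K
  proof -
    obtain R where "\<And>z. z \<in> K \<Longrightarrow> norm z \<le> R"
      using compact_imp_bounded[OF \<open>compact K\<close>] by (auto simp: bounded_iff)
    moreover obtain C where "\<And>n z. norm z \<le> R \<Longrightarrow> norm (f n z) \<le> C"
      using bdd unfolding loc_bounded_def by metis
    ultimately show ?thesis by blast
  qed
qed (use holo that in auto)

lemma loc_bounded_subseq: "loc_bounded f \<Longrightarrow> loc_bounded (\<lambda>n. f (r n))"
  unfolding loc_bounded_def by meson

text \<open>
  By Montel's theorem a locally bounded family can fail to converge only if some subsequence
  converges to a wrong limit.
\<close>

lemma entire_convergence_by_subsequences: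
  fixes f :: "nat \<Rightarrow> complex \<Rightarrow> complex"
  assumes holo: "\<And>n. f n holomorphic_on UNIV" and bdd: "loc_bounded f"
    and sub: "\<And>r g. strict_mono (r :: nat \<Rightarrow> nat) \<Longrightarrow> g holomorphic_on UNIV \<Longrightarrow>
      (\<And>x. (\<lambda>n. f (r n) x) \<longlonglongrightarrow> g x) \<Longrightarrow> g = (\<lambda>_. c)"
  shows "uniform_limit (cball 0 R) f (\<lambda>_. c) sequentially"
proof (rule ccontr)
  assume "\<not> ?thesis"
  then obtain \<epsilon> where \<epsilon>: "0 < \<epsilon>" "\<exists>\<^sub>F n in sequentially. \<not> (\<forall>z\<in>cball 0 R. dist (f n z) c < \<epsilon>)"
    unfolding uniform_limit_iff by (auto simp: frequently_def)
  then have "infinite {n. \<not> (\<forall>z\<in>cball 0 R. dist (f n z) c < \<epsilon>)}"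
    by (simp add: frequently_cofinite[symmetric] cofinite_eq_sequentially)
  then obtain s :: "nat \<Rightarrow> nat" where s: "strict_mono s" "\<And>n. \<not> (\<forall>z\<in>cball 0 R. dist (f (s n) z) c < \<epsilon>)"
    using infinite_enumerate[of "{n. \<not> (\<forall>z\<in>cball 0 R. dist (f n z) c < \<epsilon>)}"] by blast
  obtain g r where g: "g holomorphic_on UNIV" "strict_mono (r :: nat \<Rightarrow> nat)"
    "\<And>x. (\<lambda>n. f (s (r n)) x) \<longlonglongrightarrow> g x"
    "\<And>K. compact K \<Longrightarrow> uniform_limit K ((\<lambda>n. f (s n)) \<circ> r) g sequentially"
    using loc_bounded_Montel[OF holo loc_bounded_subseq[OF bdd, of s]] by blast
  have "g = (\<lambda>_. c)"
    using sub[of "s \<circ> r" g] g s(1) by (simp add: strict_mono_o)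
  then have "uniform_limit (cball 0 R) ((\<lambda>n. f (s n)) \<circ> r) (\<lambda>_. c) sequentially" using g(4) by simp
  then have "\<forall>\<^sub>F n in sequentially. \<forall>z\<in>cball 0 R. dist (f (s (r n)) z) c < \<epsilon>"
    using \<epsilon>(1) by (simp add: uniform_limit_iff)
  then obtain n where "\<forall>z\<in>cball 0 R. dist (f (s (r n)) z) c < \<epsilon>"
    using eventually_happens'[OF sequentially_bot] by blast
  with s(2) show False by blast
qed

lemma entire_eq_on_reals:
  assumes "f holomorphic_on UNIV" "g holomorphic_on UNIV" "\<And>t::real. f (of_real t) = g (of_real t)"
  shows "f = g"
proof -
  have lim: "(0::complex) islimpt range of_real"
    unfolding islimpt_approachable
  proof (intro allI impI)
    fix e :: real assume "0 < e"
    then show "\<exists>x'\<in>range of_real. x' \<noteq> (0::complex) \<and> dist x' 0 < e"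
      by (intro bexI[of _ "of_real (e / 2)"]) (auto simp: norm_divide simp del: of_real_divide)
  qed
  have "f z - g z = 0" for z
    using assms(3) by (intro analytic_continuation[of "\<lambda>z. f z - g z" UNIV "range of_real" 0 z])
      (auto intro!: holomorphic_intros assms(1,2) lim)
  then show ?thesis by (auto simp: fun_eq_iff)
qed

lemma entire_tendsto_const:
  fixes f :: "nat \<Rightarrow> complex \<Rightarrow> complex"
  assumes holo: "\<And>n. f n holomorphic_on UNIV" and bdd: "loc_bounded f"
    and lim: "\<And>t::real. (\<lambda>n. f n (of_real t)) \<longlonglongrightarrow> c"
  shows "uniform_limit (cball 0 R) f (\<lambda>_. c) sequentially"
proof (rule entire_convergence_by_subsequences[OF holo bdd])
  fix r :: "nat \<Rightarrow> nat" and g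
  assume r: "strict_mono r" "g holomorphic_on UNIV" "\<And>x. (\<lambda>n. f (r n) x) \<longlonglongrightarrow> g x"
  show "g = (\<lambda>_. c)"
  proof (rule entire_eq_on_reals)
    fix t :: real
    have "(\<lambda>n. f (r n) (of_real t)) \<longlonglongrightarrow> c"
      using LIMSEQ_subseq_LIMSEQ[OF lim r(1)] by (simp add: comp_def)
    then show "g (of_real t) = c" using r(3) LIMSEQ_unique by blast
  qed (use r in auto)
qed

lemma entire_deriv_bound:
  assumes "f holomorphic_on UNIV" "\<And>w. norm (w - z) \<le> 1 \<Longrightarrow> norm (f w) \<le> B"
  shows "norm (deriv f z) \<le> B"
proof -
  have "norm ((deriv ^^ 1) f z) \<le> fact 1 * B / 1 ^ 1"
  proof (rule Cauchy_inequality)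
    show "f holomorphic_on ball z 1" by (rule holomorphic_on_subset[OF assms(1)]) simp
    show "continuous_on (cball z 1) f"
      by (rule continuous_on_subset[OF holomorphic_on_imp_continuous_on[OF assms(1)]]) simp
    show "norm (f x) \<le> B" if "norm (z - x) = 1" for x
      using that by (intro assms(2)) (simp add: norm_minus_commute)
  qed simp
  then show ?thesis by simp
qed

lemma entire_Lipschitz:
  assumes holo: "f holomorphic_on UNIV" and b: "\<And>w. norm w \<le> R + 1 \<Longrightarrow> norm (f w) \<le> B"
    and xy: "norm x \<le> R" "norm y \<le> R"
  shows "norm (f x - f y) \<le> B * norm (x - y)"
proof (rule field_differentiable_bound[of "cball 0 R" f "deriv f" B x y])
  show "(f has_field_derivative deriv f z) (at z within cball 0 R)" if "z \<in> cball 0 R" for z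
    by (rule has_field_derivative_at_within, rule holomorphic_derivI[OF holo]) auto
  show "norm (deriv f z) \<le> B" if "z \<in> cball 0 R" for z
  proof (rule entire_deriv_bound[OF holo])
    fix w assume "norm (w - z) \<le> 1"
    then have "norm w \<le> R + 1" using that norm_triangle_ineq[of "w - z" z] by simp
    then show "norm (f w) \<le> B" by (rule b)
  qed
qed (use xy in auto)

text \<open>
  Locally bounded entire families are equicontinuous, so values close to \<open>c\<close> at points that
  approach \<open>t\<close> force convergence at \<open>t\<close> itself.
\<close>

lemma entire_tendsto_from_nearby:
  fixes f :: "nat \<Rightarrow> complex \<Rightarrow> complex"
  assumes holo: "\<And>n. f n holomorphic_on UNIV" and bdd: "loc_bounded f"
    and near: "\<And>\<epsilon>. 0 < \<epsilon> \<Longrightarrow> \<forall>\<^sub>F n in sequentially. \<exists>s. \<bar>s - t\<bar> < \<epsilon> \<and> norm (f n (of_real s) - c) < \<epsilon>"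
  shows "(\<lambda>n. f n (of_real t)) \<longlonglongrightarrow> c"
proof (rule LIMSEQ_I)
  fix e :: real assume e: "0 < e"
  define R where "R = \<bar>t\<bar> + 1"
  obtain C where C: "\<And>n z. norm z \<le> R + 1 \<Longrightarrow> norm (f n z) \<le> C"
    using bdd unfolding loc_bounded_def by metis
  have C0: "0 \<le> C" using C[of 0 0] norm_ge_zero[of "f 0 0"] by (simp add: R_def del: norm_ge_zero)
  define \<epsilon> where "\<epsilon> = min 1 (e / (C + 1))"
  have \<epsilon>: "0 < \<epsilon>" "\<epsilon> \<le> 1" "(C + 1) * \<epsilon> \<le> e"
  proof -
    have "(C + 1) * \<epsilon> \<le> (C + 1) * (e / (C + 1))" using C0 by (intro mult_left_mono) (auto simp: \<epsilon>_def)
    then show "(C + 1) * \<epsilon> \<le> e" using C0 by simp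
  qed (use e C0 in \<open>auto simp: \<epsilon>_def\<close>)
  from near[OF \<epsilon>(1)] obtain N where
    N: "\<And>n. N \<le> n \<Longrightarrow> \<exists>s. \<bar>s - t\<bar> < \<epsilon> \<and> norm (f n (of_real s) - c) < \<epsilon>"
    by (auto simp: eventually_sequentially)
  have "norm (f n (of_real t) - c) < e" if "N \<le> n" for n
  proof -
    obtain s where s: "\<bar>s - t\<bar> < \<epsilon>" "norm (f n (of_real s) - c) < \<epsilon>" using N[OF \<open>N \<le> n\<close>] by blast
    have "norm (f n (of_real t) - f n (of_real s)) \<le> C * norm (complex_of_real t - of_real s)"
      using s(1) \<epsilon>(2) by (intro entire_Lipschitz[OF holo C, where R = R]) (auto simp: R_def)
    also have "norm (complex_of_real t - of_real s) = \<bar>s - t\<bar>"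
      by (simp add: of_real_diff[symmetric] abs_minus_commute del: of_real_diff)
    also have "C * \<bar>s - t\<bar> \<le> C * \<epsilon>" using s(1) C0 by (intro mult_left_mono) auto
    finally have "norm (f n (of_real t) - f n (of_real s)) \<le> C * \<epsilon>" .
    then have "norm (f n (of_real t) - c) < C * \<epsilon> + \<epsilon>"
      using s(2) norm_triangle_ineq[of "f n (of_real t) - f n (of_real s)" "f n (of_real s) - c"] by simp
    then show ?thesis using \<epsilon>(3) by (simp add: algebra_simps)
  qed
  then show "\<exists>N. \<forall>n\<ge>N. norm (f n (of_real t) - c) < e" by blast
qed

text \<open>
  The Borel-Caratheodory inequality between the radii \<open>\<rho>\<close> and \<open>2 \<rho>\<close>: a one-sided bound of the real
  part controls the modulus. It is the Schwarz lemma after a Moebius map.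
\<close>

lemma Borel_Caratheodory_half:
  assumes holo: "f holomorphic_on ball 0 (2 * \<rho>)" and f0: "f 0 = 0" and \<rho>: "0 < \<rho>" and M: "0 < M"
    and re: "\<And>z. norm z < 2 * \<rho> \<Longrightarrow> Re (f z) < M" and z: "norm z \<le> \<rho>"
  shows "norm (f z) \<le> 2 * M"
proof -
  have lt: "norm w < norm (2 * of_real M - w)" if "Re w < M" for w :: complex
  proof -
    have "(norm w)\<^sup>2 < (norm (2 * of_real M - w))\<^sup>2"
    proof -
      have "0 < 4 * M * (M - Re w)" using M that by simp
      then show ?thesis unfolding cmod_power2 by (simp add: power2_eq_square algebra_simps)
    qed
    then show ?thesis by (rule power_less_imp_less_base) simp
  qed
  \<comment> \<open>\<open>w \<mapsto> w / (2 M - w)\<close> maps the half-plane \<open>Re w < M\<close> into the unit disc.\<close>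
  define \<phi> where "\<phi> \<zeta> = f (of_real (2 * \<rho>) * \<zeta>) / (2 * of_real M - f (of_real (2 * \<rho>) * \<zeta>))" for \<zeta>
  have in_ball: "norm (of_real (2 * \<rho>) * \<zeta>) < 2 * \<rho>" if "norm \<zeta> < 1" for \<zeta> :: complex
    using that \<rho> by (simp add: norm_mult)
  have nz: "2 * of_real M - f (of_real (2 * \<rho>) * \<zeta>) \<noteq> 0" if "norm \<zeta> < 1" for \<zeta>
    using lt[OF re[OF in_ball[OF that]]] by auto
  have "(f \<circ> (\<lambda>\<zeta>. of_real (2 * \<rho>) * \<zeta>)) holomorphic_on ball 0 1"
    using in_ball by (intro holomorphic_on_compose_gen[OF _ holo]) (auto intro!: holomorphic_intros)
  then have h: "(\<lambda>\<zeta>. f (of_real (2 * \<rho>) * \<zeta>)) holomorphic_on ball 0 1" by (simp add: comp_def)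
  have hol\<phi>: "\<phi> holomorphic_on ball 0 1"
    unfolding \<phi>_def using nz by (intro holomorphic_intros h) auto
  have \<phi>0: "\<phi> 0 = 0" by (simp add: \<phi>_def f0)
  have no: "norm (\<phi> \<zeta>) < 1" if "norm \<zeta> < 1" for \<zeta>
    using lt[OF re[OF in_ball[OF that]]] nz[OF that] by (simp add: \<phi>_def norm_divide divide_less_eq)
  define \<zeta> where "\<zeta> = z / of_real (2 * \<rho>)"
  have \<zeta>: "norm \<zeta> \<le> 1 / 2" using z \<rho> by (simp add: \<zeta>_def norm_divide field_simps)
  then have \<zeta>1: "norm \<zeta> < 1" by simp
  have "norm (\<phi> \<zeta>) \<le> norm \<zeta>" using Schwarz_Lemma(1)[OF hol\<phi> \<phi>0 no \<zeta>1] .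
  then have "norm (\<phi> \<zeta>) \<le> 1 / 2" using \<zeta> by simp
  moreover have "of_real (2 * \<rho>) * \<zeta> = z" using \<rho> by (simp add: \<zeta>_def)
  ultimately have "norm (f z) \<le> 1 / 2 * norm (2 * of_real M - f z)"
    using nz[OF \<zeta>1] by (simp add: \<phi>_def norm_divide divide_le_eq)
  also have "\<dots> \<le> 1 / 2 * (norm (2 * of_real M :: complex) + norm (f z))"
    by (intro mult_left_mono norm_triangle_ineq4) auto
  also have "norm (2 * of_real M :: complex) = 2 * M" using M by (simp add: norm_mult)
  finally show ?thesis by simp
qed

text \<open>
  The case of order one without zeros in Hadamard's factorization: the logarithm has real part of
  at most linear growth, hence by Borel-Caratheodory grows at most linearly, and Liouville's
  theorem makes it affine.
\<close>

lemma entire_zero_free_exp_type: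
  assumes holo: "u holomorphic_on UNIV" and nz: "\<And>z. u z \<noteq> 0"
    and type: "\<And>z. norm (u z) \<le> C * exp (K * norm z)"
  obtains a b where "\<And>z. u z = exp (a * z + b)"
proof -
  obtain g where g: "g holomorphic_on UNIV" "\<And>x. exp (g x) = u x"
    using holomorphic_logarithm_exists[OF convex_UNIV open_UNIV holo, of 0] nz by auto
  define f where "f z = g z - g 0" for z
  have f: "f holomorphic_on UNIV" "f 0 = 0"
    unfolding f_def by (auto intro!: holomorphic_intros g(1))
  have C: "0 < C" using type[of 0] nz[of 0] by (simp add: less_le_trans[of 0 "norm (u 0)"])
  define c where "c = \<bar>ln C - Re (g 0)\<bar> + 1"
  define k where "k = \<bar>K\<bar>"
  have re: "Re (f z) < c + k * norm z" for z
  proof -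
    have "exp (Re (g z)) \<le> C * exp (K * norm z)" using type[of z] by (simp add: g(2)[symmetric])
    also have "\<dots> = exp (ln C + K * norm z)" using C by (simp add: exp_add)
    finally have "Re (g z) \<le> ln C + K * norm z" by simp
    also have "K * norm z \<le> k * norm z" unfolding k_def by (intro mult_right_mono) auto
    finally show ?thesis unfolding f_def c_def by simp
  qed
  have lin: "norm (f z) \<le> (2 * c + 4 * k) * norm z ^ 1" if "1 \<le> norm z" for z
  proof -
    have "norm (f z) \<le> 2 * (c + k * (2 * norm z))"
    proof (rule Borel_Caratheodory_half[where f = f and z = z and \<rho> = "norm z" and M = "c + k * (2 * norm z)"])
      fix w :: complex assume "norm w < 2 * norm z"
      then have "k * norm w \<le> k * (2 * norm z)" unfolding k_def by (intro mult_left_mono) auto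
      then show "Re (f w) < c + k * (2 * norm z)" using re[of w] by linarith
    next
      have "0 \<le> k * (2 * norm z)" by (simp add: k_def)
      then show "0 < c + k * (2 * norm z)" unfolding c_def by linarith
    qed (use that f in \<open>auto intro: holomorphic_on_subset\<close>)
    moreover have "c * 1 \<le> c * norm z" using that by (intro mult_left_mono) (auto simp: c_def)
    ultimately show ?thesis by (simp add: algebra_simps)
  qed
  have "f z = (\<Sum>j\<le>1. (deriv ^^ j) f 0 / fact j * z ^ j)" for z
    using Liouville_polynomial[OF f(1) lin] by blast
  then have "f z = deriv f 0 * z" for z using f(2) by (simp add: numeral_2_eq_2)
  then have "g z = deriv f 0 * z + g 0" for z unfolding f_def by (metis diff_add_cancel)
  then show ?thesis using that g(2) by metis
qed

section \<open>Families asymptotic to rotations have affine phases\<close>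

text \<open>
  Phases and their speeds are measured in turns, to match the normalization of \<^const>\<open>Rot\<close>.
\<close>

definition unit_phase :: "(complex \<Rightarrow> complex) \<Rightarrow> real" where
  "unit_phase u = Arg (u 0) / (2 * pi)"

text \<open>
  The threshold keeps the speeds bounded; along the families considered below, \<open>u 0\<close> has modulus
  close to 1 except for finitely many members.
\<close>

definition phase_speed :: "(complex \<Rightarrow> complex) \<Rightarrow> real" where
  "phase_speed u = (if 1 / 2 \<le> norm (u 0) then Im (deriv u 0 / u 0) / (2 * pi) else 0)"

definition affine_phase :: "(complex \<Rightarrow> complex) \<Rightarrow> complex \<Rightarrow> complex" where
  "affine_phase u z = of_real (2 * pi) * (of_real (phase_speed u) * z + of_real (unit_phase u))"

lemma loc_bounded_exp_type:
  assumes "\<And>n z. norm (f n z) \<le> C * exp (K * norm z)" "0 \<le> C"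
  shows "loc_bounded f"
  unfolding loc_bounded_def
proof (intro allI)
  fix R
  have "norm (f n z) \<le> C * exp (\<bar>K\<bar> * R)" if "norm z \<le> R" for n z
  proof -
    have "K * norm z \<le> \<bar>K\<bar> * norm z" by (intro mult_right_mono) auto
    also have "\<dots> \<le> \<bar>K\<bar> * R" using that by (intro mult_left_mono) auto
    finally have "C * exp (K * norm z) \<le> C * exp (\<bar>K\<bar> * R)" using assms(2) by (intro mult_left_mono) auto
    then show ?thesis using assms(1)[of n z] by linarith
  qed
  then show "\<exists>C. \<forall>n z. norm z \<le> R \<longrightarrow> norm (f n z) \<le> C" by blast
qed

lemma loc_bounded_mult:
  assumes "loc_bounded f" "loc_bounded g" shows "loc_bounded (\<lambda>n z. f n z * g n z)"
  unfolding loc_bounded_def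
proof (intro allI)
  fix R
  obtain C where C: "\<And>n z. norm z \<le> R \<Longrightarrow> norm (f n z) \<le> C" using assms(1) unfolding loc_bounded_def by metis
  obtain D where D: "\<And>n z. norm z \<le> R \<Longrightarrow> norm (g n z) \<le> D" using assms(2) unfolding loc_bounded_def by metis
  have "norm (f n z * g n z) \<le> C * D" if "norm z \<le> R" for n z
    unfolding norm_mult by (rule mult_mono[OF C[OF that] D[OF that]]) (use C[OF that, of n] norm_ge_zero[of "f n z"] in \<open>linarith, simp\<close>)
  then show "\<exists>C. \<forall>n z. norm z \<le> R \<longrightarrow> norm (f n z * g n z) \<le> C" by blast
qed

lemma phase_speed_bounded:
  assumes "u holomorphic_on UNIV" "\<And>z. norm z \<le> 1 \<Longrightarrow> norm (u z) \<le> B"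
  shows "\<bar>phase_speed u\<bar> \<le> B / pi"
proof (cases "1 / 2 \<le> norm (u 0)")
  case True
  have d: "norm (deriv u 0) \<le> B" using assms by (intro entire_deriv_bound) auto
  then have B: "0 \<le> B" using norm_ge_zero order_trans by blast
  have "\<bar>Im (deriv u 0 / u 0)\<bar> \<le> norm (deriv u 0) / norm (u 0)"
    using abs_Im_le_cmod[of "deriv u 0 / u 0"] by (simp add: norm_divide)
  also have "\<dots> \<le> B / (1 / 2)" using True d B by (intro frac_le) auto
  finally show ?thesis using True by (simp add: phase_speed_def field_simps)
next
  case False
  have "norm (u 0) \<le> B" using assms(2)[of 0] by simp
  then have "0 \<le> B" using norm_ge_zero order_trans by blast
  then show ?thesis using False by (simp add: phase_speed_def)
qed

lemma loc_bounded_phase: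
  assumes a: "bounded (range a)" and s: "s = \<i> \<or> s = - \<i>"
  shows "loc_bounded (\<lambda>n z. exp (s * (of_real (2 * pi) * (of_real (a n) * z + of_real (b n)))))"
  unfolding loc_bounded_def
proof (intro allI)
  fix R :: real
  obtain A where A: "\<And>n. \<bar>a n\<bar> \<le> A" using a by (auto simp: bounded_iff)
  have "norm (exp (s * (of_real (2 * pi) * (of_real (a n) * z + of_real (b n))))) \<le> exp (2 * pi * (A * R))"
    if "norm z \<le> R" for n z
  proof -
    have i: "s = \<i> \<or> s = - \<i>" using s .
    have "norm (exp (s * (of_real (2 * pi) * (of_real (a n) * z + of_real (b n)))))
        = exp (Re (s * (of_real (2 * pi) * (of_real (a n) * z + of_real (b n)))))"
      by simp
    also have "Re (s * (of_real (2 * pi) * (of_real (a n) * z + of_real (b n)))) \<le> 2 * pi * (\<bar>a n\<bar> * \<bar>Im z\<bar>)"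
    proof -
      have "2 * pi * (a n * Im z) \<le> 2 * pi * (\<bar>a n\<bar> * \<bar>Im z\<bar>)" "- (2 * pi * (a n * Im z)) \<le> 2 * pi * (\<bar>a n\<bar> * \<bar>Im z\<bar>)"
        unfolding abs_mult[symmetric] mult_minus_right[symmetric] by (intro mult_left_mono; simp)+
      then show ?thesis using i by auto
    qed
    also have "2 * pi * (\<bar>a n\<bar> * \<bar>Im z\<bar>) \<le> 2 * pi * (A * R)"
      using abs_Im_le_cmod[of z] that A[of n] by (intro mult_left_mono mult_mono) auto
    finally show ?thesis by simp
  qed
  then show "\<exists>C. \<forall>n z. norm z \<le> R \<longrightarrow> norm (exp (s * (of_real (2 * pi) * (of_real (a n) * z + of_real (b n))))) \<le> C" by blast
qed

text \<open>
  Along any subsequence, limits \<open>U\<close> and \<open>W\<close> exist. They satisfy \<open>U W = 1\<close> on the line, hence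
  everywhere, so \<open>U\<close> is zero-free of exponential type and therefore \<open>exp (a z + b)\<close>, with
  imaginary \<open>a\<close> and \<open>b\<close> because it is unimodular on the line. Value and derivative at 0 determine
  \<open>a\<close> and \<open>exp b\<close>, and both are continuous under locally uniform convergence; that is why the
  phases read off from the members of the family, which do not depend on the subsequence, cancel
  the limit.
\<close>

lemma entire_asymptotically_unimodular:
  fixes u w :: "nat \<Rightarrow> complex \<Rightarrow> complex"
  assumes hol: "\<And>n. u n holomorphic_on UNIV" "\<And>n. w n holomorphic_on UNIV"
    and type: "\<And>n z. norm (u n z) \<le> C * exp (K * norm z)" "\<And>n z. norm (w n z) \<le> C * exp (K * norm z)"
    and conj: "\<And>n t. w n (of_real t) = cnj (u n (of_real t))"
    and lim: "\<And>t::real. (\<lambda>n. u n (of_real t) * w n (of_real t)) \<longlonglongrightarrow> 1"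
  shows "uniform_limit (cball 0 R) (\<lambda>n z. exp (- \<i> * affine_phase (u n) z) * u n z) (\<lambda>_. 1) sequentially" (is ?U)
    and "uniform_limit (cball 0 R) (\<lambda>n z. exp (\<i> * affine_phase (u n) z) * w n z) (\<lambda>_. 1) sequentially" (is ?W)
    and "bounded (range (\<lambda>n. phase_speed (u n)))"
proof -
  have C: "0 \<le> C" using type(1)[of 0 0] norm_ge_zero[of "u 0 0"] by (simp del: norm_ge_zero)
  note lb = loc_bounded_exp_type[OF type(1) C] loc_bounded_exp_type[OF type(2) C]
  have "\<bar>phase_speed (u n)\<bar> \<le> C * exp \<bar>K\<bar> / pi" for n
  proof (rule phase_speed_bounded[OF hol(1)])
    fix z :: complex assume "norm z \<le> 1"
    have "K * norm z \<le> \<bar>K\<bar> * norm z" by (intro mult_right_mono) auto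
    also have "\<dots> \<le> \<bar>K\<bar> * 1" using \<open>norm z \<le> 1\<close> by (intro mult_left_mono) auto
    finally have "C * exp (K * norm z) \<le> C * exp \<bar>K\<bar>" using C by (intro mult_left_mono) auto
    then show "norm (u n z) \<le> C * exp \<bar>K\<bar>" using type(1)[of n z] by linarith
  qed
  then show bdd: "bounded (range (\<lambda>n. phase_speed (u n)))"
    unfolding bounded_iff by (auto intro!: exI[of _ "C * exp \<bar>K\<bar> / pi"])
  have lbP: "loc_bounded (\<lambda>n z. exp (s * affine_phase (u n) z))" if "s = \<i> \<or> s = - \<i>" for s
    unfolding affine_phase_def by (rule loc_bounded_phase[OF bdd that])
  have key: "\<exists>r'. strict_mono (r' :: nat \<Rightarrow> nat) \<and> (\<forall>z. (\<lambda>n. exp (- \<i> * affine_phase (u (r (r' n))) z) * u (r (r' n)) z) \<longlonglongrightarrow> 1)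
      \<and> (\<forall>z. (\<lambda>n. exp (\<i> * affine_phase (u (r (r' n))) z) * w (r (r' n)) z) \<longlonglongrightarrow> 1)"
    if r: "strict_mono r" for r :: "nat \<Rightarrow> nat"
  proof -
    obtain U r1 where U: "U holomorphic_on UNIV" "strict_mono (r1 :: nat \<Rightarrow> nat)"
      "\<And>x. (\<lambda>n. u (r (r1 n)) x) \<longlonglongrightarrow> U x" "\<And>K. compact K \<Longrightarrow> uniform_limit K ((\<lambda>n. u (r n)) \<circ> r1) U sequentially"
      by (rule loc_bounded_Montel[of "\<lambda>n. u (r n)"]) (rule hol(1) loc_bounded_subseq[OF lb(1)] that; assumption?)+
    obtain W r2 where W: "W holomorphic_on UNIV" "strict_mono (r2 :: nat \<Rightarrow> nat)"
      "\<And>x. (\<lambda>n. w (r (r1 (r2 n))) x) \<longlonglongrightarrow> W x"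
      by (rule loc_bounded_Montel[of "\<lambda>n. w (r (r1 n))"]) (rule hol(2) loc_bounded_subseq[OF lb(2)] that; assumption?)+
    define \<sigma> where "\<sigma> n = r (r1 (r2 n))" for n
    have \<sigma>: "strict_mono \<sigma>" using r U(2) W(2) by (auto simp: \<sigma>_def strict_mono_def)
    have Ul: "(\<lambda>n. u (\<sigma> n) x) \<longlonglongrightarrow> U x" for x
      using LIMSEQ_subseq_LIMSEQ[OF U(3) W(2)] by (simp add: \<sigma>_def comp_def)
    have Wl: "(\<lambda>n. w (\<sigma> n) x) \<longlonglongrightarrow> W x" for x using W(3) by (simp add: \<sigma>_def)
    have Ud: "(\<lambda>n. deriv (u (\<sigma> n)) 0) \<longlonglongrightarrow> deriv U 0"
    proof -
      have "uniform_limit (cball 0 1) ((\<lambda>n. u (r n)) \<circ> r1) U sequentially" by (rule U(4)) simp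
      then have "uniform_limit (ball 0 1) ((\<lambda>n. u (r n)) \<circ> r1) U sequentially"
        by (rule uniform_limit_on_subset) auto
      then have "(\<lambda>n. (deriv ^^ 1) (((\<lambda>n. u (r n)) \<circ> r1) n) 0) \<longlonglongrightarrow> (deriv ^^ 1) U 0"
        by (rule higher_deriv_complex_uniform_limit) (simp_all add: holomorphic_on_subset[OF hol(1)])
      then have "(\<lambda>n. deriv (u (r (r1 n))) 0) \<longlonglongrightarrow> deriv U 0" by simp
      from LIMSEQ_subseq_LIMSEQ[OF this W(2)] show ?thesis by (simp add: \<sigma>_def comp_def)
    qed
    have UW: "U z * W z = 1" for z
    proof -
      have "(\<lambda>z. U z * W z) = (\<lambda>_. 1)"
      proof (rule entire_eq_on_reals)
        fix t :: real
        have "(\<lambda>n. u (\<sigma> n) (of_real t) * w (\<sigma> n) (of_real t)) \<longlonglongrightarrow> 1"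
          using LIMSEQ_subseq_LIMSEQ[OF lim \<sigma>] by (simp add: comp_def)
        then show "U (of_real t) * W (of_real t) = 1"
          using tendsto_mult[OF Ul Wl] LIMSEQ_unique by blast
      qed (auto intro!: holomorphic_intros U(1) W(1))
      then show ?thesis by (rule fun_cong)
    qed
    have "norm (U z) \<le> C * exp (K * norm z)" for z
      by (rule LIMSEQ_le_const2[OF tendsto_norm[OF Ul[of z]]]) (use type(1) in blast)
    moreover have "U z \<noteq> 0" for z using UW[of z] by auto
    ultimately obtain a b where ab: "\<And>z. U z = exp (a * z + b)"
      using entire_zero_free_exp_type[OF U(1)] by blast
    have mod1: "norm (U (of_real t)) = 1" for t
    proof -
      have "W (of_real t) = cnj (U (of_real t))"
        using Wl[of "of_real t"] tendsto_cnj[OF Ul[of "of_real t"]] unfolding conj by (rule LIMSEQ_unique)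
      then have "U (of_real t) * cnj (U (of_real t)) = 1" using UW by metis
      then have "of_real ((norm (U (of_real t)))\<^sup>2) = (1::complex)"
        by (metis complex_norm_square)
      then have "(norm (U (of_real t)))\<^sup>2 = 1" by (metis of_real_eq_1_iff)
      then show ?thesis using norm_ge_zero[of "U (of_real t)"] by (simp add: power2_eq_1_iff del: norm_ge_zero)
    qed
    have b0: "Re b = 0" using mod1[of 0] by (simp add: ab)
    \<comment> \<open>A function \<open>exp (a z + b)\<close> of modulus 1 on the line has purely imaginary \<open>a\<close> and \<open>b\<close>.\<close>
    have a0: "Re a = 0" using mod1[of 1] b0 by (simp add: ab)
    have a_eq: "a = \<i> * of_real (Im a)" using a0 by (simp add: complex_eq_iff)
    have U0: "U 0 = exp b" "norm (U 0) = 1" "U 0 \<noteq> 0" using mod1[of 0] by (auto simp: ab)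
    have dU: "deriv U 0 = a * exp b"
    proof -
      have "(U has_field_derivative a * exp (a * 0 + b)) (at 0)"
        unfolding ab[abs_def] by (auto intro!: derivative_eq_intros)
      then show ?thesis using DERIV_imp_deriv by fastforce
    qed
    have ev: "\<forall>\<^sub>F n in sequentially. 1 / 2 < norm (u (\<sigma> n) 0)"
      using tendsto_norm[OF Ul[of 0]] U0(2) by (intro order_tendstoD(1)[of _ 1]) auto
    have "(\<lambda>n. Im (deriv (u (\<sigma> n)) 0 / u (\<sigma> n) 0) / (2 * pi)) \<longlonglongrightarrow> Im (deriv U 0 / U 0) / (2 * pi)"
      by (intro tendsto_intros Ul Ud U0(3)) auto
    moreover have "Im (deriv U 0 / U 0) = Im a" by (simp add: dU U0)
    ultimately have "(\<lambda>n. Im (deriv (u (\<sigma> n)) 0 / u (\<sigma> n) 0) / (2 * pi)) \<longlonglongrightarrow> Im a / (2 * pi)" by simp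
    then have sp: "(\<lambda>n. phase_speed (u (\<sigma> n))) \<longlonglongrightarrow> Im a / (2 * pi)"
    proof (rule Lim_transform_eventually)
      show "\<forall>\<^sub>F n in sequentially. Im (deriv (u (\<sigma> n)) 0 / u (\<sigma> n) 0) / (2 * pi) = phase_speed (u (\<sigma> n))"
        using ev by eventually_elim (simp add: phase_speed_def)
    qed
    have ph: "exp (\<i> * affine_phase (u n) z) = exp (\<i> * of_real (2 * pi) * of_real (phase_speed (u n)) * z) * (u n 0 / of_real (norm (u n 0)))"
      if "u n 0 \<noteq> 0" for n z
    proof -
      have "\<i> * affine_phase (u n) z = \<i> * of_real (2 * pi) * of_real (phase_speed (u n)) * z + \<i> * of_real (Arg (u n 0))"
        by (simp add: affine_phase_def unit_phase_def algebra_simps)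
      moreover have "exp (\<i> * of_real (Arg (u n 0))) = u n 0 / of_real (norm (u n 0))"
        using Arg_eq[OF that] that by (simp add: field_simps)
      ultimately show ?thesis by (simp add: exp_add)
    qed
    have phl: "(\<lambda>n. exp (\<i> * affine_phase (u (\<sigma> n)) z)) \<longlonglongrightarrow> U z" for z
    proof -
      have "(\<lambda>n. exp (\<i> * of_real (2 * pi) * of_real (phase_speed (u (\<sigma> n))) * z) * (u (\<sigma> n) 0 / of_real (norm (u (\<sigma> n) 0))))
          \<longlonglongrightarrow> exp (\<i> * of_real (2 * pi) * of_real (Im a / (2 * pi)) * z) * (U 0 / of_real (norm (U 0)))"
        by (intro tendsto_intros sp Ul) (use U0 in auto)
      also have "exp (\<i> * of_real (2 * pi) * of_real (Im a / (2 * pi)) * z) * (U 0 / of_real (norm (U 0))) = U z"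
      proof -
        have "\<i> * of_real (2 * pi) * of_real (Im a / (2 * pi)) * z = (\<i> * of_real (Im a)) * z" by simp
        also have "\<dots> = a * z" by (simp only: a_eq[symmetric])
        finally have eq: "\<i> * of_real (2 * pi) * of_real (Im a / (2 * pi)) * z = a * z" .
        show ?thesis unfolding eq using U0 by (simp add: ab exp_add)
      qed
      finally show ?thesis
      proof (rule Lim_transform_eventually)
        show "\<forall>\<^sub>F n in sequentially. exp (\<i> * of_real (2 * pi) * of_real (phase_speed (u (\<sigma> n))) * z) * (u (\<sigma> n) 0 / of_real (norm (u (\<sigma> n) 0)))
            = exp (\<i> * affine_phase (u (\<sigma> n)) z)"
          using ev by eventually_elim (subst ph, auto)
      qed
    qed
    have Unz: "U z \<noteq> 0" for z by (simp add: ab)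
    have "(\<lambda>n. exp (- \<i> * affine_phase (u (\<sigma> n)) z) * u (\<sigma> n) z) \<longlonglongrightarrow> 1" for z
    proof -
      have "(\<lambda>n. inverse (exp (\<i> * affine_phase (u (\<sigma> n)) z)) * u (\<sigma> n) z) \<longlonglongrightarrow> inverse (U z) * U z"
        by (intro tendsto_intros phl Ul Unz)
      then show ?thesis using Unz by (simp add: exp_minus)
    qed
    moreover have "(\<lambda>n. exp (\<i> * affine_phase (u (\<sigma> n)) z) * w (\<sigma> n) z) \<longlonglongrightarrow> 1" for z
      using tendsto_mult[OF phl[of z] Wl[of z]] UW by simp
    moreover have "strict_mono (\<lambda>n. r1 (r2 n))" using U(2) W(2) by (auto simp: strict_mono_def)
    ultimately show ?thesis unfolding \<sigma>_def by (intro exI[of _ "\<lambda>n. r1 (r2 n)"]) auto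
  qed
  have const: "g = (\<lambda>_. 1)" if "strict_mono r'" "\<And>x. (\<lambda>n. f (r n) x) \<longlonglongrightarrow> g x" "\<And>x. (\<lambda>n. f (r (r' n)) x) \<longlonglongrightarrow> 1"
    for f :: "nat \<Rightarrow> complex \<Rightarrow> complex" and r r' :: "nat \<Rightarrow> nat" and g
    using that LIMSEQ_subseq_LIMSEQ[OF that(2,1)] LIMSEQ_unique by (fastforce simp: comp_def)
  have holP: "(\<lambda>z. exp (s * affine_phase (u n) z)) holomorphic_on UNIV" for s n
    unfolding affine_phase_def by (intro holomorphic_intros)
  show ?U
  proof (rule entire_convergence_by_subsequences)
    show "loc_bounded (\<lambda>n z. exp (- \<i> * affine_phase (u n) z) * u n z)"
      by (intro loc_bounded_mult lbP lb) simp
    fix r :: "nat \<Rightarrow> nat" and g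
    assume "strict_mono r" and g: "\<And>x. (\<lambda>n. exp (- \<i> * affine_phase (u (r n)) x) * u (r n) x) \<longlonglongrightarrow> g x"
    from key[OF this(1)] obtain r' where "strict_mono (r' :: nat \<Rightarrow> nat)"
      "\<And>z. (\<lambda>n. exp (- \<i> * affine_phase (u (r (r' n))) z) * u (r (r' n)) z) \<longlonglongrightarrow> 1" by blast
    from const[where f = "\<lambda>n x. exp (- \<i> * affine_phase (u n) x) * u n x", OF this(1) g this(2)] show "g = (\<lambda>_. 1)" .
  qed (intro holomorphic_on_mult holP hol)
  show ?W
  proof (rule entire_convergence_by_subsequences)
    show "loc_bounded (\<lambda>n z. exp (\<i> * affine_phase (u n) z) * w n z)"
      by (intro loc_bounded_mult lbP lb) simp
    fix r :: "nat \<Rightarrow> nat" and g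
    assume "strict_mono r" and g: "\<And>x. (\<lambda>n. exp (\<i> * affine_phase (u (r n)) x) * w (r n) x) \<longlonglongrightarrow> g x"
    from key[OF this(1)] obtain r' where "strict_mono (r' :: nat \<Rightarrow> nat)"
      "\<And>z. (\<lambda>n. exp (\<i> * affine_phase (u (r (r' n))) z) * w (r (r' n)) z) \<longlonglongrightarrow> 1" by blast
    from const[where f = "\<lambda>n x. exp (\<i> * affine_phase (u n) x) * w n x", OF this(1) g this(2)] show "g = (\<lambda>_. 1)" .
  qed (intro holomorphic_on_mult holP hol)
qed


definition cRot :: "complex \<Rightarrow> complex^2^2" where
  "cRot \<theta> = vector [vector [cos (of_real (2 * pi) * \<theta>), - sin (of_real (2 * pi) * \<theta>)],
                    vector [sin (of_real (2 * pi) * \<theta>), cos (of_real (2 * pi) * \<theta>)]]"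

lemma rotation_matrix_2_entries:
  assumes "rotation_matrix (M :: real^2^2)"
  shows "M $ 2 $ 2 = M $ 1 $ 1" "M $ 2 $ 1 = - M $ 1 $ 2" "(M $ 1 $ 1)\<^sup>2 + (M $ 1 $ 2)\<^sup>2 = 1"
proof -
  have o: "transpose M ** M = mat 1" "det M = 1"
    using assms by (auto simp: rotation_matrix_def orthogonal_matrix)
  have 1: "M$1$1 * M$1$1 + M$2$1 * M$2$1 = 1" "M$1$2 * M$1$2 + M$2$2 * M$2$2 = 1"
    "M$1$1 * M$1$2 + M$2$1 * M$2$2 = 0"
    using o(1) by (simp_all add: vec_eq_iff forall_2 matrix_matrix_mult_def transpose_def mat_def sum_2)
  have 2: "M$1$1 * M$2$2 - M$1$2 * M$2$1 = 1" using o(2) by (simp add: det_2)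
  have "(M$1$1 - M$2$2)\<^sup>2 + (M$2$1 + M$1$2)\<^sup>2 = 0"
    using 1 2 by (simp add: power2_eq_square algebra_simps)
  then have 3: "M$1$1 - M$2$2 = 0 \<and> M$2$1 + M$1$2 = 0" by (simp only: sum_power2_eq_zero_iff)
  then show "M $ 2 $ 2 = M $ 1 $ 1" "M $ 2 $ 1 = - M $ 1 $ 2" by linarith+
  with 2 show "(M $ 1 $ 1)\<^sup>2 + (M $ 1 $ 2)\<^sup>2 = 1" by (simp add: power2_eq_square)
qed

text \<open>
  In the coordinates that diagonalize rotations, multiplication by a rotation multiplies \<open>u\<close> and
  \<open>v\<close> by one exponential and \<open>w\<close> and \<open>v'\<close> by the inverse one.
\<close>

lemma cRot_mult_entries:
  fixes Q :: "complex^2^2" and \<theta> :: complex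
  defines "u \<equiv> ((Q$1$1 + Q$2$2) + \<i> * (Q$2$1 - Q$1$2)) / 2" and "w \<equiv> ((Q$1$1 + Q$2$2) - \<i> * (Q$2$1 - Q$1$2)) / 2"
    and "v \<equiv> ((Q$1$1 - Q$2$2) + \<i> * (Q$2$1 + Q$1$2)) / 2" and "v' \<equiv> ((Q$1$1 - Q$2$2) - \<i> * (Q$2$1 + Q$1$2)) / 2"
    and "e \<equiv> exp (- \<i> * (of_real (2 * pi) * \<theta>))" and "e' \<equiv> exp (\<i> * (of_real (2 * pi) * \<theta>))"
  shows "(cRot (- \<theta>) ** Q) $ 1 $ 1 = ((e * u + e' * w) + (e * v + e' * v')) / 2"
    and "(cRot (- \<theta>) ** Q) $ 2 $ 2 = ((e * u + e' * w) - (e * v + e' * v')) / 2"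
    and "(cRot (- \<theta>) ** Q) $ 2 $ 1 = ((e * u - e' * w) + (e * v - e' * v')) / (2 * \<i>)"
    and "(cRot (- \<theta>) ** Q) $ 1 $ 2 = ((e' * w - e * u) + (e * v - e' * v')) / (2 * \<i>)"
proof -
  let ?c = "cos (of_real (2 * pi) * \<theta>)" and ?s = "sin (of_real (2 * pi) * \<theta>)"
  have e: "e = ?c - \<i> * ?s" "e' = ?c + \<i> * ?s"
    unfolding e_def e'_def by (simp_all add: exp_Euler[symmetric] exp_minus_Euler[symmetric])
  have R: "cRot (- \<theta>) $ 1 $ 1 = ?c" "cRot (- \<theta>) $ 1 $ 2 = ?s" "cRot (- \<theta>) $ 2 $ 1 = - ?s" "cRot (- \<theta>) $ 2 $ 2 = ?c"
    by (simp_all add: cRot_def)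
  show "(cRot (- \<theta>) ** Q) $ 1 $ 1 = ((e * u + e' * w) + (e * v + e' * v')) / 2"
    "(cRot (- \<theta>) ** Q) $ 2 $ 2 = ((e * u + e' * w) - (e * v + e' * v')) / 2"
    "(cRot (- \<theta>) ** Q) $ 2 $ 1 = ((e * u - e' * w) + (e * v - e' * v')) / (2 * \<i>)"
    "(cRot (- \<theta>) ** Q) $ 1 $ 2 = ((e' * w - e * u) + (e * v - e' * v')) / (2 * \<i>)"
    unfolding matrix_matrix_mult_def e u_def w_def v_def v'_def
    by (simp_all add: sum_2 R field_simps)
qed

text \<open>
  The rigidity behind the whole result. The diagonal coordinates \<open>u\<close> and \<open>w\<close> of such a family are
  asymptotically inverse and conjugate to each other on the line, while the others tend to 0
  there. Exponential type then leaves only affine phases, and the convergence is locally uniform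
  on the whole complex plane.
\<close>

theorem asymptotic_rotations_affine_phase:
  fixes Q :: "nat \<Rightarrow> complex \<Rightarrow> complex^2^2"
  assumes hol: "\<And>n i j. (\<lambda>z. Q n z $ i $ j) holomorphic_on UNIV"
    and type: "\<And>n z i j. norm (Q n z $ i $ j) \<le> C * exp (K * norm z)"
    and real: "\<And>n t i j. Q n (of_real t) $ i $ j \<in> \<real>"
    and near: "\<And>t \<epsilon>. 0 < \<epsilon> \<Longrightarrow> \<forall>\<^sub>F n in sequentially. \<exists>s. \<bar>s - t\<bar> < \<epsilon> \<and>
      (\<exists>M. rotation_matrix M \<and> (\<forall>i j. norm (Q n (of_real s) $ i $ j - of_real (M $ i $ j)) < \<epsilon>))"
  obtains a b :: "nat \<Rightarrow> real" where "bounded (range a)"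
    "\<And>R i j. uniform_limit (cball 0 R)
      (\<lambda>n z. (cRot (- (of_real (a n) * z + of_real (b n))) ** Q n z) $ i $ j) (\<lambda>_. mat 1 $ i $ j) sequentially"
proof -
  have C: "0 \<le> C" using type[of 0 0 1 1] norm_ge_zero[of "Q 0 0 $ 1 $ 1"] by (simp del: norm_ge_zero)
  \<comment> \<open>The coordinates in which a complex rotation is diagonal: a rotation by \<open>\<theta>\<close> turns has
    \<open>u = exp (2 \<pi> \<i> \<theta>)\<close>, \<open>w = exp (- 2 \<pi> \<i> \<theta>)\<close> and \<open>v = v' = 0\<close>.\<close>
  define u where "u n z = ((Q n z$1$1 + Q n z$2$2) + \<i> * (Q n z$2$1 - Q n z$1$2)) / 2" for n z
  define w where "w n z = ((Q n z$1$1 + Q n z$2$2) - \<i> * (Q n z$2$1 - Q n z$1$2)) / 2" for n z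
  define v where "v n z = ((Q n z$1$1 - Q n z$2$2) + \<i> * (Q n z$2$1 + Q n z$1$2)) / 2" for n z
  define v' where "v' n z = ((Q n z$1$1 - Q n z$2$2) - \<i> * (Q n z$2$1 + Q n z$1$2)) / 2" for n z
  have holo: "u n holomorphic_on UNIV" "w n holomorphic_on UNIV" "v n holomorphic_on UNIV" "v' n holomorphic_on UNIV" for n
    unfolding u_def[abs_def] w_def[abs_def] v_def[abs_def] v'_def[abs_def] by (intro holomorphic_intros hol; simp)+
  have n4: "norm ((a + s1 * b + s * (c + s1 * d)) / 2) \<le> 2 * D"
    if "norm a \<le> D" "norm b \<le> D" "norm c \<le> D" "norm d \<le> D" "norm s1 = 1" "norm s = 1" for a b c d s s1 :: complex and D
  proof -
    have "norm (a + s1 * b + s * (c + s1 * d)) \<le> (norm a + norm (s1 * b)) + norm (s * (c + s1 * d))"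
      by (intro order_trans[OF norm_triangle_ineq] add_right_mono norm_triangle_ineq)
    also have "norm (s * (c + s1 * d)) \<le> norm c + norm (s1 * d)"
      using norm_triangle_ineq[of c "s1 * d"] that by (simp add: norm_mult)
    finally show ?thesis using that by (simp add: norm_mult norm_divide)
  qed
  have ty: "norm (u n z) \<le> (2 * C) * exp (K * norm z)" "norm (w n z) \<le> (2 * C) * exp (K * norm z)"
    "norm (v n z) \<le> (2 * C) * exp (K * norm z)" "norm (v' n z) \<le> (2 * C) * exp (K * norm z)" for n z
    using n4[of "Q n z$1$1" _ "Q n z$2$2" "Q n z$2$1" "- Q n z$1$2" 1 \<i>, OF type type type] type[of n z 1 2]
      n4[of "Q n z$1$1" _ "Q n z$2$2" "Q n z$2$1" "- Q n z$1$2" 1 "- \<i>", OF type type type]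
      n4[of "Q n z$1$1" _ "Q n z$2$2" "Q n z$2$1" "- Q n z$1$2" "-1" \<i>, OF type type type]
      n4[of "Q n z$1$1" _ "Q n z$2$2" "Q n z$2$1" "- Q n z$1$2" "-1" "- \<i>", OF type type type]
    by (simp_all add: u_def w_def v_def v'_def)
  have lb: "loc_bounded u" "loc_bounded w" "loc_bounded v" "loc_bounded v'"
    using ty C by (auto intro!: loc_bounded_exp_type[where C = "2 * C" and K = K])
  have cn: "w n (of_real t) = cnj (u n (of_real t))" for n t
    using real[of n t] by (simp add: u_def w_def Reals_cnj_iff)
  have nearby: "\<forall>\<^sub>F n in sequentially. \<exists>s. \<bar>s - t\<bar> < \<epsilon> \<and> norm (u n (of_real s) * w n (of_real s) - 1) < \<epsilon>
      \<and> norm (v n (of_real s)) < \<epsilon> \<and> norm (v' n (of_real s)) < \<epsilon>" if \<epsilon>: "0 < \<epsilon>" for t \<epsilon> :: real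
  proof -
    define \<delta> where "\<delta> = min 1 \<epsilon> / 8"
    have \<delta>: "0 < \<delta>" "8 * \<delta> \<le> \<epsilon>" "8 * \<delta> \<le> 1" using \<epsilon> by (auto simp: \<delta>_def)
    show ?thesis using near[OF \<delta>(1), of t]
    proof eventually_elim
      case (elim n)
      then obtain s M where s: "\<bar>s - t\<bar> < \<delta>" and M: "rotation_matrix M"
        and q: "\<And>i j. norm (Q n (of_real s) $ i $ j - of_real (M $ i $ j)) < \<delta>" by blast
      note Me = rotation_matrix_2_entries[OF M]
      define m where "m = Complex (M$1$1) (- M$1$2)"
      have nm: "norm m = 1" using Me(3) by (simp add: m_def cmod_def)
      let ?d = "\<lambda>i j. Q n (of_real s) $ i $ j - of_real (M $ i $ j)"
      have q': "norm (?d i j) \<le> \<delta>" for i j using q[of i j] by simp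
      have q'': "norm (- ?d i j) \<le> \<delta>" for i j by (simp only: norm_minus_cancel q')
      have um: "u n (of_real s) - m = (?d 1 1 + 1 * ?d 2 2 + \<i> * (?d 2 1 + 1 * (- ?d 1 2))) / 2"
        by (simp add: u_def m_def Me complex_eq_iff)
      have vm: "v n (of_real s) = (?d 1 1 + (-1) * ?d 2 2 + \<i> * (?d 2 1 + (-1) * (- ?d 1 2))) / 2"
        by (simp add: v_def Me complex_eq_iff)
      have vm': "v' n (of_real s) = (?d 1 1 + (-1) * ?d 2 2 + (- \<i>) * (?d 2 1 + (-1) * (- ?d 1 2))) / 2"
        by (simp add: v'_def Me complex_eq_iff)
      have b: "norm (u n (of_real s) - m) \<le> 2 * \<delta>" "norm (v n (of_real s)) \<le> 2 * \<delta>" "norm (v' n (of_real s)) \<le> 2 * \<delta>"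
        unfolding um vm vm' by (rule n4, rule q', rule q', rule q', rule q'', simp, simp)+
      have "u n (of_real s) * w n (of_real s) - 1 = of_real ((norm (u n (of_real s)))\<^sup>2 - 1)"
        unfolding cn complex_norm_square[symmetric] by simp
      then have "norm (u n (of_real s) * w n (of_real s) - 1) = \<bar>(norm (u n (of_real s)))\<^sup>2 - 1\<bar>"
        by (simp only: norm_of_real)
      also have "\<dots> = \<bar>norm (u n (of_real s)) - 1\<bar> * (norm (u n (of_real s)) + 1)"
      proof -
        have sq: "x\<^sup>2 - 1 = (x - 1) * (x + 1)" for x :: real by (simp add: power2_eq_square algebra_simps)
        show ?thesis unfolding sq abs_mult by simp
      qed
      also have "\<dots> \<le> (2 * \<delta>) * (1 + 2 * \<delta> + 1)"
      proof (rule mult_mono)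
        show "\<bar>norm (u n (of_real s)) - 1\<bar> \<le> 2 * \<delta>"
          using norm_triangle_ineq3[of "u n (of_real s)" m] b(1) nm by simp
        then show "norm (u n (of_real s)) + 1 \<le> 1 + 2 * \<delta> + 1" by linarith
      qed (use \<delta> in auto)
      also have "\<dots> < 8 * \<delta>"
      proof -
        have "\<delta> * (4 * \<delta>) < \<delta> * 4" using \<delta> by (intro mult_strict_left_mono) auto
        then show ?thesis by (simp add: algebra_simps)
      qed
      finally show ?case using b s \<delta> by (intro exI[of _ s]) auto
    qed
  qed
  have lims: "(\<lambda>n. u n (of_real t) * w n (of_real t)) \<longlonglongrightarrow> 1" "(\<lambda>n. v n (of_real t)) \<longlonglongrightarrow> 0" "(\<lambda>n. v' n (of_real t)) \<longlonglongrightarrow> 0" for t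
  proof -
    show "(\<lambda>n. u n (of_real t) * w n (of_real t)) \<longlonglongrightarrow> 1"
      by (rule entire_tendsto_from_nearby[where f = "\<lambda>n z. u n z * w n z"])
        (auto intro!: holomorphic_intros holo loc_bounded_mult lb eventually_mono[OF nearby])
    show "(\<lambda>n. v n (of_real t)) \<longlonglongrightarrow> 0"
      by (rule entire_tendsto_from_nearby) (auto intro!: holo lb eventually_mono[OF nearby])
    show "(\<lambda>n. v' n (of_real t)) \<longlonglongrightarrow> 0"
      by (rule entire_tendsto_from_nearby) (auto intro!: holo lb eventually_mono[OF nearby])
  qed
  note main = entire_asymptotically_unimodular[OF holo(1,2) ty(1,2) cn lims(1)]
  define a where "a n = phase_speed (u n)" for n
  define b where "b n = unit_phase (u n)" for n
  let ?\<theta> = "\<lambda>n z. of_real (a n) * z + of_real (b n)"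
  let ?e = "\<lambda>n z. exp (- \<i> * (of_real (2 * pi) * ?\<theta> n z))" and ?e' = "\<lambda>n z. exp (\<i> * (of_real (2 * pi) * ?\<theta> n z))"
  have ba: "bounded (range a)" using main(3) by (simp add: a_def)
  have U: "uniform_limit (cball 0 R) (\<lambda>n z. ?e n z * u n z) (\<lambda>_. 1) sequentially" for R
    using main(1)[of R] by (simp add: affine_phase_def a_def b_def)
  have W: "uniform_limit (cball 0 R) (\<lambda>n z. ?e' n z * w n z) (\<lambda>_. 1) sequentially" for R
    using main(2)[of R] by (simp add: affine_phase_def a_def b_def)
  have lbe: "loc_bounded ?e" "loc_bounded ?e'"
    by (intro loc_bounded_phase ba; simp)+
  have bt: "(\<lambda>n. f n t * g n t) \<longlonglongrightarrow> 0" if "loc_bounded f" "(\<lambda>n. g n t) \<longlonglongrightarrow> 0" for f g :: "nat \<Rightarrow> complex \<Rightarrow> complex" and t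
  proof -
    note lbf = that(1)
    obtain C where "\<And>n z. norm z \<le> norm t \<Longrightarrow> norm (f n z) \<le> C" using lbf unfolding loc_bounded_def by metis
    then have "Bseq (\<lambda>n. f n t)" by (intro BseqI') auto
    then show ?thesis using that(2)
      by (simp add: tendsto_Zfun_iff bounded_bilinear.Bfun_prod_Zfun[OF bounded_bilinear_mult])
  qed
  have V: "uniform_limit (cball 0 R) (\<lambda>n z. ?e n z * v n z) (\<lambda>_. 0) sequentially" for R
    by (rule entire_tendsto_const, intro holomorphic_intros holo, rule loc_bounded_mult[OF lbe(1) lb(3)], rule bt[of ?e v, OF lbe(1) lims(2)])
  have V': "uniform_limit (cball 0 R) (\<lambda>n z. ?e' n z * v' n z) (\<lambda>_. 0) sequentially" for R
    by (rule entire_tendsto_const, intro holomorphic_intros holo, rule loc_bounded_mult[OF lbe(2) lb(4)], rule bt[of ?e' v', OF lbe(2) lims(3)])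
  show ?thesis
  proof (rule that[OF ba])
    fix R and i j :: 2
    note ent = cRot_mult_entries[where \<theta> = "?\<theta> _ _" and Q = "Q _ _", folded u_def w_def v_def v'_def]
    have ul: "uniform_limit (cball 0 R) (\<lambda>n z. (f n z) / c) (\<lambda>z. l / c) sequentially"
      if "uniform_limit (cball 0 R) f (\<lambda>_. l) sequentially" for f and l c :: complex
      using bounded_linear.uniform_limit[OF bounded_linear_divide[of c] that] by simp
    note U = U[of R] and W = W[of R] and V = V[of R] and V' = V'[of R]
    have 11: "uniform_limit (cball 0 R) (\<lambda>n z. (cRot (- ?\<theta> n z) ** Q n z) $ 1 $ 1) (\<lambda>_. 1) sequentially"
      unfolding ent using ul[OF uniform_limit_add[OF uniform_limit_add[OF U W] uniform_limit_add[OF V V']], of 2] by simp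
    have 22: "uniform_limit (cball 0 R) (\<lambda>n z. (cRot (- ?\<theta> n z) ** Q n z) $ 2 $ 2) (\<lambda>_. 1) sequentially"
      unfolding ent using ul[OF uniform_limit_minus[OF uniform_limit_add[OF U W] uniform_limit_add[OF V V']], of 2] by simp
    have 21: "uniform_limit (cball 0 R) (\<lambda>n z. (cRot (- ?\<theta> n z) ** Q n z) $ 2 $ 1) (\<lambda>_. 0) sequentially"
      unfolding ent using ul[OF uniform_limit_add[OF uniform_limit_minus[OF U W] uniform_limit_minus[OF V V']], of "2 * \<i>"] by simp
    have 12: "uniform_limit (cball 0 R) (\<lambda>n z. (cRot (- ?\<theta> n z) ** Q n z) $ 1 $ 2) (\<lambda>_. 0) sequentially"
      unfolding ent using ul[OF uniform_limit_add[OF uniform_limit_minus[OF W U] uniform_limit_minus[OF V V']], of "2 * \<i>"] by simp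
    show "uniform_limit (cball 0 R) (\<lambda>n z. (cRot (- ?\<theta> n z) ** Q n z) $ i $ j) (\<lambda>_. mat 1 $ i $ j) sequentially"
      using exhaust_2[of i] exhaust_2[of j] 11 12 21 22 by (auto simp: mat_def)
  qed
qed

section \<open>Two by two matrices and products close to the identity\<close>

lemma norm_matrix_mult_le:
  fixes X :: "'k::real_normed_field^'n^'m" and Y :: "'k^'p^'n"
  shows "norm (X ** Y) \<le> norm X * norm Y"
proof -
  have e: "norm ((X ** Y) $ i $ j) \<le> norm (X $ i) * L2_set (\<lambda>k. norm (Y $ k $ j)) UNIV" for i j
  proof -
    have "norm ((X ** Y) $ i $ j) \<le> (\<Sum>k\<in>UNIV. norm (X $ i $ k) * norm (Y $ k $ j))"
      unfolding matrix_matrix_mult_def by (simp add: norm_mult[symmetric] norm_sum)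
    also have "\<dots> \<le> L2_set (\<lambda>k. norm (X $ i $ k)) UNIV * L2_set (\<lambda>k. norm (Y $ k $ j)) UNIV"
      using L2_set_mult_ineq[of "\<lambda>k. norm (X $ i $ k)" "\<lambda>k. norm (Y $ k $ j)" UNIV] by simp
    finally show ?thesis by (simp add: norm_vec_def)
  qed
  have col: "L2_set (\<lambda>j. L2_set (\<lambda>k. norm (Y $ k $ j)) UNIV) UNIV = norm Y"
  proof -
    have "(\<Sum>j\<in>UNIV. \<Sum>k\<in>UNIV. (norm (Y $ k $ j))\<^sup>2) = (\<Sum>k\<in>UNIV. \<Sum>j\<in>UNIV. (norm (Y $ k $ j))\<^sup>2)"
      by (rule sum.swap)
    then show ?thesis by (simp add: norm_vec_def L2_set_def sum_nonneg)
  qed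
  have row: "norm ((X ** Y) $ i) \<le> norm (X $ i) * norm Y" for i
  proof -
    have "norm ((X ** Y) $ i) = L2_set (\<lambda>j. norm ((X ** Y) $ i $ j)) UNIV" by (simp add: norm_vec_def)
    also have "\<dots> \<le> L2_set (\<lambda>j. norm (X $ i) * L2_set (\<lambda>k. norm (Y $ k $ j)) UNIV) UNIV"
      by (intro L2_set_mono e) auto
    also have "\<dots> = norm (X $ i) * norm Y" by (simp add: L2_set_right_distrib[symmetric] col)
    finally show ?thesis .
  qed
  have "norm (X ** Y) \<le> L2_set (\<lambda>i. norm (X $ i) * norm Y) UNIV"
    unfolding norm_vec_def[of "X ** Y"] by (intro L2_set_mono row) auto
  also have "\<dots> = norm X * norm Y" by (simp add: L2_set_left_distrib[symmetric] norm_vec_def[of X])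
  finally show ?thesis .
qed

lemma bounded_bilinear_matrix_mult:
  "bounded_bilinear (\<lambda>(X :: 'k::real_normed_field^'n^'m) (Y :: 'k^'p^'n). X ** Y)"
proof
  fix a a' :: "'k^'n^'m" and b b' :: "'k^'p^'n" and r :: real
  show "(a + a') ** b = a ** b + a' ** b"
    by (vector matrix_matrix_mult_def sum.distrib[symmetric] field_simps)
  show "a ** (b + b') = a ** b + a ** b'" by (rule matrix_add_ldistrib)
  show "(r *\<^sub>R a) ** b = r *\<^sub>R (a ** b)"
    by (simp add: vec_eq_iff matrix_matrix_mult_def scaleR_sum_right)
  show "a ** (r *\<^sub>R b) = r *\<^sub>R (a ** b)"
    by (simp add: vec_eq_iff matrix_matrix_mult_def scaleR_sum_right)
  show "\<exists>K. \<forall>(a::'k^'n^'m) (b::'k^'p^'n). norm (a ** b) \<le> norm a * norm b * K"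
    by (intro exI[of _ 1]) (simp add: norm_matrix_mult_le)
qed

interpretation matrix_mult: bounded_bilinear "\<lambda>(X :: 'k::real_normed_field^'n^'m) (Y :: 'k^'p^'n). X ** Y"
  by (rule bounded_bilinear_matrix_mult)

lemma SL2_inverse:
  assumes "M \<in> SL2"
  shows "M ** matrix_inv M = mat 1" "matrix_inv M ** M = mat 1"
proof -
  have "invertible M" using assms by (simp add: SL2_def invertible_det_nz)
  then show "M ** matrix_inv M = mat 1" "matrix_inv M ** M = mat 1"
    unfolding invertible_def matrix_inv_def by (rule someI2_ex, simp)+
qed

lemma SL2_matrix_inv_entries:
  assumes "M \<in> SL2"
  shows "matrix_inv M $ 1 $ 1 = M $ 2 $ 2" "matrix_inv M $ 1 $ 2 = - M $ 1 $ 2"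
    "matrix_inv M $ 2 $ 1 = - M $ 2 $ 1" "matrix_inv M $ 2 $ 2 = M $ 1 $ 1"
proof -
  define N :: "real^2^2" where "N = vector [vector [M $ 2 $ 2, - M $ 1 $ 2], vector [- M $ 2 $ 1, M $ 1 $ 1]]"
  have "M ** N = mat 1"
    using assms by (simp add: SL2_def N_def vec_eq_iff forall_2 matrix_matrix_mult_def mat_def sum_2 det_2 algebra_simps)
  then have "matrix_inv M ** (M ** N) = matrix_inv M ** mat 1" by simp
  then have "N = matrix_inv M" by (simp add: matrix_mul_assoc SL2_inverse[OF assms])
  then show "matrix_inv M $ 1 $ 1 = M $ 2 $ 2" "matrix_inv M $ 1 $ 2 = - M $ 1 $ 2"
    "matrix_inv M $ 2 $ 1 = - M $ 2 $ 1" "matrix_inv M $ 2 $ 2 = M $ 1 $ 1"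
    by (simp_all add: N_def flip: \<open>N = matrix_inv M\<close>)
qed

lemma SL2_matrix_inv: "M \<in> SL2 \<Longrightarrow> matrix_inv M \<in> SL2"
  by (simp add: SL2_def det_2 SL2_matrix_inv_entries[unfolded SL2_def] mult.commute)

lemma SL2_mult: "M \<in> SL2 \<Longrightarrow> N \<in> SL2 \<Longrightarrow> M ** N \<in> SL2"
  by (simp add: SL2_def det_mul)

lemma SL2_one: "mat 1 \<in> SL2"
  by (simp add: SL2_def)

lemma norm_SL2_inv: "M \<in> SL2 \<Longrightarrow> norm (matrix_inv M) = norm M"
  by (simp add: norm_vec_def L2_set_def sum_2 SL2_matrix_inv_entries add_ac)

lemma SL2_inv_mult:
  assumes "M \<in> SL2" "N \<in> SL2"
  shows "matrix_inv (M ** N) = matrix_inv N ** matrix_inv M"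
proof -
  have "(M ** N) ** (matrix_inv N ** matrix_inv M) = M ** (N ** matrix_inv N) ** matrix_inv M"
    by (simp add: matrix_mul_assoc)
  then have 1: "(M ** N) ** (matrix_inv N ** matrix_inv M) = mat 1" using assms by (simp add: SL2_inverse)
  have "matrix_inv (M ** N) ** ((M ** N) ** (matrix_inv N ** matrix_inv M)) = matrix_inv N ** matrix_inv M"
    using SL2_inverse(2)[OF SL2_mult[OF assms]] by (simp add: matrix_mul_assoc)
  then show ?thesis by (simp add: 1)
qed

lemma SL2_inv_inv: "M \<in> SL2 \<Longrightarrow> matrix_inv (matrix_inv M) = M"
  by (simp add: vec_eq_iff forall_2 SL2_matrix_inv_entries SL2_matrix_inv)

definition cmat :: "real^'n^'m \<Rightarrow> 'k::real_normed_field^'n^'m" where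
  "cmat M = (\<chi> i j. of_real (M $ i $ j))"

lemma cmat_nth [simp]: "cmat M $ i $ j = of_real (M $ i $ j)"
  by (simp add: cmat_def)

lemma cmat_mult: "cmat (M ** N) = cmat M ** cmat N"
  by (simp add: vec_eq_iff matrix_matrix_mult_def)

lemma cmat_one [simp]: "cmat (mat 1) = mat 1"
  by (simp add: vec_eq_iff mat_def)

lemma cmat_add: "cmat (M + N) = cmat M + cmat N" and cmat_diff: "cmat (M - N) = cmat M - cmat N"
  by (simp_all add: vec_eq_iff)

lemma cmat_real [simp]: "(cmat M :: real^'n^'m) = M"
  by (simp add: vec_eq_iff)

lemma norm_cmat [simp]: "norm (cmat M) = norm M"
  by (simp add: norm_vec_def)

primrec near_prod :: "(nat \<Rightarrow> 'k \<Rightarrow> 'k::real_normed_field^2^2) \<Rightarrow> nat \<Rightarrow> 'k \<Rightarrow> 'k^2^2" where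
  "near_prod H 0 p = mat 1"
| "near_prod H (Suc k) p = (mat 1 + H k p) ** near_prod H k p"

primrec local_prod :: "(nat \<Rightarrow> 'k \<Rightarrow> 'k::real_normed_field^2^2) \<Rightarrow> nat \<Rightarrow> 'k \<Rightarrow> 'k^2^2" where
  "local_prod F 0 p = mat 1"
| "local_prod F (Suc k) p = F k p ** local_prod F k p"

lemma norm_mat_1_2 [simp]: "norm (mat 1 :: 'k::real_normed_field^2^2) = sqrt 2"
  by (simp add: norm_vec_def L2_set_def sum_2 mat_def)

text \<open>
  An abstract scale for measuring matrix-valued functions: \<open>sm c X\<close> means that \<open>X\<close> is of the given
  regularity with norm at most \<open>c\<close>. The two instances are \<open>k\<close> bounded derivatives on \<open>[-T, T]\<close>
  (for \<open>'k\<close> the reals) and bounded holomorphy on a disc (for \<open>'k\<close> the complex numbers); \<open>cpx\<close> is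
  the inclusion into the complex numbers. The last assumption says that entire functions which are
  small on the disc of radius \<open>Tr\<close> are small on the scale.
\<close>

locale matrix_scale =
  fixes sm :: "real \<Rightarrow> ('k \<Rightarrow> 'k::real_normed_field^2^2) \<Rightarrow> bool"
    and cpx :: "'k \<Rightarrow> complex" and rot :: "'k \<Rightarrow> 'k^2^2"
    and T Cm Cr Tr :: real
  assumes T_nonneg: "0 \<le> T" and Cm: "1 \<le> Cm" and Cr: "0 \<le> Cr"
    and sm_const: "sm (norm M) (\<lambda>_. M)"
    and sm_id: "sm (Cm * \<bar>\<beta>\<bar>) (\<lambda>p. mat (of_real \<beta> * p))"
    and sm_add: "sm c X \<Longrightarrow> sm d Y \<Longrightarrow> sm (c + d) (\<lambda>p. X p + Y p)"
    and sm_mult: "sm c X \<Longrightarrow> sm d Y \<Longrightarrow> sm (Cm * c * d) (\<lambda>p. X p ** Y p)"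
    and sm_mono: "sm c X \<Longrightarrow> c \<le> d \<Longrightarrow> sm d X"
    and sm_pointwise: "sm c X \<Longrightarrow> norm p \<le> T \<Longrightarrow> norm (X p) \<le> c"
    and cpx_hom: "cpx (x + y) = cpx x + cpx y" "cpx (x * y) = cpx x * cpx y" "cpx (of_real r) = of_real r"
    and rot: "cpx (rot p $ i $ j) = cRot (cpx p) $ i $ j"
    and sm_restrict: "(\<And>i j. (\<lambda>z. F z $ i $ j) holomorphic_on UNIV) \<Longrightarrow>
      (\<And>p i j. F (cpx p) $ i $ j = cpx (f p $ i $ j)) \<Longrightarrow>
      (\<And>z i j. norm z \<le> Tr \<Longrightarrow> norm (F z $ i $ j) \<le> c) \<Longrightarrow> sm (Cr * c) f"
begin

lemma sm_nonneg: "sm c X \<Longrightarrow> 0 \<le> c"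
  using sm_pointwise[of c X 0] T_nonneg norm_ge_zero[of "X 0"] by (simp del: norm_ge_zero)

lemma sm_conjugate:
  assumes "sm c X" shows "sm (Cm\<^sup>2 * norm P * c * norm Q) (\<lambda>p. P ** X p ** Q)"
  using sm_mult[OF sm_mult[OF sm_const[of P] assms] sm_const[of Q]]
  by (simp add: power2_eq_square mult_ac)

text \<open>
  Each factor multiplies the norm by at most \<open>1 + Cm * h k\<close>. Writing \<open>(1 + H) W\<close> as \<open>W + H W\<close>
  makes sure that the constant \<open>Cm\<close> multiplies only the small part, so it does not accumulate.
\<close>

lemma sm_near_prod:
  assumes "\<And>k. k < m \<Longrightarrow> sm (h k) (H k)"
  shows "sm (sqrt 2 * exp (Cm * (\<Sum>k<m. h k))) (near_prod H m)"
  using assms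
proof (induction m)
  case 0
  then show ?case using sm_const[of "mat 1"] by simp
next
  case (Suc m)
  define w where "w = sqrt 2 * exp (Cm * (\<Sum>k<m. h k))"
  have IH: "sm w (near_prod H m)" unfolding w_def using Suc by simp
  have h: "sm (h m) (H m)" using Suc by simp
  have "sm (w + Cm * h m * w) (\<lambda>p. near_prod H m p + H m p ** near_prod H m p)"
    by (rule sm_add[OF IH sm_mult[OF h IH]])
  moreover have "(\<lambda>p. near_prod H m p + H m p ** near_prod H m p) = near_prod H (Suc m)"
    by (simp add: fun_eq_iff matrix_mult.add_left)
  moreover have "w + Cm * h m * w \<le> sqrt 2 * exp (Cm * (\<Sum>k<Suc m. h k))"
  proof -
    have "w * (1 + Cm * h m) \<le> w * exp (Cm * h m)" using sm_nonneg[OF IH] by (intro mult_left_mono) auto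
    also have "\<dots> = sqrt 2 * exp (Cm * (\<Sum>k<Suc m. h k))" by (simp add: w_def exp_add[symmetric] distrib_left)
    finally show ?thesis by (simp add: algebra_simps)
  qed
  ultimately show ?case using sm_mono by metis
qed

text \<open>
  A discrete Gronwall estimate: the products differ by at most the sum of the differences of the
  factors, up to the exponentials of the sums of their sizes.
\<close>

lemma sm_near_prod_diff:
  assumes "\<And>k. k < m \<Longrightarrow> sm (h k) (H k)" "\<And>k. k < m \<Longrightarrow> sm (g k) (G k)"
    and "\<And>k. k < m \<Longrightarrow> sm (d k) (\<lambda>p. H k p - G k p)"
  shows "sm (Cm * sqrt 2 * (\<Sum>k<m. d k) * exp (Cm * (\<Sum>k<m. h k)) * exp (Cm * (\<Sum>k<m. g k)))
    (\<lambda>p. near_prod H m p - near_prod G m p)"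
  using assms
proof (induction m)
  case 0
  then show ?case using sm_const[of 0] by simp
next
  case (Suc m)
  define E where "E = exp (Cm * (\<Sum>k<m. h k))"
  define F where "F = exp (Cm * (\<Sum>k<m. g k))"
  define D where "D = (\<Sum>k<m. d k)"
  define e where "e = Cm * sqrt 2 * D * E * F"
  have IH: "sm e (\<lambda>p. near_prod H m p - near_prod G m p)"
    unfolding e_def D_def E_def F_def using Suc by simp
  have h: "sm (h m) (H m)" and g: "sm (g m) (G m)" and d: "sm (d m) (\<lambda>p. H m p - G m p)" using Suc by simp_all
  have W: "sm (sqrt 2 * F) (near_prod G m)" unfolding F_def using Suc by (intro sm_near_prod) simp
  note nn = sm_nonneg[OF h] sm_nonneg[OF g] sm_nonneg[OF d]
  have D0: "0 \<le> D" unfolding D_def by (intro sum_nonneg) (rule sm_nonneg[OF Suc.prems(3)], simp)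
  have E1: "1 \<le> E"
  proof -
    have "0 \<le> (\<Sum>k<m. h k)" by (intro sum_nonneg) (rule sm_nonneg[OF Suc.prems(1)], simp)
    then show ?thesis using Cm by (simp add: E_def)
  qed
  have F0: "0 < F" by (simp add: F_def)
  have A: "sm ((e + Cm * h m * e) + Cm * d m * (sqrt 2 * F))
    (\<lambda>p. (near_prod H m p - near_prod G m p) + H m p ** (near_prod H m p - near_prod G m p)
      + (H m p - G m p) ** near_prod G m p)"
    by (intro sm_add sm_mult IH h d W)
  have eq: "(\<lambda>p. (near_prod H m p - near_prod G m p) + H m p ** (near_prod H m p - near_prod G m p)
      + (H m p - G m p) ** near_prod G m p) = (\<lambda>p. near_prod H (Suc m) p - near_prod G (Suc m) p)"
    by (simp add: fun_eq_iff matrix_mult.add_left matrix_mult.diff_left matrix_mult.diff_right)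
  have le: "(e + Cm * h m * e) + Cm * d m * (sqrt 2 * F)
      \<le> Cm * sqrt 2 * (\<Sum>k<Suc m. d k) * exp (Cm * (\<Sum>k<Suc m. h k)) * exp (Cm * (\<Sum>k<Suc m. g k))"
  proof -
    define E' where "E' = exp (Cm * h m)"
    define F' where "F' = exp (Cm * g m)"
    have E'1: "1 + Cm * h m \<le> E'" "1 \<le> E'" unfolding E'_def using nn Cm by auto
    have F'1: "1 \<le> F'" unfolding F'_def using nn Cm by auto
    have "e + Cm * h m * e = e * (1 + Cm * h m)" by (simp add: algebra_simps)
    also have "\<dots> \<le> e * (E' * F')"
    proof (rule mult_left_mono)
      have "(1 + Cm * h m) * 1 \<le> E' * F'" using E'1 F'1 by (intro mult_mono) auto
      then show "1 + Cm * h m \<le> E' * F'" by simp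
      show "0 \<le> e" by (rule sm_nonneg[OF IH])
    qed
    also have "\<dots> = Cm * sqrt 2 * D * (E * E' * (F * F'))" by (simp add: e_def mult_ac)
    finally have 1: "e + Cm * h m * e \<le> Cm * sqrt 2 * D * (E * E' * (F * F'))" .
    have "Cm * d m * (sqrt 2 * F) = Cm * sqrt 2 * d m * (1 * (F * 1))" by simp
    also have "\<dots> \<le> Cm * sqrt 2 * d m * (E * E' * (F * F'))"
    proof (rule mult_left_mono)
      have "1 * 1 \<le> E * E'" using E1 E'1 by (intro mult_mono) auto
      moreover have "F * 1 \<le> F * F'" using F0 F'1 by (intro mult_left_mono) auto
      ultimately show "1 * (F * 1) \<le> E * E' * (F * F')" using F0 by - (rule mult_mono, linarith+)
    qed (use Cm nn in auto)
    finally have "(e + Cm * h m * e) + Cm * d m * (sqrt 2 * F) \<le> Cm * sqrt 2 * (D + d m) * (E * E' * (F * F'))"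
      using 1 by (simp add: algebra_simps)
    then show ?thesis by (simp add: D_def E_def F_def E'_def F'_def exp_add distrib_left mult_ac)
  qed
  show ?case by (rule sm_mono[OF A[unfolded eq] le])
qed

end

section \<open>Comparison of iterates with their tangent products\<close>

lemma cocycle_pow_SL2: "(\<And>x. A x \<in> SL2) \<Longrightarrow> cocycle_pow \<alpha> A n x \<in> SL2"
  by (induction n) (auto intro: SL2_one SL2_mult)

text \<open>
  For \<open>F k p = A (xs + k \<alpha> + \<beta> p)\<close>, the factor by which the quotient of the iterates at the moved
  point and at \<open>xs\<close> changes in step \<open>k\<close>, minus the identity.
\<close>

definition exact_factor ::
  "real \<Rightarrow> (real \<Rightarrow> real^2^2) \<Rightarrow> real \<Rightarrow> (nat \<Rightarrow> 'k \<Rightarrow> 'k^2^2) \<Rightarrow> nat \<Rightarrow> 'k \<Rightarrow> 'k::real_normed_field^2^2" where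
  "exact_factor \<alpha> A xs F k p = cmat (matrix_inv (cocycle_pow \<alpha> A (Suc k) xs)) ** F k p ** cmat (cocycle_pow \<alpha> A k xs) - mat 1"

text \<open>
  The first-order part of the exact factor. It is linear in \<open>p\<close>, so the corresponding products are
  polynomials and extend to the complex plane whatever the regularity of \<open>A\<close>.
\<close>

definition tangent_factor ::
  "real \<Rightarrow> (real \<Rightarrow> real^2^2) \<Rightarrow> (real \<Rightarrow> real^2^2) \<Rightarrow> real \<Rightarrow> real \<Rightarrow> nat \<Rightarrow> 'k \<Rightarrow> 'k::real_normed_field^2^2" where
  "tangent_factor \<alpha> A dA xs \<beta> k p = cmat (matrix_inv (cocycle_pow \<alpha> A (Suc k) xs)) **
     (mat (of_real \<beta> * p) ** cmat (dA (xs + real k * \<alpha>))) ** cmat (cocycle_pow \<alpha> A k xs)"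

abbreviation "exact_prod \<alpha> A xs F \<equiv> near_prod (exact_factor \<alpha> A xs F)"
abbreviation "tangent_prod \<alpha> A dA xs \<beta> \<equiv> near_prod (tangent_factor \<alpha> A dA xs \<beta>)"

lemma local_prod_eq_near_prod:
  assumes SL2: "\<And>x. A x \<in> SL2"
  shows "local_prod F m p = cmat (cocycle_pow \<alpha> A m xs) ** exact_prod \<alpha> A xs F m p"
proof (induction m)
  case (Suc m)
  let ?C = "cmat (cocycle_pow \<alpha> A m xs)" and ?D = "cmat (cocycle_pow \<alpha> A (Suc m) xs)"
    and ?E = "cmat (matrix_inv (cocycle_pow \<alpha> A (Suc m) xs))"
  have DE: "?D ** ?E = mat 1"
    unfolding cmat_mult[symmetric] SL2_inverse(1)[OF cocycle_pow_SL2[OF SL2]] by simp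
  have "?D ** (mat 1 + exact_factor \<alpha> A xs F m p) = (?D ** ?E) ** F m p ** ?C"
    by (simp add: exact_factor_def matrix_mul_assoc del: cocycle_pow.simps)
  also have "\<dots> = F m p ** ?C" by (simp only: DE matrix_mul_lid)
  finally show ?case using Suc by (simp add: matrix_mul_assoc del: cocycle_pow.simps)
qed simp

lemma local_prod_of_real:
  assumes "\<And>k. k < m \<Longrightarrow> F k (of_real t) = cmat (A (x + real k * \<alpha>))"
  shows "local_prod F m (of_real t) = cmat (cocycle_pow \<alpha> A m x)"
  using assms by (induction m) (auto simp: cmat_mult)

lemma tangent_factor_of_real:
  "(tangent_factor \<alpha> A dA xs \<beta> k (of_real t) :: 'k::real_normed_field^2^2) = cmat (tangent_factor \<alpha> A dA xs \<beta> k t)"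
proof -
  have "(mat (of_real \<beta> * of_real t) :: 'k^2^2) = cmat (mat (\<beta> * t))" by (simp add: vec_eq_iff mat_def)
  then show ?thesis by (simp add: tangent_factor_def cmat_mult del: cocycle_pow.simps)
qed

lemma near_prod_tangent_of_real:
  "tangent_prod \<alpha> A dA xs \<beta> m (of_real t) = cmat (tangent_prod \<alpha> A dA xs \<beta> m t)"
  by (induction m) (simp_all add: tangent_factor_of_real cmat_mult cmat_add)

lemma norm_mat_2: "norm (mat c :: 'k::real_normed_field^2^2) = sqrt 2 * norm c"
  by (simp add: norm_vec_def L2_set_def sum_2 mat_def real_sqrt_mult)

text \<open>
  The conclusion of the maximal inequality at the base point \<open>xs\<close>; \<open>dA\<close> will be the derivative of
  \<open>A\<close>.
\<close>

locale bounded_averages =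
  fixes \<alpha> :: real and A dA :: "real \<Rightarrow> real^2^2" and xs S M0 M1 :: real
  assumes SL2: "\<And>x. A x \<in> SL2" and M0: "\<And>x. norm (A x) \<le> M0" and M1: "\<And>x. norm (dA x) \<le> M1"
    and avg: "\<And>n. (\<Sum>k<n. (norm (cocycle_pow \<alpha> A k xs))\<^sup>2) \<le> S * real n"
begin

lemma nonneg: "0 \<le> M0" "0 \<le> M1" "0 \<le> S"
  using order_trans[OF norm_ge_zero M0] order_trans[OF norm_ge_zero M1] avg[of 1] by simp_all

lemma pow_SL2: "cocycle_pow \<alpha> A n x \<in> SL2"
  by (rule cocycle_pow_SL2[OF SL2])

lemma norm_inv_pow: "norm (matrix_inv (cocycle_pow \<alpha> A (Suc k) xs)) \<le> M0 * norm (cocycle_pow \<alpha> A k xs)"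
proof -
  have "norm (matrix_inv (cocycle_pow \<alpha> A (Suc k) xs)) = norm (A (xs + real k * \<alpha>) ** cocycle_pow \<alpha> A k xs)"
    by (subst norm_SL2_inv[OF pow_SL2]) simp
  also have "\<dots> \<le> norm (A (xs + real k * \<alpha>)) * norm (cocycle_pow \<alpha> A k xs)" by (rule norm_matrix_mult_le)
  also have "\<dots> \<le> M0 * norm (cocycle_pow \<alpha> A k xs)" by (intro mult_right_mono M0) simp
  finally show ?thesis .
qed

lemma scaled_sum_le:
  assumes "real m * \<bar>\<beta>\<bar> \<le> 1" "0 \<le> c"
  shows "(\<Sum>k<m. c * \<bar>\<beta>\<bar> * (norm (cocycle_pow \<alpha> A k xs))\<^sup>2) \<le> c * S"
proof -
  have "(\<Sum>k<m. c * \<bar>\<beta>\<bar> * (norm (cocycle_pow \<alpha> A k xs))\<^sup>2) = c * \<bar>\<beta>\<bar> * (\<Sum>k<m. (norm (cocycle_pow \<alpha> A k xs))\<^sup>2)"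
    by (simp add: sum_distrib_left)
  also have "\<dots> \<le> c * \<bar>\<beta>\<bar> * (S * real m)" using assms by (intro mult_left_mono avg) auto
  also have "\<dots> = c * S * (real m * \<bar>\<beta>\<bar>)" by simp
  also have "\<dots> \<le> c * S * 1" using assms nonneg by (intro mult_left_mono) auto
  finally show ?thesis by simp
qed

text \<open>
  The averages bound the sum of the norms of the linear coefficients, whence exponential type
  uniformly in \<open>m\<close> and \<open>\<beta>\<close>.
\<close>

lemma norm_near_prod_tangent_le:
  fixes p :: "'k::real_normed_field"
  assumes "real m * \<bar>\<beta>\<bar> \<le> 1"
  shows "norm (tangent_prod \<alpha> A dA xs \<beta> m p) \<le> sqrt 2 * exp (sqrt 2 * M0 * M1 * S * norm p)"
proof -
  let ?G = "tangent_factor \<alpha> A dA xs \<beta> :: nat \<Rightarrow> 'k \<Rightarrow> 'k^2^2"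
  have G: "norm (?G k p) \<le> (sqrt 2 * M0 * M1 * norm p) * \<bar>\<beta>\<bar> * (norm (cocycle_pow \<alpha> A k xs))\<^sup>2" for k
  proof -
    have "norm (?G k p) \<le> norm (matrix_inv (cocycle_pow \<alpha> A (Suc k) xs)) * (norm (mat (of_real \<beta> * p) :: 'k^2^2) * norm (dA (xs + real k * \<alpha>))) * norm (cocycle_pow \<alpha> A k xs)"
      unfolding tangent_factor_def
      by (rule order_trans[OF norm_matrix_mult_le] mult_mono norm_matrix_mult_le | simp del: cocycle_pow.simps)+
    also have "\<dots> \<le> (M0 * norm (cocycle_pow \<alpha> A k xs)) * ((sqrt 2 * (\<bar>\<beta>\<bar> * norm p)) * M1) * norm (cocycle_pow \<alpha> A k xs)"
      using nonneg norm_inv_pow[of k] M1 by (intro mult_mono) (auto simp: norm_mat_2 norm_mult simp del: cocycle_pow.simps)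
    finally show ?thesis by (simp add: power2_eq_square mult_ac)
  qed
  have "norm (near_prod ?G j p) \<le> sqrt 2 * exp (\<Sum>k<j. norm (?G k p))" for j
  proof (induction j)
    case (Suc j)
    have "norm (near_prod ?G (Suc j) p) \<le> norm (near_prod ?G j p) + norm (?G j p) * norm (near_prod ?G j p)"
      by (simp add: matrix_mult.add_left order_trans[OF norm_triangle_ineq] norm_matrix_mult_le)
    also have "\<dots> = norm (near_prod ?G j p) * (1 + norm (?G j p))" by (simp add: algebra_simps)
    also have "\<dots> \<le> (sqrt 2 * exp (\<Sum>k<j. norm (?G k p))) * exp (norm (?G j p))"
      using Suc by (intro mult_mono) auto
    finally show ?case by (simp add: exp_add mult_ac)
  qed simp
  note this[of m]
  also have "(\<Sum>k<m. norm (?G k p)) \<le> (\<Sum>k<m. (sqrt 2 * M0 * M1 * norm p) * \<bar>\<beta>\<bar> * (norm (cocycle_pow \<alpha> A k xs))\<^sup>2)"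
    by (intro sum_mono G)
  also have "\<dots> \<le> (sqrt 2 * M0 * M1 * norm p) * S"
    using nonneg by (intro scaled_sum_le assms) auto
  finally show ?thesis by (simp add: mult_ac)
qed

end

lemma holomorphic_matrix_mult:
  fixes F G :: "complex \<Rightarrow> complex^2^2"
  assumes "\<And>i j. (\<lambda>z. F z $ i $ j) holomorphic_on U" "\<And>i j. (\<lambda>z. G z $ i $ j) holomorphic_on U"
  shows "(\<lambda>z. (F z ** G z) $ i $ j) holomorphic_on U"
  unfolding matrix_matrix_mult_def by (simp add: sum_2) (intro holomorphic_intros assms)

lemma holomorphic_mat:
  assumes "f holomorphic_on U" shows "(\<lambda>z. (mat (f z) :: complex^2^2) $ i $ j) holomorphic_on U"
  using assms by (cases "i = j") (auto simp: mat_def)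

lemma holomorphic_near_prod_tangent:
  "(\<lambda>z. tangent_prod \<alpha> A dA xs \<beta> m z $ i $ j) holomorphic_on U"
proof (induction m arbitrary: i j)
  case (Suc m)
  have "(\<lambda>z. tangent_factor \<alpha> A dA xs \<beta> m z $ i $ j) holomorphic_on U" for i j
    unfolding tangent_factor_def by (intro holomorphic_matrix_mult holomorphic_mat holomorphic_intros)
  then have "(\<lambda>z. (mat 1 + tangent_factor \<alpha> A dA xs \<beta> m z) $ i $ j) holomorphic_on U" for i j
    by (simp only: vector_add_component) (intro holomorphic_intros)
  then show ?case using Suc by (simp add: holomorphic_matrix_mult)
qed simp

context matrix_scale
begin

text \<open>
  The errors of the factors are \<open>o(\<beta>)\<close> times the squared norms of the iterates; these sum up to
  \<open>O(m)\<close>, and \<open>m * \<beta>\<close> is at most 1. So the exact products have the same limits as the polynomials.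
\<close>

lemma near_prod_exact_tangent:
  fixes F :: "nat \<Rightarrow> nat \<Rightarrow> 'k \<Rightarrow> 'k^2^2" and m :: "nat \<Rightarrow> nat" and \<beta> :: "nat \<Rightarrow> real"
  assumes "bounded_averages \<alpha> A dA xs S M0 M1" and m\<beta>: "\<And>n. real (m n) * \<bar>\<beta> n\<bar> \<le> 1"
    and approx: "\<And>\<epsilon>. 0 < \<epsilon> \<Longrightarrow> \<forall>\<^sub>F n in sequentially. \<forall>k<m n. sm (\<bar>\<beta> n\<bar> * \<epsilon>)
      (\<lambda>p. F n k p - cmat (A (xs + real k * \<alpha>)) - mat (of_real (\<beta> n) * p) ** cmat (dA (xs + real k * \<alpha>)))"
    and \<epsilon>: "0 < \<epsilon>"
  shows "\<forall>\<^sub>F n in sequentially. sm \<epsilon> (\<lambda>p. exact_prod \<alpha> A xs (F n) (m n) p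
    - tangent_prod \<alpha> A dA xs (\<beta> n) (m n) p)"
proof -
  interpret bounded_averages \<alpha> A dA xs S M0 M1 by fact
  let ?a = "\<lambda>k. norm (cocycle_pow \<alpha> A k xs)"
  define G where "G = Cm^4 * M0 * M1 * S"
  define D where "D = Cm\<^sup>2 * M0 * S"
  define Z where "Z = Cm * sqrt 2 * exp (Cm * (G + 1)) * exp (Cm * G)"
  have D0: "0 \<le> D" using nonneg by (simp add: D_def)
  have Z0: "0 < Z" using Cm by (simp add: Z_def)
  \<comment> \<open>\<open>D * \<delta>\<close> bounds the sum of the errors of the factors; it has to be at most 1 to keep the
    sum of the sizes of the exact factors bounded, and at most \<open>\<epsilon> / Z\<close> for the conclusion.\<close>
  define \<delta> where "\<delta> = min 1 (\<epsilon> / Z) / (D + 1)"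
  have \<delta>: "0 < \<delta>" using \<epsilon> Z0 D0 by (simp add: \<delta>_def)
  have "D * \<delta> \<le> (D + 1) * \<delta>" using \<delta> by simp
  also have "\<dots> = min 1 (\<epsilon> / Z)" using D0 by (simp add: \<delta>_def)
  finally have D\<delta>: "D * \<delta> \<le> 1" "D * \<delta> \<le> \<epsilon> / Z" by auto
  show ?thesis using approx[OF \<delta>]
  proof eventually_elim
    case (elim n)
    let ?\<beta> = "\<beta> n"
    define g where "g k = Cm^4 * M0 * M1 * \<bar>?\<beta>\<bar> * (?a k)\<^sup>2" for k
    define d where "d k = Cm\<^sup>2 * M0 * \<delta> * \<bar>?\<beta>\<bar> * (?a k)\<^sup>2" for k
    have sg: "sm (g k) (tangent_factor \<alpha> A dA xs ?\<beta> k)" for k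
    proof -
      have "sm (Cm\<^sup>2 * norm (cmat (matrix_inv (cocycle_pow \<alpha> A (Suc k) xs)) :: 'k^2^2) * (Cm * (Cm * \<bar>?\<beta>\<bar>) * norm (cmat (dA (xs + real k * \<alpha>)) :: 'k^2^2)) * norm (cmat (cocycle_pow \<alpha> A k xs) :: 'k^2^2))
        (tangent_factor \<alpha> A dA xs ?\<beta> k)"
        unfolding tangent_factor_def[abs_def] by (intro sm_conjugate sm_mult sm_id sm_const)
      then show ?thesis
      proof (rule sm_mono)
        have "Cm\<^sup>2 * norm (matrix_inv (cocycle_pow \<alpha> A (Suc k) xs)) * (Cm * (Cm * \<bar>?\<beta>\<bar>) * norm (dA (xs + real k * \<alpha>))) * ?a k
          \<le> Cm\<^sup>2 * (M0 * ?a k) * (Cm * (Cm * \<bar>?\<beta>\<bar>) * M1) * ?a k"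
          using norm_inv_pow[of k] M1 nonneg Cm by (intro mult_mono mult_nonneg_nonneg) auto
        also have "\<dots> = g k" by (simp add: g_def power2_eq_square power4_eq_xxxx mult_ac)
        finally show "Cm\<^sup>2 * norm (cmat (matrix_inv (cocycle_pow \<alpha> A (Suc k) xs)) :: 'k^2^2) * (Cm * (Cm * \<bar>?\<beta>\<bar>) * norm (cmat (dA (xs + real k * \<alpha>)) :: 'k^2^2)) * norm (cmat (cocycle_pow \<alpha> A k xs) :: 'k^2^2) \<le> g k"
          by (simp del: cocycle_pow.simps)
      qed
    qed
    have sd: "sm (d k) (\<lambda>p. exact_factor \<alpha> A xs (F n) k p - tangent_factor \<alpha> A dA xs ?\<beta> k p)" if "k < m n" for k
    proof -
      let ?X = "\<lambda>p. F n k p - cmat (A (xs + real k * \<alpha>)) - mat (of_real ?\<beta> * p) ** cmat (dA (xs + real k * \<alpha>))"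
      let ?P = "cmat (matrix_inv (cocycle_pow \<alpha> A (Suc k) xs)) :: 'k^2^2" and ?Q = "cmat (cocycle_pow \<alpha> A k xs) :: 'k^2^2"
      have one: "?P ** cmat (A (xs + real k * \<alpha>)) ** ?Q = mat 1"
      proof -
        have "?P ** cmat (A (xs + real k * \<alpha>)) ** ?Q = cmat (matrix_inv (cocycle_pow \<alpha> A (Suc k) xs) ** cocycle_pow \<alpha> A (Suc k) xs)"
          unfolding cocycle_pow.simps cmat_mult by (simp only: matrix_mul_assoc)
        then show ?thesis by (simp only: SL2_inverse(2)[OF pow_SL2] cmat_one)
      qed
      have A: "sm (Cm\<^sup>2 * norm ?P * (\<bar>?\<beta>\<bar> * \<delta>) * norm ?Q) (\<lambda>p. ?P ** ?X p ** ?Q)"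
        using elim that by (intro sm_conjugate) auto
      have eq: "(\<lambda>p. ?P ** ?X p ** ?Q) = (\<lambda>p. exact_factor \<alpha> A xs (F n) k p - tangent_factor \<alpha> A dA xs ?\<beta> k p)"
        unfolding exact_factor_def tangent_factor_def matrix_mult.diff_left matrix_mult.diff_right one ..
      have le: "Cm\<^sup>2 * norm ?P * (\<bar>?\<beta>\<bar> * \<delta>) * norm ?Q \<le> d k"
      proof -
        have "Cm\<^sup>2 * norm (matrix_inv (cocycle_pow \<alpha> A (Suc k) xs)) * (\<bar>?\<beta>\<bar> * \<delta>) * ?a k \<le> Cm\<^sup>2 * (M0 * ?a k) * (\<bar>?\<beta>\<bar> * \<delta>) * ?a k"
          using norm_inv_pow[of k] nonneg Cm \<delta> by (intro mult_mono mult_nonneg_nonneg) auto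
        also have "\<dots> = d k" by (simp add: d_def power2_eq_square mult_ac)
        finally show ?thesis by (simp del: cocycle_pow.simps)
      qed
      show ?thesis by (rule sm_mono[OF A[unfolded eq] le])
    qed
    have sh: "sm (g k + d k) (exact_factor \<alpha> A xs (F n) k)" if "k < m n" for k
      using sm_add[OF sg[of k] sd[OF that]] by simp
    have Sg: "(\<Sum>k<m n. g k) \<le> G"
      unfolding g_def G_def using nonneg by (intro scaled_sum_le m\<beta>) auto
    have "(\<Sum>k<m n. d k) \<le> (Cm\<^sup>2 * M0 * \<delta>) * S"
      unfolding d_def using nonneg \<delta> by (intro scaled_sum_le m\<beta>) auto
    then have Sd: "(\<Sum>k<m n. d k) \<le> D * \<delta>" by (simp add: D_def mult_ac)
    have Sd0: "0 \<le> (\<Sum>k<m n. d k)" using nonneg \<delta> by (intro sum_nonneg) (simp add: d_def)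
    have Sh: "(\<Sum>k<m n. g k + d k) \<le> G + 1" using Sg Sd D\<delta> by (simp add: sum.distrib)
    have "sm (Cm * sqrt 2 * (\<Sum>k<m n. d k) * exp (Cm * (\<Sum>k<m n. g k + d k)) * exp (Cm * (\<Sum>k<m n. g k)))
      (\<lambda>p. exact_prod \<alpha> A xs (F n) (m n) p - near_prod (tangent_factor \<alpha> A dA xs ?\<beta>) (m n) p)"
      by (intro sm_near_prod_diff sh sg sd)
    then show ?case
    proof (rule sm_mono)
      have "Cm * sqrt 2 * (\<Sum>k<m n. d k) * exp (Cm * (\<Sum>k<m n. g k + d k)) * exp (Cm * (\<Sum>k<m n. g k))
        \<le> Cm * sqrt 2 * (D * \<delta>) * exp (Cm * (G + 1)) * exp (Cm * G)"
        using Cm Sd0 Sd Sh Sg D0 \<delta> by (intro mult_mono mult_nonneg_nonneg) auto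
      also have "\<dots> = Z * (D * \<delta>)" by (simp add: Z_def mult_ac)
      also have "\<dots> \<le> Z * (\<epsilon> / Z)" using D\<delta> Z0 by (intro mult_left_mono) auto
      also have "\<dots> = \<epsilon>" using Z0 by simp
      finally show "Cm * sqrt 2 * (\<Sum>k<m n. d k) * exp (Cm * (\<Sum>k<m n. g k + d k)) * exp (Cm * (\<Sum>k<m n. g k)) \<le> \<epsilon>" .
    qed
  qed
qed

end

section \<open>Transfer of convergence from the tangent products\<close>

lemma norm_matrix2_le:
  fixes M :: "'k::real_normed_field^2^2"
  assumes "\<And>i j. norm (M $ i $ j) \<le> c"
  shows "norm M \<le> 2 * c"
proof -
  have c: "0 \<le> c" using assms[of 1 1] norm_ge_zero order_trans by blast
  have "(\<Sum>i\<in>UNIV. \<Sum>j\<in>UNIV. (norm (M $ i $ j))\<^sup>2) \<le> (\<Sum>i\<in>(UNIV::2 set). \<Sum>j\<in>(UNIV::2 set). c\<^sup>2)"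
    by (intro sum_mono power_mono assms) auto
  also have "\<dots> = (2 * c)\<^sup>2" by (simp add: power_mult_distrib)
  finally have "sqrt (\<Sum>i\<in>UNIV. \<Sum>j\<in>UNIV. (norm (M $ i $ j))\<^sup>2) \<le> 2 * c"
    using c by (intro real_le_lsqrt) (auto intro!: sum_nonneg)
  then show ?thesis by (simp add: norm_vec_def L2_set_def sum_nonneg)
qed

lemma norm_entry_le: "norm (M $ i $ j) \<le> norm (M :: 'k::real_normed_field^2^2)"
  using Finite_Cartesian_Product.norm_nth_le[of "M $ i" j] Finite_Cartesian_Product.norm_nth_le[of M i] by linarith

lemma norm_cos_sin_le_exp_Im:
  fixes z :: complex
  shows "norm (cos z) \<le> exp \<bar>Im z\<bar>" "norm (sin z) \<le> exp \<bar>Im z\<bar>"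
proof -
  have e: "norm (exp (\<i> * z)) \<le> exp \<bar>Im z\<bar>" "norm (exp (- (\<i> * z))) \<le> exp \<bar>Im z\<bar>" by simp_all
  have "norm (exp (\<i> * z) + exp (- (\<i> * z))) \<le> 2 * exp \<bar>Im z\<bar>"
    using norm_triangle_ineq[of "exp (\<i> * z)" "exp (- (\<i> * z))"] e by linarith
  then show "norm (cos z) \<le> exp \<bar>Im z\<bar>" by (simp add: cos_exp_eq norm_divide)
  have "norm (exp (\<i> * z) - exp (- (\<i> * z))) \<le> 2 * exp \<bar>Im z\<bar>"
    using norm_triangle_ineq4[of "exp (\<i> * z)" "exp (- (\<i> * z))"] e by linarith
  then show "norm (sin z) \<le> exp \<bar>Im z\<bar>" by (simp add: sin_exp_eq norm_divide norm_mult)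
qed

lemma norm_cRot_entry_le: "norm (cRot \<theta> $ i $ j) \<le> exp (2 * pi * \<bar>Im \<theta>\<bar>)"
proof -
  have "\<bar>Im (of_real (2 * pi) * \<theta>)\<bar> = 2 * pi * \<bar>Im \<theta>\<bar>" by (simp add: abs_mult)
  then show ?thesis
    using norm_cos_sin_le_exp_Im[of "of_real (2 * pi) * \<theta>"] exhaust_2[of i] exhaust_2[of j] by (auto simp: cRot_def)
qed

lemma holomorphic_cRot:
  assumes "f holomorphic_on U" shows "(\<lambda>z. cRot (f z) $ i $ j) holomorphic_on U"
  using exhaust_2[of i] exhaust_2[of j] by (auto simp: cRot_def intro!: holomorphic_intros assms)

context matrix_scale
begin

lemma cpx_zero: "cpx 0 = 0" and cpx_one: "cpx 1 = 1" and cpx_uminus: "cpx (- x) = - cpx x" and cpx_diff: "cpx (x - y) = cpx x - cpx y"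
proof -
  show 0: "cpx 0 = 0" using cpx_hom(3)[of 0] by simp
  show "cpx 1 = 1" using cpx_hom(3)[of 1] by simp
  show m: "cpx (- x) = - cpx x" for x using cpx_hom(1)[of x "- x"] 0 by (simp add: eq_neg_iff_add_eq_0 add.commute)
  show "cpx (x - y) = cpx x - cpx y" using cpx_hom(1)[of x "- y"] m by simp
qed

lemma cpx_matrix_mult:
  fixes x y :: "'k^2^2"
  assumes "\<And>i j. X $ i $ j = cpx (x $ i $ j)" "\<And>i j. Y $ i $ j = cpx (y $ i $ j)"
  shows "(X ** Y) $ i $ j = cpx ((x ** y) $ i $ j)"
  by (simp add: matrix_matrix_mult_def assms) (simp add: sum_2 cpx_hom)

lemma cpx_cmat: "cmat M $ i $ j = cpx (cmat M $ i $ j)"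
  by (simp add: cpx_hom)

lemma cpx_mat: "mat (cpx c) $ i $ j = cpx (mat c $ i $ j)"
  by (simp add: mat_def cpx_zero)

lemma cpx_near_prod_tangent:
  "tangent_prod \<alpha> A dA xs \<beta> m (cpx p) $ i $ j = cpx (tangent_prod \<alpha> A dA xs \<beta> m p $ i $ j)"
proof (induction m arbitrary: i j)
  case 0
  then show ?case using cpx_mat[of 1 i j] by (simp add: cpx_one)
next
  case (Suc m)
  have "mat (of_real \<beta> * cpx p) $ i $ j = cpx (mat (of_real \<beta> * p) $ i $ j)" for i j :: 2
    using cpx_mat[of "of_real \<beta> * p" i j] by (simp add: cpx_hom)
  then have "tangent_factor \<alpha> A dA xs \<beta> m (cpx p) $ i $ j = cpx (tangent_factor \<alpha> A dA xs \<beta> m p $ i $ j)" for i j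
    unfolding tangent_factor_def by (intro cpx_matrix_mult cpx_cmat)
  then have "(mat 1 + tangent_factor \<alpha> A dA xs \<beta> m (cpx p)) $ i $ j = cpx ((mat 1 + tangent_factor \<alpha> A dA xs \<beta> m p) $ i $ j)" for i j
    using cpx_mat[of 1 i j] by (simp add: cpx_hom cpx_one)
  then show ?case using Suc by (simp add: cpx_matrix_mult)
qed

text \<open>
  The exact product is replaced by the tangent product at the cost of a small error on the scale;
  the tangent product converges locally uniformly on the complex plane, and this is stronger than
  convergence on the scale.
\<close>

theorem renormalized_convergence:
  fixes F :: "nat \<Rightarrow> nat \<Rightarrow> 'k \<Rightarrow> 'k^2^2" and m :: "nat \<Rightarrow> nat" and \<beta> a b :: "nat \<Rightarrow> real" and B C :: "real^2^2"
  assumes SL2: "\<And>x. A x \<in> SL2"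
    and close: "\<And>\<epsilon>. 0 < \<epsilon> \<Longrightarrow> \<forall>\<^sub>F n in sequentially. sm \<epsilon> (\<lambda>p. exact_prod \<alpha> A xs (F n) (m n) p
      - tangent_prod \<alpha> A dA xs (\<beta> n) (m n) p)"
    and a: "bounded (range a)" and bdd: "\<And>n. norm (cocycle_pow \<alpha> A (m n) xs) \<le> D"
    and lim: "\<And>R i j. uniform_limit (cball 0 R) (\<lambda>n z. (cRot (- (of_real (a n) * z + of_real (b n))) **
      (cmat (B ** cocycle_pow \<alpha> A (m n) xs) ** tangent_prod \<alpha> A dA xs (\<beta> n) (m n) z ** cmat C)) $ i $ j)
      (\<lambda>_. mat 1 $ i $ j) sequentially"
    and \<epsilon>: "0 < \<epsilon>"
  shows "\<forall>\<^sub>F n in sequentially. sm \<epsilon> (\<lambda>p. rot (- (of_real (a n) * p + of_real (b n))) ** cmat B **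
    local_prod (F n) (m n) p ** cmat C - mat 1)"
proof -
  obtain K where K: "\<And>n. \<bar>a n\<bar> \<le> K" using a by (auto simp: bounded_iff)
  have hol\<theta>: "(\<lambda>z. - (of_real (a n) * z + of_real (b n))) holomorphic_on UNIV" for n by (intro holomorphic_intros)
  have cpx\<theta>: "- (of_real (a n) * cpx p + of_real (b n)) = cpx (- (of_real (a n) * p + of_real (b n)))" for n p
    by (simp only: cpx_hom cpx_uminus)
  \<comment> \<open>On the disc of radius \<open>Tr\<close> the rotations are bounded independently of \<open>n\<close>: the real
    constants \<open>b n\<close> do not contribute to the imaginary part of the angle.\<close>
  define \<rho> where "\<rho> = \<bar>Tr\<bar>"
  define c where "c = exp (2 * pi * (K * \<rho>))"
  have c0: "0 \<le> c" by (simp add: c_def)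
  have cR: "norm (cRot (- (of_real (a n) * z + of_real (b n))) $ i $ j) \<le> c" if "norm z \<le> Tr" for n z i j
  proof -
    have "\<bar>a n * Im z\<bar> \<le> K * \<rho>"
      unfolding abs_mult using K[of n] abs_Im_le_cmod[of z] that by (intro mult_mono) (auto simp: \<rho>_def)
    then have "exp (2 * pi * \<bar>Im (- (of_real (a n) * z + of_real (b n)))\<bar>) \<le> c"
      by (simp add: c_def)
    with norm_cRot_entry_le show ?thesis by (rule order_trans)
  qed
  have smR: "sm (Cr * c) (\<lambda>p. rot (- (of_real (a n) * p + of_real (b n))))" for n
    by (rule sm_restrict[where F = "\<lambda>z. cRot (- (of_real (a n) * z + of_real (b n)))"])
      (simp_all only: holomorphic_cRot[OF hol\<theta>] cpx\<theta> rot cR)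
  define \<gamma> where "\<gamma> = Cm * (Cr * c) * (Cm\<^sup>2 * (norm B * D) * norm C)"
  have D0: "0 \<le> D" using bdd order_trans[OF norm_ge_zero] by blast
  have \<gamma>0: "0 \<le> \<gamma>" using Cm Cr c0 D0 by (simp add: \<gamma>_def)
  define \<epsilon>1 where "\<epsilon>1 = \<epsilon> / (2 * (\<gamma> + 1))"
  have \<epsilon>1: "0 < \<epsilon>1" "\<gamma> * \<epsilon>1 \<le> \<epsilon> / 2"
  proof -
    show "0 < \<epsilon>1" using \<epsilon> \<gamma>0 by (simp add: \<epsilon>1_def)
    then have "\<gamma> * \<epsilon>1 \<le> (\<gamma> + 1) * \<epsilon>1" by simp
    also have "\<dots> = \<epsilon> / 2" using \<gamma>0 by (simp add: \<epsilon>1_def field_simps)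
    finally show "\<gamma> * \<epsilon>1 \<le> \<epsilon> / 2" .
  qed
  define \<epsilon>2 where "\<epsilon>2 = \<epsilon> / (2 * (Cr + 1))"
  have \<epsilon>2: "0 < \<epsilon>2" "Cr * \<epsilon>2 \<le> \<epsilon> / 2"
  proof -
    show "0 < \<epsilon>2" using \<epsilon> Cr by (simp add: \<epsilon>2_def)
    then have "Cr * \<epsilon>2 \<le> (Cr + 1) * \<epsilon>2" by simp
    also have "\<dots> = \<epsilon> / 2" using Cr by (simp add: \<epsilon>2_def field_simps)
    finally show "Cr * \<epsilon>2 \<le> \<epsilon> / 2" .
  qed
  let ?G = "\<lambda>n. tangent_prod \<alpha> A dA xs (\<beta> n) (m n)"
  let ?GC = "\<lambda>n z. tangent_prod \<alpha> A dA xs (\<beta> n) (m n) z :: complex^2^2"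
  let ?P = "\<lambda>n. B ** cocycle_pow \<alpha> A (m n) xs"
  let ?Q = "\<lambda>n z. cRot (- (of_real (a n) * z + of_real (b n))) ** (cmat (?P n) ** ?GC n z ** cmat C)"
  have ev: "\<forall>\<^sub>F n in sequentially. \<forall>z\<in>cball 0 Tr. dist (?Q n z $ i $ j) (mat 1 $ i $ j) < \<epsilon>2" for i j
    using lim[of i j Tr] \<epsilon>2(1) unfolding uniform_limit_iff by blast
  have "\<forall>\<^sub>F n in sequentially. \<forall>i\<in>UNIV. \<forall>j\<in>UNIV. \<forall>z\<in>cball 0 Tr. dist (?Q n z $ i $ j) (mat 1 $ i $ j) < \<epsilon>2"
    by (rule eventually_ball_finite, simp, rule ballI, rule eventually_ball_finite, simp, rule ballI, rule ev)
  with close[OF \<epsilon>1(1)] show ?thesis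
  proof eventually_elim
    case (elim n)
    let ?W = "exact_prod \<alpha> A xs (F n) (m n)"
    have 1: "sm (Cr * \<epsilon>2) (\<lambda>p. rot (- (of_real (a n) * p + of_real (b n))) ** (cmat (?P n) ** ?G n p ** cmat C) - mat 1)"
    proof (rule sm_restrict[where F = "\<lambda>z. ?Q n z - mat 1"])
      show "(\<lambda>z. (?Q n z - mat 1) $ i $ j) holomorphic_on UNIV" for i j
      proof -
        have "(\<lambda>z. ?Q n z $ i $ j) holomorphic_on UNIV"
          by (intro holomorphic_matrix_mult holomorphic_cRot[OF hol\<theta>] holomorphic_near_prod_tangent)
            (simp_all add: holomorphic_on_const)
        then show ?thesis by (simp only: vector_minus_component) (intro holomorphic_intros)
      qed
      show "(?Q n (cpx p) - mat 1) $ i $ j = cpx ((rot (- (of_real (a n) * p + of_real (b n))) ** (cmat (?P n) ** ?G n p ** cmat C) - mat 1) $ i $ j)" for p i j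
      proof -
        have "?Q n (cpx p) $ i $ j = cpx ((rot (- (of_real (a n) * p + of_real (b n))) ** (cmat (?P n) ** ?G n p ** cmat C)) $ i $ j)"
          unfolding cpx\<theta> by (intro cpx_matrix_mult cpx_cmat cpx_near_prod_tangent rot[symmetric])
        then show ?thesis using cpx_mat[of 1 i j] by (simp only: vector_minus_component cpx_diff cpx_one)
      qed
      show "norm ((?Q n z - mat 1) $ i $ j) \<le> \<epsilon>2" if "norm z \<le> Tr" for z i j
        using elim(2) that by (auto simp: dist_norm intro: less_imp_le)
    qed
    have 2: "sm (Cm * (Cr * c) * (Cm\<^sup>2 * norm (cmat (?P n) :: 'k^2^2) * \<epsilon>1 * norm (cmat C :: 'k^2^2)))
      (\<lambda>p. rot (- (of_real (a n) * p + of_real (b n))) ** (cmat (?P n) ** (?W p - ?G n p) ** cmat C))"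
      by (intro sm_mult sm_conjugate smR elim(1))
    have "sm (\<gamma> * \<epsilon>1) (\<lambda>p. rot (- (of_real (a n) * p + of_real (b n))) ** (cmat (?P n) ** (?W p - ?G n p) ** cmat C))"
    proof (rule sm_mono[OF 2])
      have "norm (?P n) \<le> norm B * D"
        by (rule order_trans[OF norm_matrix_mult_le]) (intro mult_left_mono bdd norm_ge_zero)
      then have "Cm * (Cr * c) * (Cm\<^sup>2 * norm (?P n) * \<epsilon>1 * norm C) \<le> Cm * (Cr * c) * (Cm\<^sup>2 * (norm B * D) * \<epsilon>1 * norm C)"
        using Cm Cr c0 \<epsilon>1 by (intro mult_left_mono mult_right_mono) auto
      then show "Cm * (Cr * c) * (Cm\<^sup>2 * norm (cmat (?P n) :: 'k^2^2) * \<epsilon>1 * norm (cmat C :: 'k^2^2)) \<le> \<gamma> * \<epsilon>1"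
        by (simp add: \<gamma>_def mult_ac)
    qed
    from sm_add[OF 1 this] have 3: "sm (Cr * \<epsilon>2 + \<gamma> * \<epsilon>1) (\<lambda>p. rot (- (of_real (a n) * p + of_real (b n))) ** (cmat (?P n) ** ?G n p ** cmat C) - mat 1
       + rot (- (of_real (a n) * p + of_real (b n))) ** (cmat (?P n) ** (?W p - ?G n p) ** cmat C))" .
    have lp: "local_prod (F n) (m n) p = cmat (cocycle_pow \<alpha> A (m n) xs) ** ?W p" for p
      by (rule local_prod_eq_near_prod[OF SL2])
    have eq: "rot (- (of_real (a n) * p + of_real (b n))) ** (cmat (?P n) ** ?G n p ** cmat C) - mat 1
       + rot (- (of_real (a n) * p + of_real (b n))) ** (cmat (?P n) ** (?W p - ?G n p) ** cmat C)
      = rot (- (of_real (a n) * p + of_real (b n))) ** cmat B ** local_prod (F n) (m n) p ** cmat C - mat 1" for p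
      unfolding lp matrix_mult.diff_left matrix_mult.diff_right cmat_mult
      by (simp add: matrix_mul_assoc)
    show ?case
      by (rule sm_mono[OF 3[unfolded eq]]) (use \<epsilon>1 \<epsilon>2 in linarith)
  qed
qed

end

section \<open>Recurrence to a density point\<close>

lemma norm_rotation_matrix_2: "rotation_matrix (M :: real^2^2) \<Longrightarrow> norm M = sqrt 2"
proof -
  assume M: "rotation_matrix M"
  note e = rotation_matrix_2_entries[OF M]
  have "(M $ 1 $ 1)\<^sup>2 + (M $ 1 $ 2)\<^sup>2 + ((M $ 2 $ 1)\<^sup>2 + (M $ 2 $ 2)\<^sup>2) = 2"
    using e by (simp add: power2_eq_square)
  then show ?thesis by (simp add: norm_vec_def L2_set_def sum_2 add_nonneg_nonneg)
qed

lemma rotation_matrix_mult: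
  "rotation_matrix (M :: real^2^2) \<Longrightarrow> rotation_matrix N \<Longrightarrow> rotation_matrix (M ** N)"
  by (simp add: rotation_matrix_def orthogonal_matrix_mul det_mul)

lemma rotation_matrix_cocycle_pow:
  assumes B: "\<And>x. B x \<in> SL2"
    and rot: "\<And>k. rotation_matrix (B (x + real k * \<alpha> + \<alpha>) ** A (x + real k * \<alpha>) ** matrix_inv (B (x + real k * \<alpha>)))"
  shows "rotation_matrix (B (x + real m * \<alpha>) ** cocycle_pow \<alpha> A m x ** matrix_inv (B x))"
proof (induction m)
  case 0
  then show ?case by (simp add: SL2_inverse[OF B] rotation_matrix_def orthogonal_matrix_id)
next
  case (Suc m)
  let ?y = "x + real m * \<alpha>"
  have "(B (?y + \<alpha>) ** A ?y ** matrix_inv (B ?y)) ** (B ?y ** cocycle_pow \<alpha> A m x ** matrix_inv (B x))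
     = B (?y + \<alpha>) ** A ?y ** (matrix_inv (B ?y) ** B ?y) ** cocycle_pow \<alpha> A m x ** matrix_inv (B x)"
    by (simp only: matrix_mul_assoc)
  also have "\<dots> = B (x + real (Suc m) * \<alpha>) ** cocycle_pow \<alpha> A (Suc m) x ** matrix_inv (B x)"
    by (simp add: SL2_inverse[OF B] matrix_mul_assoc algebra_simps)
  finally show ?case using rotation_matrix_mult[OF rot[of m] Suc] by simp
qed

text \<open>
  Close to \<open>x + \<beta> n * t\<close>, at the scale \<open>\<beta> n\<close>, most points are good, and so are most of their
  translates by \<open>c n\<close>, because the translation does not leave the scale.
\<close>

lemma nearby_good_points:
  fixes B :: "real \<Rightarrow> 'a::{metric_space, second_countable_topology}" and \<beta> :: "nat \<Rightarrow> real" and c :: "nat \<Rightarrow> real"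
  assumes meas: "B \<in> borel_measurable lebesgue"
    and dens: "\<forall>\<epsilon>>0. \<forall>\<eta>>0. \<exists>d>0. \<forall>r. 0 < r \<and> r < d \<longrightarrow>
      measure lebesgue (cball x r - {y. dist (B y) (B x) < \<epsilon>}) < \<eta> * r"
    and ae: "AE y in lebesgue. P y"
    and \<beta>: "\<beta> \<longlonglongrightarrow> 0" "\<And>n. \<beta> n \<noteq> 0" and c: "\<And>n. \<bar>c n\<bar> \<le> \<bar>\<beta> n\<bar>" and \<epsilon>: "0 < \<epsilon>"
  shows "\<forall>\<^sub>F n in sequentially. \<exists>s. \<bar>s - t\<bar> < \<epsilon> \<and> P (x + \<beta> n * s)
    \<and> dist (B (x + \<beta> n * s)) (B x) < \<epsilon> \<and> dist (B (x + \<beta> n * s + c n)) (B x) < \<epsilon>"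
proof -
  define G where "G = {y. dist (B y) (B x) < \<epsilon>}"
  have G: "G \<in> sets lebesgue"
    using measurable_sets[OF meas, of "ball (B x) \<epsilon>"] by (simp add: G_def vimage_def dist_commute)
  obtain N where N: "N \<in> null_sets lebesgue" "{y. \<not> P y} \<subseteq> N"
    using ae by (auto simp: eventually_ae_filter)
  define R where "R = \<bar>t\<bar> + \<epsilon> + 1"
  have R: "0 < R" using \<epsilon> by (simp add: R_def)
  \<comment> \<open>With this density the bad set and its translate by \<open>- c n\<close> together are shorter than the
    interval of length \<open>\<bar>\<beta> n\<bar> * \<epsilon>\<close> around \<open>x + \<beta> n * t\<close>.\<close>
  define \<eta> where "\<eta> = \<epsilon> / (2 * R)"
  have "0 < \<eta>" using \<epsilon> R by (simp add: \<eta>_def)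
  with dens[rule_format, OF \<epsilon> this] obtain d where d: "0 < d" "\<And>r. 0 < r \<Longrightarrow> r < d \<Longrightarrow> measure lebesgue (cball x r - G) < \<eta> * r"
    unfolding G_def by blast
  have "\<forall>\<^sub>F n in sequentially. \<bar>\<beta> n\<bar> < d / R"
    using tendstoD[OF \<beta>(1), of "d / R"] d(1) R by simp
  then show ?thesis
  proof eventually_elim
    case (elim n)
    define r where "r = \<bar>\<beta> n\<bar> * R"
    have r: "0 < r" "r < d" using elim \<beta>(2)[of n] R by (auto simp: r_def field_simps)
    define J where "J = cball (x + \<beta> n * t) (\<bar>\<beta> n\<bar> * (\<epsilon> / 2))"
    have Jm: "measure lebesgue J = \<bar>\<beta> n\<bar> * \<epsilon>"
      using \<epsilon> unfolding J_def cball_eq_atLeastAtMost by simp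
    have JR: "y \<in> cball x r" "y + c n \<in> cball x r" if "y \<in> J" for y
    proof -
      have "\<bar>x + \<beta> n * t - y\<bar> \<le> \<bar>\<beta> n\<bar> * (\<epsilon> / 2)" using that by (simp add: J_def dist_real_def)
      moreover have "\<bar>y - x\<bar> \<le> \<bar>x + \<beta> n * t - y\<bar> + \<bar>\<beta> n * t\<bar>" by linarith
      ultimately have "\<bar>y - x\<bar> \<le> \<bar>\<beta> n * t\<bar> + \<bar>\<beta> n\<bar> * (\<epsilon> / 2)" by linarith
      also have "\<dots> \<le> \<bar>\<beta> n\<bar> * (\<bar>t\<bar> + \<epsilon>)" using \<epsilon> by (simp add: abs_mult distrib_left)
      finally have 1: "\<bar>y - x\<bar> \<le> \<bar>\<beta> n\<bar> * (\<bar>t\<bar> + \<epsilon>)" .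
      have 2: "r = \<bar>\<beta> n\<bar> * (\<bar>t\<bar> + \<epsilon>) + \<bar>\<beta> n\<bar>" by (simp add: r_def R_def algebra_simps)
      show "y \<in> cball x r" "y + c n \<in> cball x r"
        unfolding mem_cball dist_real_def using 1 2 c[of n] by linarith+
    qed
    define Z where "Z = cball x r - G"
    have Z: "Z \<in> lmeasurable" unfolding Z_def using G by (intro fmeasurable_Diff) auto
    have Z': "(+) (- c n) ` Z \<in> lmeasurable" using Z by (rule measurable_translation)
    have "\<not> J \<subseteq> (Z \<union> (+) (- c n) ` Z) \<union> N"
    proof
      assume sub: "J \<subseteq> (Z \<union> (+) (- c n) ` Z) \<union> N"
      have Nm: "N \<in> lmeasurable" using N(1) by (auto simp: fmeasurable_def null_sets_def)
      have "measure lebesgue J \<le> measure lebesgue ((Z \<union> (+) (- c n) ` Z) \<union> N)"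
        using Z Z' Nm by (intro measure_mono_fmeasurable[OF sub]) (auto simp: J_def intro: fmeasurable.Un)
      also have "\<dots> \<le> measure lebesgue (Z \<union> (+) (- c n) ` Z) + measure lebesgue N"
        using Z Z' Nm by (intro measure_Un_le) auto
      also have "measure lebesgue (Z \<union> (+) (- c n) ` Z) \<le> measure lebesgue Z + measure lebesgue ((+) (- c n) ` Z)"
        using Z Z' by (intro measure_Un_le) auto
      also have "measure lebesgue ((+) (- c n) ` Z) = measure lebesgue Z" by (rule measure_translation)
      also have "measure lebesgue N = 0" using N(1) by (simp add: measure_eq_0_null_sets)
      finally have "\<bar>\<beta> n\<bar> * \<epsilon> \<le> 2 * measure lebesgue Z" using Jm by simp
      also have "\<dots> < 2 * (\<eta> * r)" using d(2)[OF r] by (simp add: Z_def)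
      also have "\<dots> = \<bar>\<beta> n\<bar> * \<epsilon>" using R by (simp add: \<eta>_def r_def)
      finally show False by simp
    qed
    then obtain y where y: "y \<in> J" "y \<notin> Z" "y \<notin> (+) (- c n) ` Z" "y \<notin> N" by blast
    have 1: "y \<in> G" using y JR(1)[OF y(1)] by (simp add: Z_def)
    have "y + c n \<notin> Z"
    proof
      assume "y + c n \<in> Z"
      then have "(+) (- c n) (y + c n) \<in> (+) (- c n) ` Z" by (rule imageI)
      then show False using y(3) by simp
    qed
    then have 2: "y + c n \<in> G" using JR(2)[OF y(1)] by (simp add: Z_def)
    have 3: "P y" using y(4) N(2) by blast
    define s where "s = (y - x) / \<beta> n"
    have ys: "y = x + \<beta> n * s" using \<beta>(2)[of n] by (simp add: s_def)
    have "\<bar>\<beta> n * (t - s)\<bar> \<le> \<bar>\<beta> n\<bar> * (\<epsilon> / 2)"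
      using y(1) unfolding J_def ys by (simp add: dist_real_def right_diff_distrib)
    then have "\<bar>\<beta> n\<bar> * \<bar>s - t\<bar> \<le> \<bar>\<beta> n\<bar> * (\<epsilon> / 2)"
      by (simp only: abs_mult abs_minus_commute[of t s])
    then have "\<bar>s - t\<bar> \<le> \<epsilon> / 2" using \<beta>(2)[of n] by simp
    then have "\<bar>s - t\<bar> < \<epsilon>" using \<epsilon> by simp
    with 1 2 3 show ?case unfolding ys G_def by blast
  qed
qed

context bounded_averages
begin

context
  fixes B :: "real \<Rightarrow> real^2^2" and m :: "nat \<Rightarrow> nat" and \<beta> :: "nat \<Rightarrow> real"
  assumes BSL2: "\<And>x. B x \<in> SL2" and m\<beta>: "\<And>n. real (m n) * \<bar>\<beta> n\<bar> \<le> 1"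
    and good: "\<And>t \<epsilon>. 0 < \<epsilon> \<Longrightarrow> \<forall>\<^sub>F n in sequentially. \<exists>s. \<bar>s - t\<bar> < \<epsilon> \<and>
      rotation_matrix (B (xs + \<beta> n * s + real (m n) * \<alpha>) ** cocycle_pow \<alpha> A (m n) (xs + \<beta> n * s) ** matrix_inv (B (xs + \<beta> n * s))) \<and>
      dist (B (xs + \<beta> n * s)) (B xs) < \<epsilon> \<and> dist (B (xs + \<beta> n * s + real (m n) * \<alpha>)) (B xs) < \<epsilon>"
    and close: "\<And>T \<epsilon>. 0 < \<epsilon> \<Longrightarrow> \<forall>\<^sub>F n in sequentially. \<forall>t. \<bar>t\<bar> \<le> T \<longrightarrow>
      norm (matrix_inv (cocycle_pow \<alpha> A (m n) xs) ** cocycle_pow \<alpha> A (m n) (xs + \<beta> n * t)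
        - tangent_prod \<alpha> A dA xs (\<beta> n) (m n) t) \<le> \<epsilon>"
begin

text \<open>
  At a good point nearby the iterate is bounded, since there it is conjugate to a rotation by
  bounded matrices; the comparison with the tangent product carries the bound over to \<open>xs\<close>.
\<close>

lemma renormalized_value_bounded:
  obtains D where "\<And>n. norm (cocycle_pow \<alpha> A (m n) xs) \<le> D"
proof -
  define b where "b = norm (B xs)"
  define L where "L = sqrt 2 * exp (sqrt 2 * M0 * M1 * S * 1)"
  have "\<forall>\<^sub>F n in sequentially. norm (cocycle_pow \<alpha> A (m n) xs) \<le> (b + 1) * sqrt 2 * (b + 1) * (L + 1)"
    using close[of 1 1, OF zero_less_one] good[of 1 0, OF zero_less_one]
  proof eventually_elim
    case (elim n)
    then obtain s where s: "\<bar>s\<bar> < 1" "dist (B (xs + \<beta> n * s)) (B xs) < 1" "dist (B (xs + \<beta> n * s + real (m n) * \<alpha>)) (B xs) < 1"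
      and rot: "rotation_matrix (B (xs + \<beta> n * s + real (m n) * \<alpha>) ** cocycle_pow \<alpha> A (m n) (xs + \<beta> n * s) ** matrix_inv (B (xs + \<beta> n * s)))"
      by auto
    let ?x = "xs + \<beta> n * s"
    let ?B1 = "B ?x" and ?B2 = "B (?x + real (m n) * \<alpha>)" and ?A = "cocycle_pow \<alpha> A (m n) ?x" and ?Az = "cocycle_pow \<alpha> A (m n) xs"
    let ?R = "?B2 ** ?A ** matrix_inv ?B1"
    have nB: "norm ?B1 \<le> b + 1" "norm ?B2 \<le> b + 1"
      using s(2,3) norm_triangle_ineq2[of ?B1 "B xs"] norm_triangle_ineq2[of ?B2 "B xs"] by (auto simp: b_def dist_norm)
    have "matrix_inv ?B2 ** ?R ** ?B1 = (matrix_inv ?B2 ** ?B2) ** ?A ** (matrix_inv ?B1 ** ?B1)"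
      by (simp only: matrix_mul_assoc)
    then have A_eq: "?A = matrix_inv ?B2 ** ?R ** ?B1" by (simp add: SL2_inverse[OF BSL2])
    have nA: "norm ?A \<le> (b + 1) * sqrt 2 * (b + 1)"
    proof -
      have "norm ?A \<le> norm (matrix_inv ?B2) * norm ?R * norm ?B1"
        by (subst A_eq) (rule order_trans[OF norm_matrix_mult_le mult_right_mono[OF norm_matrix_mult_le norm_ge_zero]])
      also have "\<dots> \<le> (b + 1) * sqrt 2 * (b + 1)"
        using nB by (intro mult_mono) (simp_all only: norm_SL2_inv[OF BSL2] norm_rotation_matrix_2[OF rot], simp_all add: b_def)
      finally show ?thesis .
    qed
    let ?W = "matrix_inv ?Az ** ?A"
    let ?G = "tangent_prod \<alpha> A dA xs (\<beta> n) (m n) s"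
    have "norm ?G \<le> sqrt 2 * exp (sqrt 2 * M0 * M1 * S * norm s)"
      by (rule norm_near_prod_tangent_le[OF m\<beta>])
    also have "\<dots> \<le> L"
    proof -
      have "sqrt 2 * M0 * M1 * S * norm s \<le> sqrt 2 * M0 * M1 * S * 1"
        using s(1) nonneg by (intro mult_left_mono) auto
      then show ?thesis by (simp add: L_def)
    qed
    finally have "norm ?W \<le> L + 1"
      using elim(1)[rule_format, of s] s(1) norm_triangle_ineq2[of ?W ?G] by linarith
    have WS: "?W \<in> SL2" by (intro SL2_mult SL2_matrix_inv pow_SL2)
    have "?Az ** ?W = ?A" by (simp add: matrix_mul_assoc SL2_inverse[OF pow_SL2])
    then have "?Az ** (?W ** matrix_inv ?W) = ?A ** matrix_inv ?W" by (simp add: matrix_mul_assoc)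
    then have "?Az = ?A ** matrix_inv ?W" by (simp only: SL2_inverse(1)[OF WS] matrix_mul_rid)
    then have "norm ?Az \<le> norm ?A * norm (matrix_inv ?W)" by (metis norm_matrix_mult_le)
    also have "\<dots> = norm ?A * norm ?W" by (simp only: norm_SL2_inv[OF WS])
    also have "\<dots> \<le> ((b + 1) * sqrt 2 * (b + 1)) * (L + 1)"
      using nA \<open>norm ?W \<le> L + 1\<close> by (intro mult_mono) (auto simp: b_def)
    finally show ?case .
  qed
  then have "Bfun (\<lambda>n. cocycle_pow \<alpha> A (m n) xs) sequentially" by (rule BfunI)
  then show ?thesis using that by (auto simp: Bseq_def)
qed

lemma renormalized_near_rotation:
  assumes \<epsilon>: "0 < \<epsilon>"
  shows "\<forall>\<^sub>F n in sequentially. \<exists>s. \<bar>s - t\<bar> < \<epsilon> \<and> (\<exists>M. rotation_matrix M \<and>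
    (\<forall>i j. norm ((cmat (B xs ** cocycle_pow \<alpha> A (m n) xs) ** tangent_prod \<alpha> A dA xs (\<beta> n) (m n) (of_real s)
      ** cmat (matrix_inv (B xs)) :: complex^2^2) $ i $ j - of_real (M $ i $ j)) < \<epsilon>))"
proof -
  obtain D where D: "\<And>n. norm (cocycle_pow \<alpha> A (m n) xs) \<le> D" using renormalized_value_bounded by blast
  have D0: "0 \<le> D" using order_trans[OF norm_ge_zero D] .
  define b where "b = norm (B xs)"
  have b0: "0 \<le> b" by (simp add: b_def)
  define \<delta> where "\<delta> = min 1 \<epsilon> / (12 * (b + 1))"
  have \<delta>: "0 < \<delta>" using \<epsilon> b0 by (simp add: \<delta>_def)
  have e1: "\<delta> * (b + 1) = min 1 \<epsilon> / 12" using b0 by (simp add: \<delta>_def field_simps)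
  define e where "e = \<delta> * (b + 1)"
  have e: "0 < e" "e \<le> 1 / 12" "12 * e \<le> \<epsilon>" using \<epsilon> by (auto simp: e_def e1)
  have \<delta>1: "\<delta> \<le> e" using \<delta> b0 by (simp add: e_def)
  define \<kappa> where "\<kappa> = \<epsilon> / (4 * (b * D * b + 1))"
  have bDb: "0 \<le> b * D * b" using b0 D0 by simp
  have \<kappa>: "0 < \<kappa>" using \<epsilon> bDb by (simp add: \<kappa>_def add_nonneg_pos)
  have "b * D * b * \<kappa> \<le> (b * D * b + 1) * \<kappa>" using \<kappa> by simp
  also have "\<dots> = \<epsilon> / 4" using bDb by (simp add: \<kappa>_def field_simps)
  finally have \<kappa>2: "b * D * b * \<kappa> \<le> \<epsilon> / 4" .
  show ?thesis using good[OF \<delta>, of t] close[OF \<kappa>, of "\<bar>t\<bar> + \<delta>"]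
  proof eventually_elim
    case (elim n)
    then obtain s where s: "\<bar>s - t\<bar> < \<delta>" "dist (B (xs + \<beta> n * s)) (B xs) < \<delta>" "dist (B (xs + \<beta> n * s + real (m n) * \<alpha>)) (B xs) < \<delta>"
      and rot: "rotation_matrix (B (xs + \<beta> n * s + real (m n) * \<alpha>) ** cocycle_pow \<alpha> A (m n) (xs + \<beta> n * s) ** matrix_inv (B (xs + \<beta> n * s)))"
      by auto
    let ?x = "xs + \<beta> n * s"
    let ?B0 = "B xs" and ?B1 = "B ?x" and ?B2 = "B (?x + real (m n) * \<alpha>)"
    let ?A = "cocycle_pow \<alpha> A (m n) ?x" and ?Az = "cocycle_pow \<alpha> A (m n) xs"
    let ?R = "?B2 ** ?A ** matrix_inv ?B1"
    let ?G = "tangent_prod \<alpha> A dA xs (\<beta> n) (m n) s"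
    let ?W = "matrix_inv ?Az ** ?A"
    \<comment> \<open>\<open>B xs\<close> differs from \<open>B\<close> at the two ends of the orbit piece by factors close to the identity.\<close>
    define X where "X = (?B0 - ?B2) ** matrix_inv ?B2"
    define Y where "Y = (?B1 - ?B0) ** matrix_inv ?B0"
    have nB2: "norm ?B2 \<le> b + 1"
      using s(3) \<delta>1 e norm_triangle_ineq2[of ?B2 "B xs"] by (auto simp: b_def dist_norm)
    have X: "norm X \<le> e"
    proof -
      have "norm X \<le> norm (?B0 - ?B2) * norm (matrix_inv ?B2)" unfolding X_def by (rule norm_matrix_mult_le)
      also have "\<dots> \<le> \<delta> * (b + 1)"
        using s(3) nB2 \<delta> by (intro mult_mono) (auto simp: norm_SL2_inv[OF BSL2] dist_norm norm_minus_commute)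
      finally show ?thesis by (simp add: e_def)
    qed
    have Y: "norm Y \<le> e"
    proof -
      have "norm Y \<le> norm (?B1 - ?B0) * norm (matrix_inv ?B0)" unfolding Y_def by (rule norm_matrix_mult_le)
      also have "\<dots> \<le> \<delta> * (b + 1)"
        using s(2) \<delta> by (intro mult_mono) (auto simp: norm_SL2_inv[OF BSL2] dist_norm b_def)
      finally show ?thesis by (simp add: e_def)
    qed
    have X1: "mat 1 + X = ?B0 ** matrix_inv ?B2" unfolding X_def by (simp add: matrix_mult.diff_left SL2_inverse[OF BSL2])
    have Y1: "mat 1 + Y = ?B1 ** matrix_inv ?B0" unfolding Y_def by (simp add: matrix_mult.diff_left SL2_inverse[OF BSL2])
    have "(mat 1 + X) ** ?R ** (mat 1 + Y) = ?B0 ** (matrix_inv ?B2 ** ?B2) ** ?A ** (matrix_inv ?B1 ** ?B1) ** matrix_inv ?B0"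
      unfolding X1 Y1 by (simp only: matrix_mul_assoc)
    then have "?B0 ** ?A ** matrix_inv ?B0 = (mat 1 + X) ** ?R ** (mat 1 + Y)" by (simp add: SL2_inverse[OF BSL2])
    also have "\<dots> = ?R + (X ** ?R + ?R ** Y + X ** ?R ** Y)"
      by (simp add: matrix_mult.add_left matrix_mult.add_right)
    finally have d1: "?B0 ** ?A ** matrix_inv ?B0 - ?R = X ** ?R + ?R ** Y + X ** ?R ** Y" by simp
    have nR: "norm ?R = sqrt 2" by (rule norm_rotation_matrix_2[OF rot])
    have XR: "norm (X ** ?R) \<le> e * sqrt 2"
      by (rule order_trans[OF norm_matrix_mult_le]) (use X nR in simp)
    have RY: "norm (?R ** Y) \<le> sqrt 2 * e"
      by (rule order_trans[OF norm_matrix_mult_le]) (use Y nR in simp)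
    have XRY: "norm (X ** ?R ** Y) \<le> (e * sqrt 2) * e"
      by (rule order_trans[OF norm_matrix_mult_le]) (intro mult_mono XR Y; use e in simp)
    have "norm (X ** ?R + ?R ** Y + X ** ?R ** Y) \<le> norm (X ** ?R) + norm (?R ** Y) + norm (X ** ?R ** Y)"
      by (intro order_trans[OF norm_triangle_ineq] add_mono norm_triangle_ineq order_refl)
    also have "\<dots> \<le> e * sqrt 2 + sqrt 2 * e + (e * sqrt 2) * e" by (intro add_mono XR RY XRY)
    also have "\<dots> \<le> 6 * e"
    proof -
      have s2: "sqrt 2 \<le> 2" using real_sqrt_le_iff[of 2 4] by simp
      have "e * sqrt 2 \<le> e * 2" using s2 e by (intro mult_left_mono) auto
      moreover have "(e * sqrt 2) * e \<le> (e * 2) * 1" using s2 e by (intro mult_mono) auto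
      ultimately show ?thesis by (simp add: mult.commute)
    qed
    finally have d1': "norm (?B0 ** ?A ** matrix_inv ?B0 - ?R) \<le> \<epsilon> / 2" unfolding d1 using e by linarith
    have "?B0 ** ?Az ** ?W ** matrix_inv ?B0 = ?B0 ** (?Az ** matrix_inv ?Az) ** ?A ** matrix_inv ?B0"
      by (simp only: matrix_mul_assoc)
    then have AW: "?B0 ** ?A ** matrix_inv ?B0 = ?B0 ** ?Az ** ?W ** matrix_inv ?B0" by (simp add: SL2_inverse[OF pow_SL2])
    have "?B0 ** ?Az ** ?G ** matrix_inv ?B0 - ?B0 ** ?A ** matrix_inv ?B0 = - (?B0 ** ?Az ** (?W - ?G) ** matrix_inv ?B0)"
      unfolding AW by (simp add: matrix_mult.diff_left matrix_mult.diff_right)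
    then have "norm (?B0 ** ?Az ** ?G ** matrix_inv ?B0 - ?B0 ** ?A ** matrix_inv ?B0) = norm (?B0 ** ?Az ** (?W - ?G) ** matrix_inv ?B0)"
      by simp
    also have "\<dots> \<le> norm ?B0 * norm ?Az * norm (?W - ?G) * norm (matrix_inv ?B0)"
      by (intro order_trans[OF norm_matrix_mult_le] mult_right_mono norm_ge_zero norm_matrix_mult_le)
    also have "\<dots> \<le> b * D * \<kappa> * b"
    proof -
      have "norm (?W - ?G) \<le> \<kappa>" using elim(2)[rule_format, of s] s(1) by simp
      then show ?thesis using D[of n] b0 D0 \<kappa> by (intro mult_mono) (auto simp: b_def norm_SL2_inv[OF BSL2])
    qed
    also have "\<dots> \<le> \<epsilon> / 4" using \<kappa>2 by (simp add: mult_ac)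
    finally have d2: "norm (?B0 ** ?Az ** ?G ** matrix_inv ?B0 - ?B0 ** ?A ** matrix_inv ?B0) \<le> \<epsilon> / 4" .
    have "norm (?B0 ** ?Az ** ?G ** matrix_inv ?B0 - ?R) \<le> \<epsilon> / 4 + \<epsilon> / 2"
      using norm_triangle_ineq[of "?B0 ** ?Az ** ?G ** matrix_inv ?B0 - ?B0 ** ?A ** matrix_inv ?B0" "?B0 ** ?A ** matrix_inv ?B0 - ?R"] d1' d2
      by simp
    then have tot: "norm (?B0 ** ?Az ** ?G ** matrix_inv ?B0 - ?R) < \<epsilon>" using \<epsilon> by simp
    show ?case
    proof (intro exI conjI allI)
      show "\<bar>s - t\<bar> < \<epsilon>" using s(1) \<delta>1 e by linarith
      show "rotation_matrix ?R" by (rule rot)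
      fix i j
      have "(cmat (?B0 ** ?Az) ** tangent_prod \<alpha> A dA xs (\<beta> n) (m n) (of_real s) ** cmat (matrix_inv ?B0) :: complex^2^2) $ i $ j - of_real (?R $ i $ j)
         = of_real ((?B0 ** ?Az ** ?G ** matrix_inv ?B0 - ?R) $ i $ j)"
        unfolding near_prod_tangent_of_real cmat_mult[symmetric] by simp
      then have "norm ((cmat (?B0 ** ?Az) ** tangent_prod \<alpha> A dA xs (\<beta> n) (m n) (of_real s) ** cmat (matrix_inv ?B0) :: complex^2^2) $ i $ j - of_real (?R $ i $ j))
         = norm ((?B0 ** ?Az ** ?G ** matrix_inv ?B0 - ?R) $ i $ j)" by (simp only: norm_of_real real_norm_def)
      also have "\<dots> < \<epsilon>" using norm_entry_le[of "?B0 ** ?Az ** ?G ** matrix_inv ?B0 - ?R" i j] tot by linarith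
      finally show "norm ((cmat (?B0 ** ?Az) ** tangent_prod \<alpha> A dA xs (\<beta> n) (m n) (of_real s) ** cmat (matrix_inv ?B0) :: complex^2^2) $ i $ j - of_real (?R $ i $ j)) < \<epsilon>" .
    qed
  qed
qed

text \<open>
  The tangent products, framed by the iterate and the conjugacy at \<open>xs\<close>, satisfy the hypotheses of
  the rigidity theorem.
\<close>

lemma phases_exist:
  obtains a b :: "nat \<Rightarrow> real" and D where "bounded (range a)" "\<And>n. norm (cocycle_pow \<alpha> A (m n) xs) \<le> D"
    "\<And>R i j. uniform_limit (cball 0 R) (\<lambda>n z. (cRot (- (of_real (a n) * z + of_real (b n))) **
      (cmat (B xs ** cocycle_pow \<alpha> A (m n) xs) ** tangent_prod \<alpha> A dA xs (\<beta> n) (m n) z ** cmat (matrix_inv (B xs)))) $ i $ j)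
      (\<lambda>_. mat 1 $ i $ j) sequentially"
proof -
  obtain D where D: "\<And>n. norm (cocycle_pow \<alpha> A (m n) xs) \<le> D"
    using renormalized_value_bounded by blast
  define Q where "Q n z = cmat (B xs ** cocycle_pow \<alpha> A (m n) xs) ** tangent_prod \<alpha> A dA xs (\<beta> n) (m n) z ** cmat (matrix_inv (B xs))"
    for n and z :: complex
  define C where "C = norm (B xs) * D * sqrt 2 * norm (B xs)"
  define K where "K = sqrt 2 * M0 * M1 * S"
  obtain a b :: "nat \<Rightarrow> real" where ab: "bounded (range a)"
    "\<And>R i j. uniform_limit (cball 0 R) (\<lambda>n z. (cRot (- (of_real (a n) * z + of_real (b n))) ** Q n z) $ i $ j) (\<lambda>_. mat 1 $ i $ j) sequentially"
  proof (rule asymptotic_rotations_affine_phase[of Q C K])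
    show "(\<lambda>z. Q n z $ i $ j) holomorphic_on UNIV" for n i j
      unfolding Q_def by (intro holomorphic_matrix_mult holomorphic_near_prod_tangent) (simp_all add: holomorphic_on_const)
    show "norm (Q n z $ i $ j) \<le> C * exp (K * norm z)" for n z i j
    proof -
      have "norm (Q n z $ i $ j) \<le> norm (Q n z)" by (rule norm_entry_le)
      also have "\<dots> \<le> norm (B xs) * norm (cocycle_pow \<alpha> A (m n) xs) * norm (tangent_prod \<alpha> A dA xs (\<beta> n) (m n) z) * norm (matrix_inv (B xs))"
      proof -
        have "norm (cmat (B xs ** cocycle_pow \<alpha> A (m n) xs) :: complex^2^2) \<le> norm (B xs) * norm (cocycle_pow \<alpha> A (m n) xs)"
          unfolding norm_cmat by (rule norm_matrix_mult_le)
        then show ?thesis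
          unfolding Q_def
          by (intro order_trans[OF norm_matrix_mult_le] mult_mono order_trans[OF norm_matrix_mult_le]) simp_all
      qed
      also have "\<dots> \<le> norm (B xs) * D * (sqrt 2 * exp (K * norm z)) * norm (B xs)"
      proof -
        have "0 \<le> D" using order_trans[OF norm_ge_zero D] .
        then show ?thesis
          using D[of n] norm_near_prod_tangent_le[OF m\<beta>, of n z]
          by (intro mult_mono) (auto simp: norm_SL2_inv[OF BSL2] K_def)
      qed
      finally show ?thesis by (simp add: C_def mult_ac)
    qed
    show "Q n (of_real t) $ i $ j \<in> \<real>" for n t i j
      unfolding Q_def near_prod_tangent_of_real cmat_mult[symmetric] by simp
    show "\<forall>\<^sub>F n in sequentially. \<exists>s. \<bar>s - t\<bar> < \<epsilon> \<and> (\<exists>M. rotation_matrix M \<and> (\<forall>i j. norm (Q n (of_real s) $ i $ j - of_real (M $ i $ j)) < \<epsilon>))"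
      if "0 < \<epsilon>" for t \<epsilon>
      unfolding Q_def by (rule renormalized_near_rotation[OF that])
  qed (rule that)
  show ?thesis using that[OF ab(1) D ab(2)[unfolded Q_def]] .
qed

end

end

section \<open>Finitely many derivatives\<close>

lemma nth_vderiv_0 [simp]: "nth_vderiv 0 f = f"
  by (simp add: nth_vderiv_def)

lemma nth_vderiv_Suc: "nth_vderiv (Suc j) f = nth_vderiv j (\<lambda>x. vector_derivative f (at x))"
  by (simp add: nth_vderiv_def funpow_Suc_right del: funpow.simps)

lemma times_cont_diff_0: "times_cont_diff (enat 0) f \<longleftrightarrow> continuous_on UNIV f"
  by (simp add: times_cont_diff_def)

lemma times_cont_diff_Suc:
  "times_cont_diff (enat (Suc k)) f \<longleftrightarrow>
    (\<forall>x. f differentiable (at x)) \<and> times_cont_diff (enat k) (\<lambda>x. vector_derivative f (at x))" (is "?L \<longleftrightarrow> ?R")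
proof
  assume L: ?L
  then have 1: "\<And>j x. j < Suc k \<Longrightarrow> nth_vderiv j f differentiable (at x)" "\<And>j. j \<le> Suc k \<Longrightarrow> continuous_on UNIV (nth_vderiv j f)"
    by (auto simp: times_cont_diff_def)
  have "f differentiable (at x)" for x using 1(1)[of 0 x] by simp
  moreover have "times_cont_diff (enat k) (\<lambda>x. vector_derivative f (at x))"
    using 1(1)[of "Suc _"] 1(2)[of "Suc _"] by (auto simp: times_cont_diff_def nth_vderiv_Suc)
  ultimately show ?R by blast
next
  assume R: ?R
  have c: "continuous_on UNIV f"
    using R differentiable_imp_continuous_within by (auto simp: continuous_on_eq_continuous_within)
  have "nth_vderiv j f differentiable (at x)" if "j < Suc k" for j x
    using R that by (cases j) (auto simp: times_cont_diff_def nth_vderiv_Suc)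
  moreover have "continuous_on UNIV (nth_vderiv j f)" if "j \<le> Suc k" for j
    using R c that by (cases j) (auto simp: times_cont_diff_def nth_vderiv_Suc)
  ultimately show ?L by (auto simp: times_cont_diff_def)
qed

lemma times_cont_diff_iff_finite: "times_cont_diff r f \<longleftrightarrow> (\<forall>k. enat k \<le> r \<longrightarrow> times_cont_diff (enat k) f)"
proof
  assume "\<forall>k. enat k \<le> r \<longrightarrow> times_cont_diff (enat k) f"
  moreover have "\<exists>k'. k < k' \<and> enat k' \<le> r" if "enat k < r" for k
    using that by (intro exI[of _ "Suc k"]) (auto simp: ileI1 eSuc_enat[symmetric] simp del: eSuc_enat)
  ultimately show "times_cont_diff r f" unfolding times_cont_diff_def by (metis enat_ord_simps(2) order_refl)
next
  assume "times_cont_diff r f"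
  then have 1: "\<And>j x. enat j < r \<Longrightarrow> nth_vderiv j f differentiable (at x)" "\<And>j. enat j \<le> r \<Longrightarrow> continuous_on UNIV (nth_vderiv j f)"
    by (auto simp: times_cont_diff_def)
  show "\<forall>k. enat k \<le> r \<longrightarrow> times_cont_diff (enat k) f"
    unfolding times_cont_diff_def using 1 less_le_trans order_trans by blast
qed

definition Ck_le :: "nat \<Rightarrow> real \<Rightarrow> real \<Rightarrow> (real \<Rightarrow> 'a::real_normed_vector) \<Rightarrow> bool" where
  "Ck_le k T c f \<longleftrightarrow> times_cont_diff (enat k) f \<and> (\<forall>j\<le>k. \<forall>t. \<bar>t\<bar> \<le> T \<longrightarrow> norm (nth_vderiv j f t) \<le> c)"

lemma Ck_le_0: "Ck_le 0 T c f \<longleftrightarrow> continuous_on UNIV f \<and> (\<forall>t. \<bar>t\<bar> \<le> T \<longrightarrow> norm (f t) \<le> c)"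
  by (simp add: Ck_le_def times_cont_diff_0)

lemma Ck_le_Suc:
  "Ck_le (Suc k) T c f \<longleftrightarrow> (\<exists>f'. (\<forall>x. (f has_vector_derivative f' x) (at x)) \<and>
    (\<forall>t. \<bar>t\<bar> \<le> T \<longrightarrow> norm (f t) \<le> c) \<and> Ck_le k T c f')" (is "?L \<longleftrightarrow> ?R")
proof
  assume L: ?L
  show ?R
  proof (intro exI[of _ "\<lambda>x. vector_derivative f (at x)"] conjI allI impI)
    show "(f has_vector_derivative vector_derivative f (at x)) (at x)" for x
      using L by (simp add: Ck_le_def times_cont_diff_Suc vector_derivative_works[symmetric])
    show "norm (f t) \<le> c" if "\<bar>t\<bar> \<le> T" for t
      using L that unfolding Ck_le_def by (metis le0 nth_vderiv_0)
    show "Ck_le k T c (\<lambda>x. vector_derivative f (at x))"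
      using L by (auto simp: Ck_le_def times_cont_diff_Suc nth_vderiv_Suc[symmetric])
  qed
next
  assume ?R
  then obtain f' where f': "\<And>x. (f has_vector_derivative f' x) (at x)" "\<And>t. \<bar>t\<bar> \<le> T \<Longrightarrow> norm (f t) \<le> c" "Ck_le k T c f'" by blast
  have eq: "(\<lambda>x. vector_derivative f (at x)) = f'" using f'(1) vector_derivative_at by fast
  have "times_cont_diff (enat (Suc k)) f"
    using f'(3) differentiableI_vector[OF f'(1)] by (simp add: times_cont_diff_Suc eq Ck_le_def)
  moreover have "norm (nth_vderiv j f t) \<le> c" if "j \<le> Suc k" "\<bar>t\<bar> \<le> T" for j t
    using f' that by (cases j) (auto simp: Ck_le_def nth_vderiv_Suc eq)
  ultimately show ?L by (simp add: Ck_le_def)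
qed

lemma Ck_leD: "Ck_le k T c f \<Longrightarrow> \<bar>t\<bar> \<le> T \<Longrightarrow> norm (f t) \<le> c"
  unfolding Ck_le_def by (metis le0 nth_vderiv_0)

lemma Ck_le_mono: "Ck_le k T c f \<Longrightarrow> c \<le> d \<Longrightarrow> Ck_le k T d f"
  unfolding Ck_le_def by (meson order_trans)

lemma Ck_le_nonneg: "Ck_le k T c f \<Longrightarrow> 0 \<le> T \<Longrightarrow> 0 \<le> c"
  using Ck_leD[of k T c f 0] norm_ge_zero[of "f 0"] by (simp del: norm_ge_zero)

lemma Ck_le_Suc_lower: "Ck_le (Suc k) T c f \<Longrightarrow> Ck_le k T c f"
  unfolding Ck_le_def times_cont_diff_def by (auto simp: order.strict_trans2 intro: less_imp_le)

lemma Ck_le_const: "norm M \<le> c \<Longrightarrow> Ck_le k T c (\<lambda>_. M)"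
proof (induction k arbitrary: M)
  case (Suc k)
  have "Ck_le k T c (\<lambda>_. 0 :: 'a)" using Suc.IH[of 0] order_trans[OF norm_ge_zero Suc.prems] by simp
  then show ?case unfolding Ck_le_Suc using Suc.prems by (auto intro!: exI[of _ "\<lambda>_. 0"])
qed (simp add: Ck_le_0)

lemma Ck_le_add: "Ck_le k T c f \<Longrightarrow> Ck_le k T d g \<Longrightarrow> Ck_le k T (c + d) (\<lambda>t. f t + g t)"
proof (induction k arbitrary: f g)
  case 0
  then show ?case by (auto simp: Ck_le_0 intro!: continuous_intros norm_triangle_mono)
next
  case (Suc k)
  obtain f' where f: "\<And>x. (f has_vector_derivative f' x) (at x)" "\<And>t. \<bar>t\<bar> \<le> T \<Longrightarrow> norm (f t) \<le> c" "Ck_le k T c f'"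
    using Suc.prems(1) unfolding Ck_le_Suc by blast
  obtain g' where g: "\<And>x. (g has_vector_derivative g' x) (at x)" "\<And>t. \<bar>t\<bar> \<le> T \<Longrightarrow> norm (g t) \<le> d" "Ck_le k T d g'"
    using Suc.prems(2) unfolding Ck_le_Suc by blast
  show ?case unfolding Ck_le_Suc
    using f g by (intro exI[of _ "\<lambda>t. f' t + g' t"]) (auto intro!: Suc.IH has_vector_derivative_add norm_triangle_mono)
qed

lemma Ck_le_linear:
  assumes h: "bounded_linear h" and K: "\<And>x. norm (h x) \<le> K * norm x" "0 \<le> K"
  shows "Ck_le k T c f \<Longrightarrow> Ck_le k T (K * c) (\<lambda>t. h (f t))"
proof (induction k arbitrary: f)
  case 0
  then show ?case using K
    by (auto simp: Ck_le_0 intro!: continuous_intros bounded_linear.continuous_on[OF h] order_trans[OF K(1)] mult_left_mono)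
next
  case (Suc k)
  obtain f' where f: "\<And>x. (f has_vector_derivative f' x) (at x)" "\<And>t. \<bar>t\<bar> \<le> T \<Longrightarrow> norm (f t) \<le> c" "Ck_le k T c f'"
    using Suc.prems unfolding Ck_le_Suc by blast
  show ?case unfolding Ck_le_Suc
    using f K by (intro exI[of _ "\<lambda>t. h (f' t)"])
      (auto intro!: Suc.IH bounded_linear.has_vector_derivative[OF h] order_trans[OF K(1)] mult_left_mono)
qed

lemma Ck_le_bilinear:
  assumes h: "bounded_bilinear h" and K: "\<And>x y. norm (h x y) \<le> norm x * norm y" and T: "0 \<le> T"
  shows "Ck_le k T c f \<Longrightarrow> Ck_le k T d g \<Longrightarrow> Ck_le k T (2 ^ k * c * d) (\<lambda>t. h (f t) (g t))"
proof (induction k arbitrary: f g)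
  case 0
  then show ?case
    by (auto simp: Ck_le_0 intro!: continuous_intros bounded_bilinear.continuous_on[OF h] order_trans[OF K] mult_mono
        intro: order_trans[OF norm_ge_zero])
next
  case (Suc k)
  obtain f' where f: "\<And>x. (f has_vector_derivative f' x) (at x)" "\<And>t. \<bar>t\<bar> \<le> T \<Longrightarrow> norm (f t) \<le> c" "Ck_le k T c f'"
    using Suc.prems(1) unfolding Ck_le_Suc by blast
  obtain g' where g: "\<And>x. (g has_vector_derivative g' x) (at x)" "\<And>t. \<bar>t\<bar> \<le> T \<Longrightarrow> norm (g t) \<le> d" "Ck_le k T d g'"
    using Suc.prems(2) unfolding Ck_le_Suc by blast
  have c0: "0 \<le> c" and d0: "0 \<le> d" using Ck_le_nonneg[OF _ T] f(3) g(3) by blast+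
  have d1: "Ck_le k T (2 ^ k * c * d + 2 ^ k * c * d) (\<lambda>t. h (f t) (g' t) + h (f' t) (g t))"
    using Suc.prems[THEN Ck_le_Suc_lower] f g by (intro Ck_le_add Suc.IH)
  have d2: "((\<lambda>t. h (f t) (g t)) has_vector_derivative h (f x) (g' x) + h (f' x) (g x)) (at x)" for x
    by (rule bounded_bilinear.has_vector_derivative[OF h f(1) g(1)])
  have d3: "norm (h (f t) (g t)) \<le> 2 ^ Suc k * c * d" if "\<bar>t\<bar> \<le> T" for t
  proof -
    have "norm (h (f t) (g t)) \<le> 1 * (c * d)"
      using f(2)[OF that] g(2)[OF that] c0 by (auto intro!: order_trans[OF K] mult_mono)
    also have "\<dots> \<le> 2 ^ Suc k * (c * d)" using c0 d0 by (intro mult_right_mono one_le_power) auto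
    finally show ?thesis by (simp add: mult_ac)
  qed
  have eq: "2 ^ k * c * d + 2 ^ k * c * d = 2 ^ Suc k * c * d" by simp
  show ?case unfolding Ck_le_Suc
  proof (intro exI[of _ "\<lambda>t. h (f t) (g' t) + h (f' t) (g t)"] conjI allI impI)
    show "Ck_le k T (2 ^ Suc k * c * d) (\<lambda>t. h (f t) (g' t) + h (f' t) (g t))" using d1 unfolding eq .
  qed (fact d2 d3)+
qed

lemmas Ck_le_matrix_mult = Ck_le_bilinear[OF bounded_bilinear_matrix_mult norm_matrix_mult_le]

lemma has_vector_derivative_matrix:
  fixes f :: "real \<Rightarrow> real^'n^'m"
  assumes "\<And>i j. ((\<lambda>t. f t $ i $ j) has_vector_derivative f' $ i $ j) (at t)"
  shows "(f has_vector_derivative f') (at t)"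
  unfolding has_vector_derivative_def has_derivative_componentwise_within[of f]
proof
  fix b :: "real^'n^'m" assume "b \<in> Basis"
  then obtain i j where b: "b = axis i (axis j 1)" by (auto simp: Basis_vec_def)
  show "((\<lambda>x. f x \<bullet> b) has_derivative (\<lambda>x. (x *\<^sub>R f') \<bullet> b)) (at t)"
    using assms[of i j] by (simp add: b inner_axis has_vector_derivative_def)
qed

text \<open>
  Cauchy's inequality on discs of radius 1: every derivative costs one unit of the radius.
\<close>

lemma Ck_le_restrict_entire:
  fixes F :: "complex \<Rightarrow> complex^2^2" and f :: "real \<Rightarrow> real^2^2"
  assumes T: "0 \<le> T"
  shows "(\<And>i j. (\<lambda>z. F z $ i $ j) holomorphic_on UNIV) \<Longrightarrow>
    (\<And>t i j. F (of_real t) $ i $ j = of_real (f t $ i $ j)) \<Longrightarrow>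
    (\<And>z i j. norm z \<le> T + real k \<Longrightarrow> norm (F z $ i $ j) \<le> c) \<Longrightarrow> Ck_le k T (2 * c) f"
proof (induction k arbitrary: F f)
  case (Suc k)
  define F' where "F' z = (\<chi> i j. deriv (\<lambda>z. F z $ i $ j) z)" for z
  define f' where "f' t = (\<chi> i j. Re (deriv (\<lambda>z. F z $ i $ j) (of_real t)))" for t
  have d: "((\<lambda>t. F (of_real t) $ i $ j) has_vector_derivative deriv (\<lambda>z. F z $ i $ j) (of_real t)) (at t)" for t i j
    using has_vector_derivative_real_field[OF holomorphic_derivI[OF Suc.prems(1) open_UNIV UNIV_I]] by simp
  have dR: "((\<lambda>t. f t $ i $ j) has_vector_derivative Re (deriv (\<lambda>z. F z $ i $ j) (of_real t))) (at t)" for t i j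
    using bounded_linear.has_vector_derivative[OF bounded_linear_Re d] by (simp add: Suc.prems(2))
  have "((\<lambda>t. 0) has_vector_derivative Im (deriv (\<lambda>z. F z $ i $ j) (of_real t))) (at t)" for t i j
    using bounded_linear.has_vector_derivative[OF bounded_linear_Im d] by (simp add: Suc.prems(2))
  then have "Im (deriv (\<lambda>z. F z $ i $ j) (of_real t)) = 0" for t i j
    using has_vector_derivative_const vector_derivative_unique_at by blast
  then have real: "F' (of_real t) $ i $ j = of_real (f' t $ i $ j)" for t i j
    by (simp add: F'_def f'_def complex_eq_iff)
  have "Ck_le k T (2 * c) f'"
  proof (rule Suc.IH[where F = F' and f = f'])
    show "F' (of_real t) $ i $ j = of_real (f' t $ i $ j)" for t i j by (rule real)
    show "(\<lambda>z. F' z $ i $ j) holomorphic_on UNIV" for i j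
      unfolding F'_def by (simp add: holomorphic_deriv[OF Suc.prems(1)])
    show "norm (F' z $ i $ j) \<le> c" if "norm z \<le> T + real k" for z i j
    proof -
      have "norm (deriv (\<lambda>z. F z $ i $ j) z) \<le> c"
      proof (rule entire_deriv_bound[OF Suc.prems(1)])
        fix w assume "norm (w - z) \<le> 1"
        then have "norm w \<le> T + real (Suc k)" using that norm_triangle_ineq[of "w - z" z] by simp
        then show "norm (F w $ i $ j) \<le> c" by (rule Suc.prems(3))
      qed
      then show ?thesis by (simp add: F'_def)
    qed
  qed
  moreover have "(f has_vector_derivative f' t) (at t)" for t
    by (rule has_vector_derivative_matrix) (simp add: f'_def dR)
  moreover have "norm (f t) \<le> 2 * c" if "\<bar>t\<bar> \<le> T" for t
  proof (rule norm_matrix2_le)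
    fix i j
    have "norm (F (of_real t) $ i $ j) \<le> c" using that by (intro Suc.prems(3)) simp
    then show "norm (f t $ i $ j) \<le> c" by (simp add: Suc.prems(2))
  qed
  ultimately show ?case unfolding Ck_le_Suc by blast
next
  case 0
  have "norm (f t) \<le> 2 * c" if "\<bar>t\<bar> \<le> T" for t
  proof (rule norm_matrix2_le)
    fix i j
    have "norm (F (of_real t) $ i $ j) \<le> c" using that by (intro 0(3)) simp
    then show "norm (f t $ i $ j) \<le> c" by (simp add: 0(2))
  qed
  moreover have "continuous_on UNIV f"
  proof -
    have "continuous_on UNIV (\<lambda>t. Re (F (of_real t) $ i $ j))" for i j
      by (intro continuous_intros continuous_on_compose2[OF holomorphic_on_imp_continuous_on[OF 0(1)]]) auto
    then have "continuous_on UNIV (\<lambda>t. \<chi> i j. f t $ i $ j)"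
      by (intro continuous_on_vec_lambda) (simp add: 0(2))
    then show ?thesis by simp
  qed
  ultimately show ?case by (simp add: Ck_le_0)
qed


lemma on_circle_shift_unit:
  fixes x :: real
  assumes "on_circle f" obtains j :: int where "0 \<le> x - of_int j" "x - of_int j < 1" "\<And>y. f (y - of_int j) = f y"
proof -
  have "f (y - of_int \<lfloor>x\<rfloor>) = f y" for y using periodic_int[OF assms, of y "- \<lfloor>x\<rfloor>"] by simp
  then show ?thesis
    by (intro that[of "\<lfloor>x\<rfloor>"]) linarith+
qed

lemma on_circle_bounded:
  fixes f :: "real \<Rightarrow> 'a::real_normed_vector"
  assumes "on_circle f" "continuous_on UNIV f"
  obtains M where "\<And>x. norm (f x) \<le> M"
proof -
  have "continuous_on {0..1} f" using assms(2) by (rule continuous_on_subset) simp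
  then have "bounded (f ` {0..1})" by (intro compact_imp_bounded compact_continuous_image) auto
  then obtain M where M: "\<forall>x\<in>{0..1}. norm (f x) \<le> M" by (auto simp: bounded_iff)
  have "norm (f x) \<le> M" for x
  proof -
    obtain j :: int where "0 \<le> x - of_int j" "x - of_int j < 1" "\<And>y. f (y - of_int j) = f y"
      using on_circle_shift_unit[OF assms(1)] by blast
    then show ?thesis using M[rule_format, of "x - of_int j"] by simp
  qed
  then show ?thesis using that by blast
qed

lemma on_circle_uniformly_continuous:
  fixes f :: "real \<Rightarrow> 'a::real_normed_vector"
  assumes "on_circle f" "continuous_on UNIV f" "0 < \<epsilon>"
  obtains \<delta> where "0 < \<delta>" "\<And>x h. \<bar>h\<bar> < \<delta> \<Longrightarrow> norm (f (x + h) - f x) < \<epsilon>"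
proof -
  have "continuous_on {-1..2} f" using assms(2) by (rule continuous_on_subset) simp
  then have "uniformly_continuous_on {-1..2} f" by (intro compact_uniformly_continuous) auto
  then obtain d where d: "0 < d" "\<And>x y. x \<in> {-1..2} \<Longrightarrow> y \<in> {-1..2} \<Longrightarrow> dist y x < d \<Longrightarrow> dist (f y) (f x) < \<epsilon>"
    using assms(3) unfolding uniformly_continuous_on_def by meson
  have "norm (f (x + h) - f x) < \<epsilon>" if h: "\<bar>h\<bar> < min d 1" for x h
  proof -
    obtain j :: int where j: "0 \<le> x - of_int j" "x - of_int j < 1" "\<And>y. f (y - of_int j) = f y"
      using on_circle_shift_unit[OF assms(1)] by blast
    have "dist (f (x + h - of_int j)) (f (x - of_int j)) < \<epsilon>"
      using j(1,2) h by (intro d(2)) (auto simp: dist_real_def)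
    then show ?thesis by (simp only: j(3) dist_norm)
  qed
  then show ?thesis using that[of "min d 1"] d(1) by simp
qed

lemma on_circle_vector_derivative:
  assumes "on_circle f" "\<And>x. f differentiable (at x)"
  shows "on_circle (\<lambda>x. vector_derivative f (at x))"
  unfolding on_circle_def
proof
  fix x :: real
  have 1: "(f has_vector_derivative vector_derivative f (at (x + 1))) (at (x + 1))"
    using assms(2) vector_derivative_works by blast
  have "((f \<circ> (\<lambda>y. y + 1)) has_vector_derivative 1 *\<^sub>R vector_derivative f (at (x + 1))) (at x)"
    using 1 by (intro vector_diff_chain_at) (auto intro!: derivative_eq_intros)
  moreover have "f \<circ> (\<lambda>y. y + 1) = f" using assms(1) by (auto simp: on_circle_def)
  ultimately show "vector_derivative f (at (x + 1)) = vector_derivative f (at x)"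
    by (metis scaleR_one vector_derivative_at)
qed

lemma has_vector_derivative_affine:
  assumes "\<And>x. (f has_vector_derivative f' x) (at x)"
  shows "((\<lambda>p. f (y + \<beta> * p)) has_vector_derivative \<beta> *\<^sub>R f' (y + \<beta> * p)) (at p)"
proof -
  have "((f \<circ> (\<lambda>p. y + \<beta> * p)) has_vector_derivative \<beta> *\<^sub>R f' (y + \<beta> * p)) (at p)"
    using assms by (intro vector_diff_chain_at) (auto intro!: derivative_eq_intros)
  then show ?thesis by (simp add: comp_def)
qed

text \<open>
  Periodicity makes all bounds uniform in the base point \<open>y\<close>.
\<close>

lemma Ck_le_affine_uniform:
  assumes "times_cont_diff (enat k) f" "on_circle f" "0 \<le> L"
  shows "\<exists>M. \<forall>\<beta> y. \<bar>\<beta>\<bar> \<le> L \<longrightarrow> Ck_le k T M (\<lambda>p. f (y + \<beta> * p))"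
  using assms
proof (induction k arbitrary: f)
  case 0
  obtain M where "\<And>x. norm (f x) \<le> M" using on_circle_bounded 0 by (metis times_cont_diff_0)
  then show ?case using 0(1)
    by (intro exI[of _ M]) (auto simp: Ck_le_0 times_cont_diff_0 intro!: continuous_on_compose2[of UNIV f] continuous_intros)
next
  case (Suc k)
  let ?f' = "\<lambda>x. vector_derivative f (at x)"
  have f: "\<And>x. f differentiable (at x)" "times_cont_diff (enat k) ?f'" using Suc.prems by (auto simp: times_cont_diff_Suc)
  obtain M where M: "\<And>\<beta> y. \<bar>\<beta>\<bar> \<le> L \<Longrightarrow> Ck_le k T M (\<lambda>p. ?f' (y + \<beta> * p))"
    using Suc.IH[OF f(2) on_circle_vector_derivative[OF Suc.prems(2) f(1)] Suc.prems(3)] by blast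
  have "continuous_on UNIV f"
    using f(1) by (intro differentiable_imp_continuous_on) (auto simp: differentiable_on_def)
  then obtain M' where M': "\<And>x. norm (f x) \<le> M'" using on_circle_bounded Suc.prems(2) by blast
  define N where "N = max M' (L * M)"
  have "Ck_le (Suc k) T N (\<lambda>p. f (y + \<beta> * p))" if \<beta>: "\<bar>\<beta>\<bar> \<le> L" for \<beta> y
    unfolding Ck_le_Suc
  proof (intro exI[of _ "\<lambda>p. \<beta> *\<^sub>R ?f' (y + \<beta> * p)"] conjI allI impI)
    show "((\<lambda>p. f (y + \<beta> * p)) has_vector_derivative \<beta> *\<^sub>R ?f' (y + \<beta> * p)) (at p)" for p
      using f(1) vector_derivative_works by (intro has_vector_derivative_affine) blast
    show "norm (f (y + \<beta> * p)) \<le> N" for p using M'[of "y + \<beta> * p"] by (simp add: N_def)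
    have "Ck_le k T (L * M) (\<lambda>p. \<beta> *\<^sub>R ?f' (y + \<beta> * p))"
      using \<beta> Suc.prems(3) by (intro Ck_le_linear M bounded_linear_scaleR_right) (auto intro: mult_right_mono)
    then show "Ck_le k T N (\<lambda>p. \<beta> *\<^sub>R ?f' (y + \<beta> * p))" by (rule Ck_le_mono) (simp add: N_def)
  qed
  then show ?case by blast
qed

lemma Ck_le_affine_increment:
  assumes f: "times_cont_diff (enat k) f" "on_circle f" and T: "0 \<le> T" and \<epsilon>: "0 < \<epsilon>"
  shows "\<exists>\<delta>>0. \<forall>\<beta> y. \<bar>\<beta>\<bar> < \<delta> \<longrightarrow> Ck_le k T \<epsilon> (\<lambda>p. f (y + \<beta> * p) - f y)"
proof -
  have c: "continuous_on UNIV f" using f(1) unfolding times_cont_diff_def by (metis enat_0_iff(1) nth_vderiv_0 zero_le)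
  obtain d where d: "0 < d" "\<And>x h. \<bar>h\<bar> < d \<Longrightarrow> norm (f (x + h) - f x) < \<epsilon>"
    using on_circle_uniformly_continuous[OF f(2) c \<epsilon>] by blast
  have small: "norm (f (y + \<beta> * p) - f y) \<le> \<epsilon>" if "\<bar>\<beta>\<bar> < d / (T + 1)" "\<bar>p\<bar> \<le> T" for \<beta> y p
  proof -
    have "\<bar>\<beta> * p\<bar> \<le> \<bar>\<beta>\<bar> * (T + 1)" using that(2) unfolding abs_mult by (intro mult_left_mono) auto
    also have "\<dots> < d" using that(1) T by (simp add: field_simps)
    finally show ?thesis using d(2)[of "\<beta> * p" y] by simp
  qed
  show ?thesis
  proof (cases k)
    case 0
    show ?thesis
    proof (intro exI[of _ "d / (T + 1)"] conjI allI impI)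
      show "Ck_le k T \<epsilon> (\<lambda>p. f (y + \<beta> * p) - f y)" if "\<bar>\<beta>\<bar> < d / (T + 1)" for \<beta> y
        using small[OF that] by (auto simp: 0 Ck_le_0 intro!: continuous_intros continuous_on_compose2[OF c])
    qed (use d T in auto)
  next
    case (Suc j)
    let ?f' = "\<lambda>x. vector_derivative f (at x)"
    have f': "\<And>x. f differentiable (at x)" "times_cont_diff (enat j) ?f'" using f(1) by (auto simp: times_cont_diff_Suc Suc)
    obtain M where M: "\<And>\<beta> y. \<bar>\<beta>\<bar> \<le> 1 \<Longrightarrow> Ck_le j T M (\<lambda>p. ?f' (y + \<beta> * p))"
      using Ck_le_affine_uniform[OF f'(2) on_circle_vector_derivative[OF f(2) f'(1)], where L = 1 and T = T] by auto
    have M0: "0 \<le> M" using Ck_le_nonneg[OF M T, of 0] by simp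
    define \<delta> where "\<delta> = min 1 (min (\<epsilon> / (M + 1)) (d / (T + 1)))"
    show ?thesis
    proof (intro exI[of _ \<delta>] conjI allI impI)
      show "0 < \<delta>" using \<epsilon> d T M0 by (simp add: \<delta>_def)
      fix \<beta> y assume \<beta>: "\<bar>\<beta>\<bar> < \<delta>"
      then have \<beta>': "\<bar>\<beta>\<bar> \<le> 1" "\<bar>\<beta>\<bar> < d / (T + 1)" "\<bar>\<beta>\<bar> * (M + 1) \<le> \<epsilon>"
        using M0 by (auto simp: \<delta>_def field_simps)
      show "Ck_le k T \<epsilon> (\<lambda>p. f (y + \<beta> * p) - f y)"
        unfolding Suc Ck_le_Suc
      proof (intro exI[of _ "\<lambda>p. \<beta> *\<^sub>R ?f' (y + \<beta> * p)"] conjI allI impI)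
        have "((\<lambda>p. f (y + \<beta> * p)) has_vector_derivative \<beta> *\<^sub>R ?f' (y + \<beta> * p)) (at p)" for p
          using f'(1) vector_derivative_works by (intro has_vector_derivative_affine) blast
        from has_vector_derivative_diff[OF this has_vector_derivative_const]
        show "((\<lambda>p. f (y + \<beta> * p) - f y) has_vector_derivative \<beta> *\<^sub>R ?f' (y + \<beta> * p)) (at p)" for p by simp
        show "norm (f (y + \<beta> * p) - f y) \<le> \<epsilon>" if "\<bar>p\<bar> \<le> T" for p by (rule small[OF \<beta>'(2) that])
        have "Ck_le j T (\<bar>\<beta>\<bar> * M) (\<lambda>p. \<beta> *\<^sub>R ?f' (y + \<beta> * p))"
          by (intro Ck_le_linear M \<beta>'(1) bounded_linear_scaleR_right) auto
        moreover have "\<bar>\<beta>\<bar> * M \<le> \<epsilon>" using \<beta>'(3) by (simp add: distrib_left)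
        ultimately show "Ck_le j T \<epsilon> (\<lambda>p. \<beta> *\<^sub>R ?f' (y + \<beta> * p))" by (rule Ck_le_mono)
      qed
    qed
  qed
qed

text \<open>
  Values and first derivatives are controlled by the modulus of continuity of the derivative; each
  further derivative brings another factor \<open>\<beta>\<close>.
\<close>

theorem Ck_le_tangent_approximation:
  assumes f: "times_cont_diff (enat (Suc k)) f" "on_circle f" and T: "0 \<le> T" and \<epsilon>: "0 < \<epsilon>"
  shows "\<exists>\<delta>>0. \<forall>\<beta> y. \<bar>\<beta>\<bar> < \<delta> \<longrightarrow>
    Ck_le (Suc k) T (\<bar>\<beta>\<bar> * \<epsilon>) (\<lambda>p. f (y + \<beta> * p) - f y - (\<beta> * p) *\<^sub>R vector_derivative f (at y))"
proof -
  let ?f' = "\<lambda>x. vector_derivative f (at x)"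
  have f': "\<And>x. f differentiable (at x)" "times_cont_diff (enat k) ?f'" using f(1) by (auto simp: times_cont_diff_Suc)
  define \<epsilon>' where "\<epsilon>' = \<epsilon> / (T + 1)"
  have \<epsilon>': "0 < \<epsilon>'" "\<epsilon>' \<le> \<epsilon>" "\<epsilon>' * T \<le> \<epsilon>"
    using \<epsilon> T by (auto simp: \<epsilon>'_def divide_le_eq mult_le_cancel_left1 intro: mult_left_mono)
  obtain \<delta> where \<delta>: "0 < \<delta>" "\<And>\<beta> y. \<bar>\<beta>\<bar> < \<delta> \<Longrightarrow> Ck_le k T \<epsilon>' (\<lambda>p. ?f' (y + \<beta> * p) - ?f' y)"
    using Ck_le_affine_increment[OF f'(2) on_circle_vector_derivative[OF f(2) f'(1)] T \<epsilon>'(1)] by blast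
  show ?thesis
  proof (intro exI[of _ \<delta>] conjI allI impI)
    fix \<beta> y assume \<beta>: "\<bar>\<beta>\<bar> < \<delta>"
    let ?E = "\<lambda>p. f (y + \<beta> * p) - f y - (\<beta> * p) *\<^sub>R ?f' y"
    have dE: "(?E has_vector_derivative \<beta> *\<^sub>R (?f' (y + \<beta> * p) - ?f' y)) (at p)" for p
    proof -
      have 1: "((\<lambda>p. f (y + \<beta> * p)) has_vector_derivative \<beta> *\<^sub>R ?f' (y + \<beta> * p)) (at p)"
        using f'(1) vector_derivative_works by (intro has_vector_derivative_affine) blast
      have 2: "((\<lambda>p. (\<beta> * p) *\<^sub>R ?f' y) has_vector_derivative \<beta> *\<^sub>R ?f' y) (at p)"
        by (auto intro!: derivative_eq_intros simp: has_vector_derivative_def)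
      show ?thesis
        using has_vector_derivative_diff[OF has_vector_derivative_diff[OF 1 has_vector_derivative_const] 2]
        by (simp add: scaleR_diff_right)
    qed
    show "Ck_le (Suc k) T (\<bar>\<beta>\<bar> * \<epsilon>) ?E"
      unfolding Ck_le_Suc
    proof (intro exI[of _ "\<lambda>p. \<beta> *\<^sub>R (?f' (y + \<beta> * p) - ?f' y)"] conjI allI impI)
      show "(?E has_vector_derivative \<beta> *\<^sub>R (?f' (y + \<beta> * p) - ?f' y)) (at p)" for p by (rule dE)
      have C: "Ck_le k T (\<bar>\<beta>\<bar> * \<epsilon>') (\<lambda>p. \<beta> *\<^sub>R (?f' (y + \<beta> * p) - ?f' y))"
        by (intro Ck_le_linear \<delta>(2)[OF \<beta>] bounded_linear_scaleR_right) auto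
      show "Ck_le k T (\<bar>\<beta>\<bar> * \<epsilon>) (\<lambda>p. \<beta> *\<^sub>R (?f' (y + \<beta> * p) - ?f' y))"
        by (rule Ck_le_mono[OF C]) (use \<epsilon>' in \<open>auto intro: mult_left_mono\<close>)
      fix p assume p: "\<bar>p\<bar> \<le> T"
      have "norm (?E p - ?E 0) \<le> (\<bar>\<beta>\<bar> * \<epsilon>') * norm (p - 0)"
      proof (rule differentiable_bound[of "{-T..T}" ?E "\<lambda>q h. h *\<^sub>R (\<beta> *\<^sub>R (?f' (y + \<beta> * q) - ?f' y))"])
        show "(?E has_derivative (\<lambda>h. h *\<^sub>R (\<beta> *\<^sub>R (?f' (y + \<beta> * q) - ?f' y)))) (at q within {-T..T})" for q
          using has_vector_derivative_at_within[OF dE] unfolding has_vector_derivative_def by blast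
        show "onorm (\<lambda>h. h *\<^sub>R (\<beta> *\<^sub>R (?f' (y + \<beta> * q) - ?f' y))) \<le> \<bar>\<beta>\<bar> * \<epsilon>'" if "q \<in> {-T..T}" for q
        proof (rule onorm_le)
          fix h :: real
          have "norm (\<beta> *\<^sub>R (?f' (y + \<beta> * q) - ?f' y)) \<le> \<bar>\<beta>\<bar> * \<epsilon>'"
            using that by (intro Ck_leD[OF C]) auto
          from mult_left_mono[OF this norm_ge_zero[of h]]
          show "norm (h *\<^sub>R (\<beta> *\<^sub>R (?f' (y + \<beta> * q) - ?f' y))) \<le> \<bar>\<beta>\<bar> * \<epsilon>' * norm h"
            by (simp add: abs_mult mult_ac)
        qed
      qed (use p T in \<open>auto simp: abs_le_iff\<close>)
      also have "\<dots> \<le> (\<bar>\<beta>\<bar> * \<epsilon>') * T" using p \<epsilon>' by (intro mult_left_mono) auto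
      also have "\<dots> \<le> \<bar>\<beta>\<bar> * \<epsilon>" using \<epsilon>' by (simp add: mult.assoc mult_left_mono)
      finally show "norm (?E p) \<le> \<bar>\<beta>\<bar> * \<epsilon>" by simp
    qed
  qed (rule \<delta>(1))
qed

lemma cRot_of_real: "cRot (of_real t) $ i $ j = of_real (Rot t $ i $ j)"
proof -
  have "of_real (2 * pi) * complex_of_real t = of_real (2 * pi * t)" by simp
  then show ?thesis using exhaust_2[of i] exhaust_2[of j]
    by (auto simp: cRot_def Rot_def cos_of_real sin_of_real simp del: of_real_mult)
qed

lemma mat_mult_eq_scaleR: "mat c ** (M :: real^2^2) = c *\<^sub>R M"
  by (simp add: vec_eq_iff matrix_matrix_mult_def mat_def sum_2 forall_2)

lemma matrix_scale_Ck:
  assumes T: "0 \<le> T"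
  shows "matrix_scale (Ck_le k T) of_real Rot T (2 ^ k + 2 * (T + 1)) 2 (T + real k)"
proof
  have k1: "(1::real) \<le> 2 ^ k" by simp
  show "1 \<le> 2 ^ k + 2 * (T + 1)" using add_mono[OF k1, of 0 "2 * (T + 1)"] T by simp
  show "Ck_le k T (norm M) (\<lambda>_. M)" for M :: "real^2^2" by (rule Ck_le_const) simp
  show "Ck_le k T ((2 ^ k + 2 * (T + 1)) * \<bar>\<beta>\<bar>) (\<lambda>p. mat (of_real \<beta> * p) :: real^2^2)" for \<beta>
  proof -
    have id: "Ck_le k T (T + 1) (\<lambda>p. p)"
    proof (cases k)
      case (Suc j)
      show ?thesis unfolding Suc Ck_le_Suc using T
        by (intro exI[of _ "\<lambda>_. 1"]) (auto intro!: Ck_le_const)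
    qed (auto simp: Ck_le_0)
    have lin: "bounded_linear (\<lambda>x. mat (\<beta> * x) :: real^2^2)"
    proof -
      have "(\<lambda>x. mat (\<beta> * x) :: real^2^2) = (\<lambda>x. x *\<^sub>R mat \<beta>)" by (auto simp: fun_eq_iff vec_eq_iff mat_def)
      then show ?thesis using bounded_linear_scaleR_left by simp
    qed
    have "sqrt 2 \<le> 2" using real_sqrt_le_iff[of 2 4] by simp
    then have "sqrt 2 * \<bar>\<beta> * x\<bar> \<le> 2 * \<bar>\<beta> * x\<bar>" for x by (intro mult_right_mono) auto
    then have "norm (mat (\<beta> * x) :: real^2^2) \<le> (2 * \<bar>\<beta>\<bar>) * norm x" for x
      by (simp add: norm_mat_2 abs_mult mult.assoc)
    from Ck_le_linear[OF lin this _ id]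
    have C: "Ck_le k T ((2 * \<bar>\<beta>\<bar>) * (T + 1)) (\<lambda>p. mat (\<beta> * p) :: real^2^2)" by simp
    have "(2 * (T + 1)) * \<bar>\<beta>\<bar> \<le> (2 ^ k + 2 * (T + 1)) * \<bar>\<beta>\<bar>" by (intro mult_right_mono) auto
    then have "2 * \<bar>\<beta>\<bar> * (T + 1) \<le> (2 ^ k + 2 * (T + 1)) * \<bar>\<beta>\<bar>" by (simp add: mult_ac)
    from Ck_le_mono[OF C this] show ?thesis by simp
  qed
  show "Ck_le k T ((2 ^ k + 2 * (T + 1)) * c * d) (\<lambda>p. X p ** Y p)"
    if X: "Ck_le k T c X" and Y: "Ck_le k T d Y" for c d and X Y :: "real \<Rightarrow> real^2^2"
  proof (rule Ck_le_mono[OF Ck_le_matrix_mult[OF T X Y]])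
    show "2 ^ k * c * d \<le> (2 ^ k + 2 * (T + 1)) * c * d"
      using T Ck_le_nonneg[OF X T] Ck_le_nonneg[OF Y T] by (intro mult_right_mono) auto
  qed
  show "Ck_le k T (2 * c) f"
    if "\<And>i j. (\<lambda>z. F z $ i $ j) holomorphic_on UNIV" "\<And>p i j. F (complex_of_real p) $ i $ j = complex_of_real (f p $ i $ j)"
      "\<And>z i j. norm z \<le> T + real k \<Longrightarrow> norm (F z $ i $ j) \<le> c" for F :: "complex \<Rightarrow> complex^2^2" and f :: "real \<Rightarrow> real^2^2" and c
    by (rule Ck_le_restrict_entire[OF T that])
qed (use T in \<open>auto intro: Ck_le_add Ck_le_mono Ck_leD simp: cRot_of_real\<close>)

section \<open>Holomorphic extensions\<close>

text \<open>
  Inside the real interval of convergence a power series converges absolutely, hence also on the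
  complex disc of the same radius.
\<close>

lemma real_analytic_local_extension:
  fixes A :: "real \<Rightarrow> real^2^2"
  assumes "real_analytic A"
  shows "\<exists>\<delta>>0. \<exists>G :: complex \<Rightarrow> complex^2^2. (\<forall>i j. (\<lambda>z. G z $ i $ j) holomorphic_on ball 0 \<delta>) \<and>
    (\<forall>h. \<bar>h\<bar> < \<delta> \<longrightarrow> G (of_real h) = cmat (A (x + h)))"
proof -
  obtain \<delta> c where \<delta>: "0 < \<delta>" and c: "\<And>y. \<bar>y - x\<bar> < \<delta> \<Longrightarrow> (\<lambda>m. (y - x) ^ m *\<^sub>R c m) sums A y"
    using assms unfolding real_analytic_def by meson
  have entry: "(\<lambda>m. c m $ i $ j * h ^ m) sums (A (x + h) $ i $ j)" if "\<bar>h\<bar> < \<delta>" for h i j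
  proof -
    have "(\<lambda>m. h ^ m *\<^sub>R c m) sums A (x + h)" using c[of "x + h"] that by simp
    then have "(\<lambda>m. (h ^ m *\<^sub>R c m) $ i $ j) sums (A (x + h) $ i $ j)"
      by (intro bounded_linear.sums[OF bounded_linear_compose[OF bounded_linear_vec_nth bounded_linear_vec_nth]])
    then show ?thesis by (simp add: mult.commute)
  qed
  define g where "g i j z = (\<Sum>m. of_real (c m $ i $ j) * z ^ m)" for i j and z :: complex
  have sums: "(\<lambda>m. of_real (c m $ i $ j) * z ^ m) sums g i j z" if z: "norm z < \<delta>" for i j z
  proof -
    obtain r where r: "norm z < r" "r < \<delta>" using dense[OF z] by blast
    have r0: "0 < r" using r(1) by (rule le_less_trans[OF norm_ge_zero])
    have "summable (\<lambda>m. c m $ i $ j * r ^ m)" using entry[of r] r r0 by (auto simp: sums_iff)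
    then have "summable (\<lambda>m. complex_of_real (c m $ i $ j * r ^ m))" by (rule summable_of_real)
    then have "summable (\<lambda>m. complex_of_real (c m $ i $ j) * of_real r ^ m)" by simp
    then have "summable (\<lambda>m. of_real (c m $ i $ j) * z ^ m)"
      by (rule powser_inside) (use r r0 in simp)
    then show ?thesis unfolding g_def by (rule summable_sums)
  qed
  have hol: "g i j holomorphic_on ball 0 \<delta>" for i j
    by (rule power_series_holomorphic[where a = "\<lambda>m. of_real (c m $ i $ j)"]) (use sums in simp)
  have real: "g i j (of_real h) = of_real (A (x + h) $ i $ j)" if h: "\<bar>h\<bar> < \<delta>" for i j h
  proof -
    have "(\<lambda>m. complex_of_real (c m $ i $ j * h ^ m)) sums of_real (A (x + h) $ i $ j)"
      using entry[OF h] by (rule sums_of_real)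
    moreover have "(\<lambda>m. of_real (c m $ i $ j) * of_real h ^ m) sums g i j (of_real h)"
      using h by (intro sums) simp
    ultimately show ?thesis using sums_unique2 by fastforce
  qed
  show ?thesis
    using \<delta> hol real by (intro exI[of _ \<delta>] conjI exI[of _ "\<lambda>z. \<chi> i j. g i j z"]) (auto simp: vec_eq_iff)
qed

text \<open>
  Compactness of the circle gives a common radius and bound. The extensions at different base
  points are independent of each other; each factor of an iterate uses its own one.
\<close>

lemma real_analytic_uniform_extension:
  fixes A :: "real \<Rightarrow> real^2^2"
  assumes "real_analytic A" "on_circle A"
  obtains \<rho> M :: real and G :: "real \<Rightarrow> complex \<Rightarrow> complex^2^2" where "0 < \<rho>"
    "\<And>y i j. (\<lambda>z. G y z $ i $ j) holomorphic_on ball 0 \<rho>"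
    "\<And>y z i j. norm z < \<rho> \<Longrightarrow> norm (G y z $ i $ j) \<le> M"
    "\<And>y h. \<bar>h\<bar> < \<rho> \<Longrightarrow> G y (of_real h) = cmat (A (y + h))"
proof -
  obtain \<delta> H where \<delta>: "\<And>x. 0 < \<delta> x" and H: "\<And>x i j. (\<lambda>z. (H x z :: complex^2^2) $ i $ j) holomorphic_on ball 0 (\<delta> x)"
    "\<And>x h. \<bar>h\<bar> < \<delta> x \<Longrightarrow> H x (of_real h) = cmat (A (x + h))"
    using real_analytic_local_extension[OF assms(1)] by metis
  have "\<exists>M. \<forall>z i j. norm z \<le> \<delta> x / 2 \<longrightarrow> norm (H x z $ i $ j) \<le> M" for x
  proof -
    have "\<exists>M. \<forall>z\<in>cball 0 (\<delta> x / 2). norm (H x z $ i $ j) \<le> M" for i j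
    proof -
      have "continuous_on (cball 0 (\<delta> x / 2)) (\<lambda>z. H x z $ i $ j)"
        using \<delta>[of x] by (intro holomorphic_on_imp_continuous_on holomorphic_on_subset[OF H(1)]) auto
      then have "bounded ((\<lambda>z. H x z $ i $ j) ` cball 0 (\<delta> x / 2))"
        by (intro compact_imp_bounded compact_continuous_image) auto
      then show ?thesis by (auto simp: bounded_iff)
    qed
    then obtain N where N: "\<And>i j z. z \<in> cball 0 (\<delta> x / 2) \<Longrightarrow> norm (H x z $ i $ j) \<le> N i j" by metis
    have "norm (H x z $ i $ j) \<le> Max (range (\<lambda>(i, j). N i j))" if "norm z \<le> \<delta> x / 2" for z i j
    proof -
      have "norm (H x z $ i $ j) \<le> N i j" using that by (intro N) simp
      also have "\<dots> \<le> Max (range (\<lambda>(i, j). N i j))" by (rule Max_ge) auto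
      finally show ?thesis .
    qed
    then show ?thesis by blast
  qed
  then obtain N where N: "\<And>x z i j. norm z \<le> \<delta> x / 2 \<Longrightarrow> norm (H x z $ i $ j) \<le> N x" by metis
  obtain C where C: "C \<subseteq> {0..1}" "finite C" "{0..1} \<subseteq> (\<Union>x\<in>C. ball x (\<delta> x / 4))"
    by (rule compactE_image[of "{0..1::real}" "{0..1}" "\<lambda>x. ball x (\<delta> x / 4)"]) (use \<delta> in \<open>auto\<close>)
  have Cne: "C \<noteq> {}" using C(3) by auto
  define \<rho> where "\<rho> = Min ((\<lambda>x. \<delta> x / 4) ` C)"
  define M where "M = Max (N ` C)"
  have \<rho>: "0 < \<rho>" using C(2) Cne \<delta> by (simp add: \<rho>_def)
  have loc: "\<exists>G. (\<forall>i j. (\<lambda>z. (G z :: complex^2^2) $ i $ j) holomorphic_on ball 0 \<rho>) \<and>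
    (\<forall>z i j. norm z < \<rho> \<longrightarrow> norm (G z $ i $ j) \<le> M) \<and> (\<forall>h. \<bar>h\<bar> < \<rho> \<longrightarrow> G (of_real h) = cmat (A (y + h)))" for y
  proof -
    obtain k :: int where k: "y - of_int k \<in> {0..1}"
    proof (rule that[of "\<lfloor>y\<rfloor>"])
      show "y - of_int \<lfloor>y\<rfloor> \<in> {0..1}" unfolding atLeastAtMost_iff by linarith
    qed
    obtain x where x: "x \<in> C" "\<bar>y - of_int k - x\<bar> < \<delta> x / 4"
    proof -
      have "y - of_int k \<in> (\<Union>x\<in>C. ball x (\<delta> x / 4))" using C(3) k by (rule subsetD)
      then show ?thesis using that by (auto simp: dist_real_def abs_minus_commute)
    qed
    define u where "u = y - of_int k - x"
    have \<rho>x: "\<rho> \<le> \<delta> x / 4" unfolding \<rho>_def using C(2) x(1) by (intro Min_le) auto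
    have NM: "N x \<le> M" unfolding M_def using C(2) x(1) by (intro Max_ge) auto
    have small: "norm (of_real u + z) < \<delta> x / 2" if "norm z < \<rho>" for z :: complex
    proof -
      have "norm (complex_of_real u) < \<delta> x / 4" using x(2) unfolding norm_of_real u_def by simp
      then show ?thesis using norm_triangle_ineq[of "of_real u" z] that \<rho>x by linarith
    qed
    let ?G = "\<lambda>z. H x (of_real u + z)"
    have "(\<lambda>z. ?G z $ i $ j) holomorphic_on ball 0 \<rho>" for i j
    proof -
      have "((\<lambda>z. H x z $ i $ j) \<circ> (\<lambda>z. of_real u + z)) holomorphic_on ball 0 \<rho>"
      proof (rule holomorphic_on_compose_gen[OF _ H(1)])
        show "(+) (complex_of_real u) ` ball 0 \<rho> \<subseteq> ball 0 (\<delta> x)"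
          using small \<delta>[of x] by force
      qed (intro holomorphic_intros)
      then show ?thesis by (simp add: comp_def)
    qed
    moreover have "norm (?G z $ i $ j) \<le> M" if "norm z < \<rho>" for z i j
      using N[of "of_real u + z" x i j] small[OF that] NM by simp
    moreover have "?G (of_real h) = cmat (A (y + h))" if "\<bar>h\<bar> < \<rho>" for h
    proof -
      have "H x (of_real (u + h)) = cmat (A (x + (u + h)))"
      proof (rule H(2))
        show "\<bar>u + h\<bar> < \<delta> x" using x(2)[folded u_def] that \<rho>x by linarith
      qed
      also have "A (x + (u + h)) = A (y + h)"
        using periodic_int[OF assms(2), of "y + h" "- k"] by (simp add: u_def algebra_simps)
      finally show ?thesis by simp
    qed
    ultimately show ?thesis by (intro exI[of _ ?G] conjI allI impI)
  qed
  define G where "G y = (SOME G. (\<forall>i j. (\<lambda>z. (G z :: complex^2^2) $ i $ j) holomorphic_on ball 0 \<rho>) \<and>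
    (\<forall>z i j. norm z < \<rho> \<longrightarrow> norm (G z $ i $ j) \<le> M) \<and> (\<forall>h. \<bar>h\<bar> < \<rho> \<longrightarrow> G (of_real h) = cmat (A (y + h))))" for y
  note G = someI_ex[OF loc, folded G_def]
  show ?thesis
    by (rule that[OF \<rho>, of G M]) (use G in \<open>simp_all\<close>)
qed

lemma deriv_real_on_reals:
  assumes "f holomorphic_on ball 0 \<rho>" "0 < \<rho>" "\<And>h. \<bar>h\<bar> < \<rho> \<Longrightarrow> f (of_real h) \<in> \<real>"
  shows "deriv f 0 \<in> \<real>"
proof -
  have "((\<lambda>t. f (of_real t)) has_vector_derivative deriv f (of_real 0)) (at 0)"
    using assms(1,2) by (intro has_vector_derivative_real_field holomorphic_derivI[of f "ball 0 \<rho>"]) auto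
  then have "((\<lambda>t. Im (f (of_real t))) has_vector_derivative Im (deriv f 0)) (at 0)"
    using bounded_linear.has_vector_derivative[OF bounded_linear_Im] by fastforce
  then have "((\<lambda>t. 0) has_vector_derivative Im (deriv f 0)) (at (0::real))"
    by (rule has_vector_derivative_transform_within_open[of _ _ _ "ball 0 \<rho>"]) (use assms(2,3) in \<open>auto simp: complex_is_Real_iff dist_real_def\<close>)
  then have "Im (deriv f 0) = 0"
    using has_vector_derivative_const vector_derivative_unique_at by blast
  then show ?thesis by (simp add: complex_is_Real_iff)
qed

lemma holomorphic_linear_approximation:
  assumes hol: "f holomorphic_on ball 0 \<rho>" and \<rho>: "0 < \<rho>" and M: "\<And>z. norm z < \<rho> \<Longrightarrow> norm (f z) \<le> M" and z: "norm z \<le> \<rho> / 2"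
  shows "norm (f z - f 0 - z * deriv f 0) \<le> 32 * M / \<rho>\<^sup>2 * (norm z)\<^sup>2"
    and "norm (deriv f 0) \<le> 4 * M / \<rho>"
proof -
  have C: "norm ((deriv ^^ n) f w) \<le> fact n * M / (\<rho> / 4) ^ n" if "norm w \<le> \<rho> / 2" for w n
  proof (rule Cauchy_inequality)
    have sub: "cball w (\<rho> / 4) \<subseteq> ball 0 \<rho>"
    proof
      fix v assume "v \<in> cball w (\<rho> / 4)"
      then show "v \<in> ball 0 \<rho>" using that \<rho> norm_triangle_ineq[of "v - w" w] by (simp add: dist_norm norm_minus_commute)
    qed
    show "f holomorphic_on ball w (\<rho> / 4)" using sub by (intro holomorphic_on_subset[OF hol]) auto
    show "continuous_on (cball w (\<rho> / 4)) f"
      using sub by (intro holomorphic_on_imp_continuous_on holomorphic_on_subset[OF hol])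
    show "norm (f x) \<le> M" if "norm (w - x) = \<rho> / 4" for x
      using sub that by (intro M) (auto simp: dist_norm subset_iff)
  qed (use \<rho> in simp)
  show "norm (deriv f 0) \<le> 4 * M / \<rho>" using C[of 0 1] \<rho> by (simp add: field_simps)
  have "norm ((deriv ^^ 0) f z - (\<Sum>i\<le>1. (deriv ^^ i) f 0 * (z - 0) ^ i / fact i)) \<le> 32 * M / \<rho>\<^sup>2 * norm (z - 0) ^ Suc 1 / fact 1"
  proof (rule complex_Taylor[of "cball 0 (\<rho> / 2)" 1 "\<lambda>i. (deriv ^^ i) f"])
    show "((deriv ^^ i) f has_field_derivative (deriv ^^ Suc i) f x) (at x within cball 0 (\<rho> / 2))" if "x \<in> cball 0 (\<rho> / 2)" for i x
    proof -
      have "((deriv ^^ i) f has_field_derivative deriv ((deriv ^^ i) f) x) (at x)"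
        using that \<rho> by (intro holomorphic_derivI[of _ "ball 0 \<rho>"] holomorphic_higher_deriv hol) auto
      then show ?thesis by (simp add: has_field_derivative_at_within)
    qed
    show "norm ((deriv ^^ Suc 1) f x) \<le> 32 * M / \<rho>\<^sup>2" if "x \<in> cball 0 (\<rho> / 2)" for x
      using C[of x 2] that \<rho> by (simp add: numeral_2_eq_2 power2_eq_square field_simps)
  qed (use z \<rho> in auto)
  then show "norm (f z - f 0 - z * deriv f 0) \<le> 32 * M / \<rho>\<^sup>2 * (norm z)\<^sup>2"
    by (simp add: power2_eq_square algebra_simps)
qed

text \<open>
  The disc is open and larger than the interval \<open>[-T, T]\<close>, so it is a neighbourhood of that
  interval.
\<close>

definition holomorphic_le :: "real \<Rightarrow> real \<Rightarrow> (complex \<Rightarrow> complex^2^2) \<Rightarrow> bool" where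
  "holomorphic_le T c X \<longleftrightarrow> (\<forall>i j. (\<lambda>z. X z $ i $ j) holomorphic_on ball 0 (T + 1)) \<and>
    (\<forall>z. norm z < T + 1 \<longrightarrow> norm (X z) \<le> c)"

lemma matrix_scale_holomorphic:
  assumes T: "0 \<le> T"
  shows "matrix_scale (holomorphic_le T) (\<lambda>z. z) cRot T (2 * (T + 1)) 2 (T + 1)"
proof
  show "holomorphic_le T (norm M) (\<lambda>_. M)" for M by (simp add: holomorphic_le_def)
  show "holomorphic_le T (2 * (T + 1) * \<bar>\<beta>\<bar>) (\<lambda>p. mat (of_real \<beta> * p))" for \<beta>
    unfolding holomorphic_le_def
  proof (intro conjI allI impI)
    show "(\<lambda>z. (mat (of_real \<beta> * z) :: complex^2^2) $ i $ j) holomorphic_on ball 0 (T + 1)" for i j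
      by (intro holomorphic_mat holomorphic_intros)
    fix z :: complex assume z: "norm z < T + 1"
    have "sqrt 2 \<le> 2" using real_sqrt_le_iff[of 2 4] by simp
    then have "sqrt 2 * (\<bar>\<beta>\<bar> * norm z) \<le> 2 * (\<bar>\<beta>\<bar> * (T + 1))" using z by (intro mult_mono) auto
    then show "norm (mat (of_real \<beta> * z) :: complex^2^2) \<le> 2 * (T + 1) * \<bar>\<beta>\<bar>" by (simp add: norm_mat_2 norm_mult mult_ac)
  qed
  show "holomorphic_le T (2 * (T + 1) * c * d) (\<lambda>p. X p ** Y p)"
    if X: "holomorphic_le T c X" and Y: "holomorphic_le T d Y" for c d X Y
    unfolding holomorphic_le_def
  proof (intro conjI allI impI)
    show "(\<lambda>z. (X z ** Y z) $ i $ j) holomorphic_on ball 0 (T + 1)" for i j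
      using X Y by (intro holomorphic_matrix_mult) (auto simp: holomorphic_le_def)
    fix z :: complex assume z: "norm z < T + 1"
    have n: "norm (X z) \<le> c" "norm (Y z) \<le> d" using X Y z by (auto simp: holomorphic_le_def)
    have cd: "0 \<le> c" "0 \<le> d" using order_trans[OF norm_ge_zero n(1)] order_trans[OF norm_ge_zero n(2)] .
    have "norm (X z ** Y z) \<le> 1 * (c * d)"
      using order_trans[OF norm_matrix_mult_le mult_mono[OF n]] cd by simp
    also have "\<dots> \<le> (2 * (T + 1)) * (c * d)" using T cd by (intro mult_right_mono) auto
    finally show "norm (X z ** Y z) \<le> 2 * (T + 1) * c * d" by (simp add: mult_ac)
  qed
  show "holomorphic_le T (2 * c) f"
    if "\<And>i j. (\<lambda>z. F z $ i $ j) holomorphic_on UNIV" "\<And>p i j. F p $ i $ j = f p $ i $ j"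
      "\<And>z i j. norm z \<le> T + 1 \<Longrightarrow> norm (F z $ i $ j) \<le> c" for F f :: "complex \<Rightarrow> complex^2^2" and c
  proof -
    have "f = F" using that(2) by (simp add: fun_eq_iff vec_eq_iff)
    then show ?thesis using that(1,3) by (auto simp: holomorphic_le_def intro: holomorphic_on_subset norm_matrix2_le)
  qed
  show "holomorphic_le T (c + d) (\<lambda>p. X p + Y p)" if "holomorphic_le T c X" "holomorphic_le T d Y" for c d X Y
    using that by (auto simp: holomorphic_le_def intro!: holomorphic_intros norm_triangle_mono)
qed (use T in \<open>auto simp: holomorphic_le_def intro: order_trans\<close>)

section \<open>Consequences of the comparison on the line\<close>

context matrix_scale
begin

lemma exact_tangent_close_on_reals:
  fixes F :: "nat \<Rightarrow> nat \<Rightarrow> 'k \<Rightarrow> 'k^2^2"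
  assumes avg: "bounded_averages \<alpha> A dA xs S M0 M1" and m\<beta>: "\<And>n. real (m n) * \<bar>\<beta> n\<bar> \<le> 1"
    and approx: "\<And>\<epsilon>. 0 < \<epsilon> \<Longrightarrow> \<forall>\<^sub>F n in sequentially. \<forall>k<m n. sm (\<bar>\<beta> n\<bar> * \<epsilon>)
      (\<lambda>p. F n k p - cmat (A (xs + real k * \<alpha>)) - mat (of_real (\<beta> n) * p) ** cmat (dA (xs + real k * \<alpha>)))"
    and F: "\<forall>\<^sub>F n in sequentially. \<forall>k t. \<bar>t\<bar> \<le> T \<longrightarrow> F n k (of_real t) = cmat (A (xs + real k * \<alpha> + \<beta> n * t))"
    and \<epsilon>: "0 < \<epsilon>"
  shows "\<forall>\<^sub>F n in sequentially. \<forall>t. \<bar>t\<bar> \<le> T \<longrightarrow>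
      norm (matrix_inv (cocycle_pow \<alpha> A (m n) xs) ** cocycle_pow \<alpha> A (m n) (xs + \<beta> n * t)
        - tangent_prod \<alpha> A dA xs (\<beta> n) (m n) t) \<le> \<epsilon>"
proof -
  have "\<forall>\<^sub>F n in sequentially. sm \<epsilon> (\<lambda>p. exact_prod \<alpha> A xs (F n) (m n) p
    - tangent_prod \<alpha> A dA xs (\<beta> n) (m n) p)"
    by (rule near_prod_exact_tangent[OF avg m\<beta> _ \<epsilon>]) (rule approx)
  with F show ?thesis
  proof eventually_elim
    case (elim n)
    interpret bounded_averages \<alpha> A dA xs S M0 M1 by fact
    show ?case
    proof (intro allI impI)
      fix t assume t: "\<bar>t\<bar> \<le> T"
      let ?N = "exact_prod \<alpha> A xs (F n) (m n) (of_real t)"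
      have "local_prod (F n) (m n) (of_real t) = cmat (cocycle_pow \<alpha> A (m n) (xs + \<beta> n * t))"
        using elim(1) t by (intro local_prod_of_real) (simp add: add_ac)
      then have "cmat (cocycle_pow \<alpha> A (m n) xs) ** ?N = cmat (cocycle_pow \<alpha> A (m n) (xs + \<beta> n * t))"
        using local_prod_eq_near_prod[OF SL2, where F = "F n" and m = "m n" and \<alpha> = \<alpha> and xs = xs and p = "of_real t"] by simp
      then have "cmat (matrix_inv (cocycle_pow \<alpha> A (m n) xs)) ** (cmat (cocycle_pow \<alpha> A (m n) xs) ** ?N)
         = cmat (matrix_inv (cocycle_pow \<alpha> A (m n) xs) ** cocycle_pow \<alpha> A (m n) (xs + \<beta> n * t))" by (simp add: cmat_mult)
      then have N: "?N = cmat (matrix_inv (cocycle_pow \<alpha> A (m n) xs) ** cocycle_pow \<alpha> A (m n) (xs + \<beta> n * t))"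
        by (simp add: matrix_mul_assoc cmat_mult[symmetric] SL2_inverse[OF pow_SL2])
      have "norm (?N - tangent_prod \<alpha> A dA xs (\<beta> n) (m n) (of_real t)) \<le> \<epsilon>"
        using t by (intro sm_pointwise[OF elim(2)]) simp
      then show "norm (matrix_inv (cocycle_pow \<alpha> A (m n) xs) ** cocycle_pow \<alpha> A (m n) (xs + \<beta> n * t)
          - tangent_prod \<alpha> A dA xs (\<beta> n) (m n) t) \<le> \<epsilon>"
        unfolding N near_prod_tangent_of_real cmat_diff[symmetric] norm_cmat .
    qed
  qed
qed

end

lemma Ck_cocycle_pow_affine:
  assumes "times_cont_diff (enat k) A" "on_circle A" "0 \<le> T"
  shows "\<exists>c. Ck_le k T c (\<lambda>p. cocycle_pow \<alpha> A m (x + \<beta> * p))"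
proof (induction m)
  case 0
  then show ?case using Ck_le_const[of "mat 1 :: real^2^2", OF order_refl] by (auto intro!: exI)
next
  case (Suc m)
  then obtain c where c: "Ck_le k T c (\<lambda>p. cocycle_pow \<alpha> A m (x + \<beta> * p))" by blast
  obtain M where M: "Ck_le k T M (\<lambda>p. A ((x + real m * \<alpha>) + \<beta> * p))"
    using Ck_le_affine_uniform[OF assms(1,2), where L = "\<bar>\<beta>\<bar>" and T = T] by fastforce
  have "(\<lambda>p. A ((x + real m * \<alpha>) + \<beta> * p)) = (\<lambda>p. A (x + \<beta> * p + real m * \<alpha>))" by (simp add: add_ac)
  from Ck_le_matrix_mult[OF assms(3) M[unfolded this] c] show ?case by auto
qed

lemma nth_vderiv_minus_const:
  "nth_vderiv j (\<lambda>t. f t - M) t = nth_vderiv j f t - nth_vderiv j (\<lambda>_. M) t"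
proof (cases j)
  case (Suc i)
  have "vector_derivative (\<lambda>t. f t - M) (at x) = vector_derivative f (at x)" for x
  proof -
    have "((\<lambda>t. f t - M) has_vector_derivative D) (at x) \<longleftrightarrow> (f has_vector_derivative D) (at x)" for D
    proof
      assume "((\<lambda>t. f t - M) has_vector_derivative D) (at x)"
      from has_vector_derivative_add[OF this has_vector_derivative_const[of M]]
      show "(f has_vector_derivative D) (at x)" by simp
    next
      assume "(f has_vector_derivative D) (at x)"
      from has_vector_derivative_diff[OF this has_vector_derivative_const[of M]]
      show "((\<lambda>t. f t - M) has_vector_derivative D) (at x)" by simp
    qed
    then show ?thesis by (simp add: vector_derivative_def)
  qed
  moreover have "nth_vderiv i (\<lambda>_. 0) t = 0"
  proof (induction i)
    case (Suc i)
    then show ?case by (simp add: nth_vderiv_Suc)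
  qed simp
  ultimately show ?thesis by (simp add: Suc nth_vderiv_Suc)
qed simp

lemma converges_in_Diff_from_Ck:
  fixes f :: "nat \<Rightarrow> real \<Rightarrow> real^2^2"
  assumes reg: "\<And>n k. enat k \<le> r \<Longrightarrow> times_cont_diff (enat k) (f n)"
    and lim: "\<And>k T \<epsilon>. enat k \<le> r \<Longrightarrow> 0 \<le> T \<Longrightarrow> 0 < \<epsilon> \<Longrightarrow> \<forall>\<^sub>F n in sequentially. Ck_le k T \<epsilon> (\<lambda>t. f n t - M)"
  shows "converges_in_class (Diff r) f (\<lambda>_. M)"
  unfolding converges_in_class.simps
proof (intro conjI allI impI)
  show "times_cont_diff r (f n)" for n using reg times_cont_diff_iff_finite by blast
  have "times_cont_diff (enat k) (\<lambda>_::real. M)" for k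
    using Ck_le_const[of M "norm M" k 0] by (simp add: Ck_le_def)
  then show "times_cont_diff r (\<lambda>_::real. M)" using times_cont_diff_iff_finite by blast
  fix k and K :: "real set" assume k: "enat k \<le> r" and K: "compact K"
  obtain T where T: "\<And>x. x \<in> K \<Longrightarrow> \<bar>x\<bar> \<le> T" "0 \<le> T"
  proof -
    obtain T where "\<And>x. x \<in> K \<Longrightarrow> \<bar>x\<bar> \<le> T" using compact_imp_bounded[OF K] by (auto simp: bounded_iff)
    then show ?thesis using that[of "\<bar>T\<bar>"] by force
  qed
  show "uniform_limit K (\<lambda>n. nth_vderiv k (f n)) (nth_vderiv k (\<lambda>_. M)) sequentially"
  proof (rule uniform_limitI)
    fix e :: real assume e: "0 < e"
    from lim[OF k T(2), of "e / 2"] e have "\<forall>\<^sub>F n in sequentially. Ck_le k T (e / 2) (\<lambda>t. f n t - M)" by simp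
    then show "\<forall>\<^sub>F n in sequentially. \<forall>x\<in>K. dist (nth_vderiv k (f n) x) (nth_vderiv k (\<lambda>_. M) x) < e"
    proof eventually_elim
      case (elim n)
      show ?case
      proof
        fix x assume "x \<in> K"
        then have "norm (nth_vderiv k (\<lambda>t. f n t - M) x) \<le> e / 2" using elim T(1) by (auto simp: Ck_le_def)
        then show "dist (nth_vderiv k (f n) x) (nth_vderiv k (\<lambda>_. M) x) < e"
          using e by (simp add: nth_vderiv_minus_const dist_norm)
      qed
    qed
  qed
qed

section \<open>Convergence along one orbit\<close>

text \<open>
  Convergence to the identity with the constant extension as the limit of the holomorphic
  extensions. Unlike convergence in class, where extensions of the limit may depend on the
  sequence, this passes immediately to sequences mixed from two others.
\<close>

fun converges_to_one :: "regularity \<Rightarrow> (nat \<Rightarrow> real \<Rightarrow> real^2^2) \<Rightarrow> bool" where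
  "converges_to_one (Diff r) f \<longleftrightarrow> converges_in_class (Diff r) f (\<lambda>_. mat 1)"
| "converges_to_one Analytic f \<longleftrightarrow> (\<forall>T\<ge>0. \<exists>F. (\<forall>\<^sub>F n in sequentially. holomorphic_extension (ball 0 (T + 1)) (f n) (F n)) \<and>
     uniform_limit (ball 0 (T + 1)) F (\<lambda>_. mat 1) sequentially)"

lemma converges_to_one_imp: "converges_to_one r f \<Longrightarrow> converges_in_class r f (\<lambda>_. mat 1)"
proof (cases r)
  case Analytic
  assume "converges_to_one r f"
  then have conv: "\<And>T. 0 \<le> T \<Longrightarrow> \<exists>F. (\<forall>\<^sub>F n in sequentially. holomorphic_extension (ball 0 (T + 1)) (f n) (F n)) \<and>
     uniform_limit (ball 0 (T + 1)) F (\<lambda>_. mat 1) sequentially" by (simp add: Analytic)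
  show ?thesis unfolding Analytic converges_in_class.simps
  proof (intro allI impI)
    fix K :: "real set" assume K: "compact K"
    obtain T where "\<forall>x\<in>K. \<bar>x\<bar> \<le> T" using compact_imp_bounded[OF K] by (auto simp: bounded_iff)
    then have T: "complex_of_real ` K \<subseteq> ball 0 (\<bar>T\<bar> + 1)" by fastforce
    have "holomorphic_extension (ball 0 (\<bar>T\<bar> + 1)) (\<lambda>_. mat 1) (\<lambda>_. mat 1)"
      by (auto simp: holomorphic_extension_def mat_def)
    then show "\<exists>U F G. open U \<and> complex_of_real ` K \<subseteq> U \<and>
        (\<forall>\<^sub>F n in sequentially. holomorphic_extension U (f n) (F n)) \<and>
        holomorphic_extension U (\<lambda>_. mat 1) G \<and> uniform_limit U F G sequentially"
      using conv[of "\<bar>T\<bar>"] T by (intro exI[of _ "ball 0 (\<bar>T\<bar> + 1)"]) auto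
  qed
qed simp

lemma converges_to_one_interleave:
  assumes "converges_to_one r f" "converges_to_one r f'"
  shows "converges_to_one r (\<lambda>n. if P n then f n else f' n)"
proof (cases r)
  case (Diff r)
  have u: "uniform_limit K (\<lambda>n. if P n then h n else h' n) g sequentially"
    if "uniform_limit K h g sequentially" "uniform_limit K h' g sequentially" for K and h h' :: "nat \<Rightarrow> real \<Rightarrow> real^2^2" and g
    unfolding uniform_limit_iff
  proof (intro allI impI)
    fix e :: real assume "0 < e"
    with that have "\<forall>\<^sub>F n in sequentially. \<forall>x\<in>K. dist (h n x) (g x) < e" "\<forall>\<^sub>F n in sequentially. \<forall>x\<in>K. dist (h' n x) (g x) < e"
      by (auto simp: uniform_limit_iff)
    then show "\<forall>\<^sub>F n in sequentially. \<forall>x\<in>K. dist ((if P n then h n else h' n) x) (g x) < e"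
      by eventually_elim auto
  qed
  have eq: "nth_vderiv k (if P n then f n else f' n) = (if P n then nth_vderiv k (f n) else nth_vderiv k (f' n))" for k n
    by simp
  show ?thesis using assms unfolding Diff converges_to_one.simps converges_in_class.simps eq
    by (auto intro!: u)
next
  case Analytic
  show ?thesis unfolding Analytic converges_to_one.simps
  proof (intro allI impI)
    fix T :: real assume T: "0 \<le> T"
    obtain F where F: "\<forall>\<^sub>F n in sequentially. holomorphic_extension (ball 0 (T + 1)) (f n) (F n)"
      "uniform_limit (ball 0 (T + 1)) F (\<lambda>_. mat 1) sequentially" using assms(1) T by (auto simp: Analytic)
    obtain F' where F': "\<forall>\<^sub>F n in sequentially. holomorphic_extension (ball 0 (T + 1)) (f' n) (F' n)"
      "uniform_limit (ball 0 (T + 1)) F' (\<lambda>_. mat 1) sequentially" using assms(2) T by (auto simp: Analytic)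
    show "\<exists>F. (\<forall>\<^sub>F n in sequentially. holomorphic_extension (ball 0 (T + 1)) (if P n then f n else f' n) (F n)) \<and>
      uniform_limit (ball 0 (T + 1)) F (\<lambda>_. mat 1) sequentially"
    proof (intro exI[of _ "\<lambda>n. if P n then F n else F' n"] conjI)
      show "\<forall>\<^sub>F n in sequentially. holomorphic_extension (ball 0 (T + 1)) (if P n then f n else f' n) (if P n then F n else F' n)"
        using F(1) F'(1) by eventually_elim auto
      show "uniform_limit (ball 0 (T + 1)) (\<lambda>n. if P n then F n else F' n) (\<lambda>_. mat 1) sequentially"
        unfolding uniform_limit_iff
      proof (intro allI impI)
        fix e :: real assume "0 < e"
        with F(2) F'(2) have "\<forall>\<^sub>F n in sequentially. \<forall>x\<in>ball 0 (T + 1). dist (F n x) (mat 1) < e"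
          "\<forall>\<^sub>F n in sequentially. \<forall>x\<in>ball 0 (T + 1). dist (F' n x) (mat 1) < e"
          by (auto simp: uniform_limit_iff)
        then show "\<forall>\<^sub>F n in sequentially. \<forall>x\<in>ball 0 (T + 1). dist ((if P n then F n else F' n) x) (mat 1) < e"
          by eventually_elim auto
      qed
    qed
  qed
qed

text \<open>
  The part of the hypotheses on the base point that concerns one sequence of times \<open>m n\<close> and
  scales \<open>\<beta> n\<close>.
\<close>

locale renormalized_orbit =
  fixes \<alpha> :: real and A B :: "real \<Rightarrow> real^2^2" and xs S :: real and m :: "nat \<Rightarrow> nat" and \<beta> :: "nat \<Rightarrow> real"
  assumes SL2: "\<And>x. A x \<in> SL2" and circ: "on_circle A" and BSL2: "\<And>x. B x \<in> SL2"
    and avg: "\<And>n. (\<Sum>k<n. (norm (cocycle_pow \<alpha> A k xs))\<^sup>2) \<le> S * real n"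
    and m\<beta>: "\<And>n. real (m n) * \<bar>\<beta> n\<bar> \<le> 1" and \<beta>0: "\<beta> \<longlonglongrightarrow> 0"
    and good: "\<And>t \<epsilon>. 0 < \<epsilon> \<Longrightarrow> \<forall>\<^sub>F n in sequentially. \<exists>s. \<bar>s - t\<bar> < \<epsilon> \<and>
      rotation_matrix (B (xs + \<beta> n * s + real (m n) * \<alpha>) ** cocycle_pow \<alpha> A (m n) (xs + \<beta> n * s) ** matrix_inv (B (xs + \<beta> n * s))) \<and>
      dist (B (xs + \<beta> n * s)) (B xs) < \<epsilon> \<and> dist (B (xs + \<beta> n * s + real (m n) * \<alpha>)) (B xs) < \<epsilon>"
begin

lemma \<beta>_small: "0 < \<delta> \<Longrightarrow> \<forall>\<^sub>F n in sequentially. \<bar>\<beta> n\<bar> < \<delta>"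
  using tendstoD[OF \<beta>0, of \<delta>] by simp

text \<open>
  The phases depend only on the conjugated tangent products. They are found from the scale with a
  single derivative and then serve the scales with any number of derivatives that the class
  allows.
\<close>

lemma convergence_Diff:
  assumes reg: "times_cont_diff r A" and r: "1 \<le> r"
  shows "\<exists>a b. bounded (range a) \<and> converges_to_one (Diff r)
    (\<lambda>n x. Rot (- (a n * x + b n)) ** B xs ** cocycle_pow \<alpha> A (m n) (xs + \<beta> n * x) ** matrix_inv (B xs))"
proof -
  have regk: "times_cont_diff (enat k) A" if "enat k \<le> r" for k
    using reg that by (simp add: times_cont_diff_iff_finite[of r])
  have r1: "enat (Suc 0) \<le> r" using r by (simp add: one_enat_def)
  define dA where "dA x = vector_derivative A (at x)" for x
  have diff: "A differentiable (at x)" and cd: "continuous_on UNIV dA" for x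
    using regk[OF r1] by (simp_all add: times_cont_diff_Suc times_cont_diff_0 dA_def[abs_def])
  have "continuous_on UNIV A"
    using diff by (intro differentiable_imp_continuous_on) (auto simp: differentiable_on_def)
  then obtain M0 where M0: "\<And>x. norm (A x) \<le> M0" using on_circle_bounded[OF circ] by blast
  have "on_circle dA" using on_circle_vector_derivative[OF circ diff] by (simp add: dA_def[abs_def])
  then obtain M1 where M1: "\<And>x. norm (dA x) \<le> M1" using on_circle_bounded cd by blast
  have BA: "bounded_averages \<alpha> A dA xs S M0 M1" by unfold_locales (rule SL2 M0 M1 avg)+
  define F where "F n k p = A (xs + real k * \<alpha> + \<beta> n * p)" for n k p
  have approx: "\<forall>\<^sub>F n in sequentially. \<forall>k<m n. Ck_le (Suc j) T (\<bar>\<beta> n\<bar> * \<epsilon>)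
      (\<lambda>p. F n k p - cmat (A (xs + real k * \<alpha>)) - mat (of_real (\<beta> n) * p) ** cmat (dA (xs + real k * \<alpha>)))"
    if "enat (Suc j) \<le> r" "0 \<le> T" "0 < \<epsilon>" for j T \<epsilon>
  proof -
    note regj = regk[OF that(1)] and Te = that(2,3)
    obtain \<delta> where \<delta>: "0 < \<delta>" "\<And>\<beta> y. \<bar>\<beta>\<bar> < \<delta> \<Longrightarrow> Ck_le (Suc j) T (\<bar>\<beta>\<bar> * \<epsilon>) (\<lambda>p. A (y + \<beta> * p) - A y - (\<beta> * p) *\<^sub>R dA y)"
      using Ck_le_tangent_approximation[OF regj circ Te] unfolding dA_def by blast
    show ?thesis using \<beta>_small[OF \<delta>(1)]
      by eventually_elim (auto simp: F_def mat_mult_eq_scaleR intro: \<delta>(2))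
  qed
  have close: "\<forall>\<^sub>F n in sequentially. \<forall>t. \<bar>t\<bar> \<le> T \<longrightarrow>
      norm (matrix_inv (cocycle_pow \<alpha> A (m n) xs) ** cocycle_pow \<alpha> A (m n) (xs + \<beta> n * t)
        - tangent_prod \<alpha> A dA xs (\<beta> n) (m n) t) \<le> \<epsilon>" if "0 < \<epsilon>" for T \<epsilon>
  proof -
    interpret matrix_scale "Ck_le (Suc 0) \<bar>T\<bar>" of_real Rot "\<bar>T\<bar>" "2 ^ Suc 0 + 2 * (\<bar>T\<bar> + 1)" 2 "\<bar>T\<bar> + real (Suc 0)"
      by (rule matrix_scale_Ck) simp
    have "\<forall>\<^sub>F n in sequentially. \<forall>t. \<bar>t\<bar> \<le> \<bar>T\<bar> \<longrightarrow>
      norm (matrix_inv (cocycle_pow \<alpha> A (m n) xs) ** cocycle_pow \<alpha> A (m n) (xs + \<beta> n * t)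
        - tangent_prod \<alpha> A dA xs (\<beta> n) (m n) t) \<le> \<epsilon>"
      by (rule exact_tangent_close_on_reals[where F = F, OF BA m\<beta> _ _ that]) (rule approx[OF r1], simp_all add: F_def)
    then show ?thesis by eventually_elim auto
  qed
  obtain a b D where a: "bounded (range a)" and D: "\<And>n. norm (cocycle_pow \<alpha> A (m n) xs) \<le> D"
    and lim: "\<And>R i j. uniform_limit (cball 0 R) (\<lambda>n z. (cRot (- (of_real (a n) * z + of_real (b n))) **
      (cmat (B xs ** cocycle_pow \<alpha> A (m n) xs) ** tangent_prod \<alpha> A dA xs (\<beta> n) (m n) z ** cmat (matrix_inv (B xs)))) $ i $ j)
      (\<lambda>_. mat 1 $ i $ j) sequentially"
    by (rule bounded_averages.phases_exist[OF BA BSL2 m\<beta> good close]) (assumption | rule that)+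
  let ?f = "\<lambda>n x. Rot (- (a n * x + b n)) ** B xs ** cocycle_pow \<alpha> A (m n) (xs + \<beta> n * x) ** matrix_inv (B xs)"
  have "converges_in_class (Diff r) ?f (\<lambda>_. mat 1)"
  proof (rule converges_in_Diff_from_Ck)
    fix n k assume k: "enat k \<le> r"
    obtain c where c: "Ck_le k 0 c (\<lambda>p. cocycle_pow \<alpha> A (m n) (xs + \<beta> n * p))"
      using Ck_cocycle_pow_affine[OF regk[OF k] circ order_refl, of \<alpha> "m n" xs "\<beta> n"] by blast
    have "Ck_le k 0 (2 * exp (2 * pi * (\<bar>a n\<bar> * (0 + real k)))) (\<lambda>x. Rot (- (a n * x + b n)))"
    proof (rule Ck_le_restrict_entire[where F = "\<lambda>z. cRot (- (of_real (a n) * z + of_real (b n)))"])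
      show "(\<lambda>z. cRot (- (of_real (a n) * z + of_real (b n))) $ i $ j) holomorphic_on UNIV" for i j
        by (intro holomorphic_cRot holomorphic_intros)
      show "cRot (- (of_real (a n) * of_real t + of_real (b n))) $ i $ j = of_real (Rot (- (a n * t + b n)) $ i $ j)" for t i j
        by (subst cRot_of_real[symmetric]) simp
      show "norm (cRot (- (of_real (a n) * z + of_real (b n))) $ i $ j) \<le> exp (2 * pi * (\<bar>a n\<bar> * (0 + real k)))" if "norm z \<le> 0 + real k" for z i j
      proof -
        have "\<bar>a n * Im z\<bar> \<le> \<bar>a n\<bar> * (0 + real k)"
          unfolding abs_mult using abs_Im_le_cmod[of z] that by (intro mult_left_mono) auto
        then have "exp (2 * pi * \<bar>Im (- (of_real (a n) * z + of_real (b n)))\<bar>) \<le> exp (2 * pi * (\<bar>a n\<bar> * (0 + real k)))"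
          by simp
        with norm_cRot_entry_le show ?thesis by (rule order_trans)
      qed
    qed simp
    note R = this
    have "\<exists>c. Ck_le k 0 c (?f n)"
      using Ck_le_matrix_mult[OF order_refl Ck_le_matrix_mult[OF order_refl Ck_le_matrix_mult[OF order_refl R Ck_le_const[where M = "B xs", OF order_refl]] c] Ck_le_const[where M = "matrix_inv (B xs)", OF order_refl]]
      by blast
    then show "times_cont_diff (enat k) (?f n)" by (auto simp: Ck_le_def)
  next
    fix k T \<epsilon> assume k: "enat k \<le> r" and T: "(0::real) \<le> T" and \<epsilon>: "(0::real) < \<epsilon>"
    \<comment> \<open>The tangent approximation requires at least one derivative.\<close>
    obtain j where j: "k \<le> Suc j" "enat (Suc j) \<le> r" using k r1 by (cases k) auto
    interpret matrix_scale "Ck_le (Suc j) T" of_real Rot T "2 ^ Suc j + 2 * (T + 1)" 2 "T + real (Suc j)"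
      by (rule matrix_scale_Ck[OF T])
    have close': "\<forall>\<^sub>F n in sequentially. Ck_le (Suc j) T \<epsilon> (\<lambda>p. exact_prod \<alpha> A xs (F n) (m n) p
      - tangent_prod \<alpha> A dA xs (\<beta> n) (m n) p)" if "0 < \<epsilon>" for \<epsilon>
      by (rule near_prod_exact_tangent[OF BA m\<beta> _ that]) (rule approx[OF j(2) T])
    have lp: "local_prod (F n) (m n) p = cocycle_pow \<alpha> A (m n) (xs + \<beta> n * p)" for n p
      using local_prod_of_real[of "m n" "F n" p A "xs + \<beta> n * p" \<alpha>] by (simp add: F_def add_ac)
    have "\<forall>\<^sub>F n in sequentially. Ck_le (Suc j) T \<epsilon> (\<lambda>p. Rot (- (of_real (a n) * p + of_real (b n))) ** cmat (B xs) **
      local_prod (F n) (m n) p ** cmat (matrix_inv (B xs)) - mat 1)"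
      by (rule renormalized_convergence[OF SL2 _ a D lim \<epsilon>]) (rule close')
    then show "\<forall>\<^sub>F n in sequentially. Ck_le k T \<epsilon> (\<lambda>t. ?f n t - mat 1)"
    proof eventually_elim
      case (elim n)
      then have "Ck_le (Suc j) T \<epsilon> (\<lambda>t. ?f n t - mat 1)" by (simp add: lp)
      then show ?case using j(1) by (auto simp: Ck_le_def times_cont_diff_def intro: order_trans less_le_trans)
    qed
  qed
  with a show ?thesis by auto
qed

text \<open>
  Each factor of an iterate is extended around its own point of the orbit; since \<open>\<beta> n\<close> tends to 0,
  the extensions eventually cover any given disc.
\<close>

lemma convergence_Analytic:
  assumes reg: "real_analytic A"
  shows "\<exists>a b. bounded (range a) \<and> converges_to_one Analytic
    (\<lambda>n x. Rot (- (a n * x + b n)) ** B xs ** cocycle_pow \<alpha> A (m n) (xs + \<beta> n * x) ** matrix_inv (B xs))"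
proof -
  obtain \<rho> M G where \<rho>: "0 < \<rho>" and G: "\<And>y i j. (\<lambda>z. (G y z :: complex^2^2) $ i $ j) holomorphic_on ball 0 \<rho>"
    "\<And>y z i j. norm z < \<rho> \<Longrightarrow> norm (G y z $ i $ j) \<le> M" "\<And>y h. \<bar>h\<bar> < \<rho> \<Longrightarrow> G y (of_real h) = cmat (A (y + h))"
    by (rule real_analytic_uniform_extension[OF reg circ]) (rule that)
  define dA where "dA y = (\<chi> i j. Re (deriv (\<lambda>z. G y z $ i $ j) 0))" for y
  have M0: "0 \<le> M" using order_trans[OF norm_ge_zero G(2)[of 0 0 1 1]] \<rho> by simp
  have G0: "G y 0 = cmat (A y)" for y using G(3)[of 0 y] \<rho> by simp
  have deriv: "deriv (\<lambda>z. G y z $ i $ j) 0 = of_real (dA y $ i $ j)" for y i j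
  proof -
    have "deriv (\<lambda>z. G y z $ i $ j) 0 \<in> \<real>"
      by (rule deriv_real_on_reals[OF G(1) \<rho>]) (simp add: G(3))
    then show ?thesis by (simp add: dA_def complex_is_Real_iff complex_eq_iff)
  qed
  have nA: "norm (A y) \<le> 2 * M" for y
    using G(2)[of 0 y] \<rho> by (intro norm_matrix2_le) (simp add: G0)
  have ndA: "norm (dA y) \<le> 2 * (4 * M / \<rho>)" for y
  proof (rule norm_matrix2_le)
    fix i j
    have "norm (deriv (\<lambda>z. G y z $ i $ j) 0) \<le> 4 * M / \<rho>"
      by (rule holomorphic_linear_approximation(2)[OF G(1) \<rho> G(2), where z = 0]) (use \<rho> in simp_all)
    then show "norm (dA y $ i $ j) \<le> 4 * M / \<rho>" by (simp add: deriv)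
  qed
  have BA: "bounded_averages \<alpha> A dA xs S (2 * M) (2 * (4 * M / \<rho>))" by unfold_locales (rule SL2 nA ndA avg)+
  define F where "F n k p = G (xs + real k * \<alpha>) (of_real (\<beta> n) * p)" for n k p
  have small: "\<forall>\<^sub>F n in sequentially. \<bar>\<beta> n\<bar> * (T + 1) < \<rho>" if "0 \<le> T" for T
    using \<beta>_small[of "\<rho> / (T + 1)"] \<rho> that by (simp add: field_simps)
  have F_real: "\<forall>\<^sub>F n in sequentially. \<forall>k t. \<bar>t\<bar> < T + 1 \<longrightarrow> F n k (of_real t) = cmat (A (xs + real k * \<alpha> + \<beta> n * t))"
    if "0 \<le> T" for T
    using small[OF that]
  proof eventually_elim
    case (elim n)
    show ?case
    proof (intro allI impI)
      fix k t assume "\<bar>t\<bar> < T + 1"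
      then have "\<bar>\<beta> n * t\<bar> \<le> \<bar>\<beta> n\<bar> * (T + 1)" unfolding abs_mult by (intro mult_left_mono) auto
      then have "\<bar>\<beta> n * t\<bar> < \<rho>" using elim by simp
      from G(3)[OF this] show "F n k (of_real t) = cmat (A (xs + real k * \<alpha> + \<beta> n * t))" by (simp add: F_def)
    qed
  qed
  have approx: "\<forall>\<^sub>F n in sequentially. \<forall>k<m n. holomorphic_le T (\<bar>\<beta> n\<bar> * \<epsilon>)
      (\<lambda>p. F n k p - cmat (A (xs + real k * \<alpha>)) - mat (of_real (\<beta> n) * p) ** cmat (dA (xs + real k * \<alpha>)))"
    if T: "0 \<le> T" and \<epsilon>: "0 < \<epsilon>" for T \<epsilon>
  proof -
    define L where "L = 2 * (32 * M / \<rho>\<^sup>2 * (T + 1)\<^sup>2)"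
    have L0: "0 \<le> L" using M0 by (simp add: L_def)
    have "\<forall>\<^sub>F n in sequentially. \<bar>\<beta> n\<bar> < \<rho> / (2 * (T + 1))" by (rule \<beta>_small) (use \<rho> T in simp)
    moreover have "\<forall>\<^sub>F n in sequentially. \<bar>\<beta> n\<bar> < \<epsilon> / (L + 1)" by (rule \<beta>_small) (use \<epsilon> L0 in simp)
    ultimately show ?thesis
    proof eventually_elim
      case (elim n)
      have e1: "\<bar>\<beta> n\<bar> * (T + 1) < \<rho> / 2" using elim(1) T by (simp add: field_simps)
      have e2: "L * \<bar>\<beta> n\<bar> \<le> \<epsilon>"
      proof -
        have "L * \<bar>\<beta> n\<bar> \<le> (L + 1) * \<bar>\<beta> n\<bar>" by (intro mult_right_mono) auto
        also have "\<dots> \<le> \<epsilon>" using elim(2) L0 by (simp add: field_simps)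
        finally show ?thesis .
      qed
      show ?case unfolding holomorphic_le_def
      proof (intro allI impI conjI)
        fix k i j assume "k < m n"
        let ?y = "xs + real k * \<alpha>"
        have "((\<lambda>z. G ?y z $ i $ j) \<circ> (\<lambda>p. of_real (\<beta> n) * p)) holomorphic_on ball 0 (T + 1)"
        proof (rule holomorphic_on_compose_gen[OF _ G(1)])
          show "(*) (complex_of_real (\<beta> n)) ` ball 0 (T + 1) \<subseteq> ball 0 \<rho>"
          proof clarsimp
            fix z :: complex assume "norm z < T + 1"
            then have "\<bar>\<beta> n\<bar> * norm z \<le> \<bar>\<beta> n\<bar> * (T + 1)" by (intro mult_left_mono) auto
            then show "norm (complex_of_real (\<beta> n) * z) < \<rho>" using e1 \<rho> by (simp add: norm_mult)
          qed
        qed (intro holomorphic_intros)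
        then have "(\<lambda>p. F n k p $ i $ j) holomorphic_on ball 0 (T + 1)" by (simp add: comp_def F_def)
        moreover have "(\<lambda>p. (mat (of_real (\<beta> n) * p) ** (cmat (dA ?y) :: complex^2^2)) $ i $ j) holomorphic_on ball 0 (T + 1)"
          by (intro holomorphic_matrix_mult holomorphic_mat holomorphic_intros)
        ultimately show "(\<lambda>p. (F n k p - cmat (A ?y) - mat (of_real (\<beta> n) * p) ** cmat (dA ?y)) $ i $ j) holomorphic_on ball 0 (T + 1)"
          by (simp only: vector_minus_component) (intro holomorphic_intros)
      next
        fix k and z :: complex assume "k < m n" and z: "norm z < T + 1"
        let ?y = "xs + real k * \<alpha>" and ?w = "of_real (\<beta> n) * z"
        have nw: "norm ?w \<le> \<bar>\<beta> n\<bar> * (T + 1)" using z by (auto simp: norm_mult intro: mult_left_mono)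
        have "norm (F n k z - cmat (A ?y) - mat ?w ** cmat (dA ?y)) \<le> 2 * (32 * M / \<rho>\<^sup>2 * (\<bar>\<beta> n\<bar> * (T + 1))\<^sup>2)"
        proof (rule norm_matrix2_le)
          fix i j
          have "(F n k z - cmat (A ?y) - mat ?w ** cmat (dA ?y)) $ i $ j = G ?y ?w $ i $ j - G ?y 0 $ i $ j - ?w * deriv (\<lambda>z. G ?y z $ i $ j) 0"
          proof -
            have "(mat ?w ** (cmat (dA ?y) :: complex^2^2)) $ i $ j = ?w * of_real (dA ?y $ i $ j)"
              using exhaust_2[of i] by (auto simp: matrix_matrix_mult_def mat_def sum_2)
            then show ?thesis by (simp add: F_def G0 deriv)
          qed
          also have "norm \<dots> \<le> 32 * M / \<rho>\<^sup>2 * (norm ?w)\<^sup>2"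
            by (rule holomorphic_linear_approximation(1)[OF G(1) \<rho> G(2)]) (use nw e1 in linarith)+
          also have "\<dots> \<le> 32 * M / \<rho>\<^sup>2 * (\<bar>\<beta> n\<bar> * (T + 1))\<^sup>2"
            using M0 nw by (intro mult_left_mono power_mono) auto
          finally show "norm ((F n k z - cmat (A ?y) - mat ?w ** cmat (dA ?y)) $ i $ j) \<le> 32 * M / \<rho>\<^sup>2 * (\<bar>\<beta> n\<bar> * (T + 1))\<^sup>2" .
        qed
        also have "\<dots> = \<bar>\<beta> n\<bar> * (L * \<bar>\<beta> n\<bar>)" by (simp add: L_def power_mult_distrib power2_eq_square)
        also have "\<dots> \<le> \<bar>\<beta> n\<bar> * \<epsilon>" using e2 by (intro mult_left_mono) auto
        finally show "norm (F n k z - cmat (A ?y) - mat ?w ** cmat (dA ?y)) \<le> \<bar>\<beta> n\<bar> * \<epsilon>" .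
      qed
    qed
  qed
  have close: "\<forall>\<^sub>F n in sequentially. \<forall>t. \<bar>t\<bar> \<le> T \<longrightarrow>
      norm (matrix_inv (cocycle_pow \<alpha> A (m n) xs) ** cocycle_pow \<alpha> A (m n) (xs + \<beta> n * t)
        - tangent_prod \<alpha> A dA xs (\<beta> n) (m n) t) \<le> \<epsilon>" if "0 < \<epsilon>" for T \<epsilon>
  proof -
    interpret matrix_scale "holomorphic_le \<bar>T\<bar>" "\<lambda>z. z" cRot "\<bar>T\<bar>" "2 * (\<bar>T\<bar> + 1)" 2 "\<bar>T\<bar> + 1"
      by (rule matrix_scale_holomorphic) simp
    have "\<forall>\<^sub>F n in sequentially. \<forall>k t. \<bar>t\<bar> \<le> \<bar>T\<bar> \<longrightarrow> F n k (of_real t) = cmat (A (xs + real k * \<alpha> + \<beta> n * t))"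
      using F_real[of "\<bar>T\<bar>", simplified] by eventually_elim auto
    then have "\<forall>\<^sub>F n in sequentially. \<forall>t. \<bar>t\<bar> \<le> \<bar>T\<bar> \<longrightarrow>
      norm (matrix_inv (cocycle_pow \<alpha> A (m n) xs) ** cocycle_pow \<alpha> A (m n) (xs + \<beta> n * t)
        - tangent_prod \<alpha> A dA xs (\<beta> n) (m n) t) \<le> \<epsilon>"
      by (rule exact_tangent_close_on_reals[where F = F, OF BA m\<beta> approx _ that, rotated -1]) simp_all
    then show ?thesis by eventually_elim auto
  qed
  obtain a b D where a: "bounded (range a)" and D: "\<And>n. norm (cocycle_pow \<alpha> A (m n) xs) \<le> D"
    and lim: "\<And>R i j. uniform_limit (cball 0 R) (\<lambda>n z. (cRot (- (of_real (a n) * z + of_real (b n))) **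
      (cmat (B xs ** cocycle_pow \<alpha> A (m n) xs) ** tangent_prod \<alpha> A dA xs (\<beta> n) (m n) z ** cmat (matrix_inv (B xs)))) $ i $ j)
      (\<lambda>_. mat 1 $ i $ j) sequentially"
    by (rule bounded_averages.phases_exist[OF BA BSL2 m\<beta> good close]) (assumption | rule that)+
  let ?f = "\<lambda>n x. Rot (- (a n * x + b n)) ** B xs ** cocycle_pow \<alpha> A (m n) (xs + \<beta> n * x) ** matrix_inv (B xs)"
  let ?F = "\<lambda>n p. cRot (- (of_real (a n) * p + of_real (b n))) ** cmat (B xs) ** local_prod (F n) (m n) p ** cmat (matrix_inv (B xs))"
  have "converges_to_one Analytic ?f"
    unfolding converges_to_one.simps
  proof (intro allI impI exI[of _ ?F] conjI)
    fix T :: real assume T: "0 \<le> T"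
    interpret matrix_scale "holomorphic_le T" "\<lambda>z. z" cRot T "2 * (T + 1)" 2 "T + 1"
      by (rule matrix_scale_holomorphic[OF T])
    have close': "\<forall>\<^sub>F n in sequentially. holomorphic_le T \<epsilon> (\<lambda>p. exact_prod \<alpha> A xs (F n) (m n) p
      - tangent_prod \<alpha> A dA xs (\<beta> n) (m n) p)" if "0 < \<epsilon>" for \<epsilon>
      by (rule near_prod_exact_tangent[OF BA m\<beta> _ that]) (rule approx[OF T])
    have conv: "\<forall>\<^sub>F n in sequentially. holomorphic_le T \<epsilon> (\<lambda>p. ?F n p - mat 1)" if "0 < \<epsilon>" for \<epsilon>
      by (rule renormalized_convergence[OF SL2 _ a D lim that]) (rule close')
    show "\<forall>\<^sub>F n in sequentially. holomorphic_extension (ball 0 (T + 1)) (?f n) (?F n)"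
      using conv[OF zero_less_one] F_real[OF T]
    proof eventually_elim
      case (elim n)
      have "(\<lambda>z. (?F n z - mat 1) $ i $ j + mat 1 $ i $ j) holomorphic_on ball 0 (T + 1)" for i j
        using elim(1) by (intro holomorphic_intros) (simp add: holomorphic_le_def)
      then have "(\<lambda>z. ?F n z $ i $ j) holomorphic_on ball 0 (T + 1)" for i j by simp
      moreover have "?F n (of_real x) $ i $ j = of_real (?f n x $ i $ j)" if "of_real x \<in> ball (0::complex) (T + 1)" for x i j
      proof -
        have "local_prod (F n) (m n) (of_real x) = cmat (cocycle_pow \<alpha> A (m n) (xs + \<beta> n * x))"
          using elim(2) that by (intro local_prod_of_real) (simp add: add_ac)
        moreover have "cRot (- (of_real (a n) * of_real x + of_real (b n))) = cmat (Rot (- (a n * x + b n)))"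
          using cRot_of_real[of "- (a n * x + b n)"] by (simp add: vec_eq_iff)
        ultimately have "?F n (of_real x) = cmat (?f n x)" by (simp only: cmat_mult)
        then show ?thesis by simp
      qed
      ultimately show ?case by (simp add: holomorphic_extension_def)
    qed
    show "uniform_limit (ball 0 (T + 1)) ?F (\<lambda>_. mat 1) sequentially"
      unfolding uniform_limit_iff
    proof (intro allI impI)
      fix e :: real assume e: "0 < e"
      from conv[of "e / 2"] e have "\<forall>\<^sub>F n in sequentially. holomorphic_le T (e / 2) (\<lambda>p. ?F n p - mat 1)" by simp
      then show "\<forall>\<^sub>F n in sequentially. \<forall>x\<in>ball 0 (T + 1). dist (?F n x) (mat 1) < e"
      proof eventually_elim
        case (elim n)
        then show ?case using e by (fastforce simp: holomorphic_le_def dist_norm)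
      qed
    qed
  qed
  with a show ?thesis by auto
qed

end

section \<open>Forward and backward iterates\<close>

lemma AE_lebesgue_shift:
  assumes "AE x::real in lebesgue. P x" shows "AE x in lebesgue. P (x + a)"
proof -
  obtain N where N: "N \<in> null_sets lebesgue" "{x. \<not> P x} \<subseteq> N"
    using assms by (auto simp: eventually_ae_filter)
  have "(+) (- a) ` N \<in> null_sets lebesgue"
    using negligible_translation[of N "- a"] N(1) by (simp only: negligible_iff_null_sets)
  moreover have "{x. \<not> P (x + a)} \<subseteq> (+) (- a) ` N"
  proof
    fix x assume "x \<in> {x. \<not> P (x + a)}"
    then have "x + a \<in> N" using N(2) by auto
    then have "(+) (- a) (x + a) \<in> (+) (- a) ` N" by (rule imageI)
    then show "x \<in> (+) (- a) ` N" by simp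
  qed
  ultimately show ?thesis by (intro AE_I'[of "(+) (- a) ` N"]) auto
qed

definition adj2 :: "real^2^2 \<Rightarrow> real^2^2" where
  "adj2 M = vector [vector [M $ 2 $ 2, - M $ 1 $ 2], vector [- M $ 2 $ 1, M $ 1 $ 1]]"

lemma matrix_inv_eq_adj2: "M \<in> SL2 \<Longrightarrow> matrix_inv M = adj2 M"
  by (simp add: vec_eq_iff forall_2 SL2_matrix_inv_entries adj2_def)

lemma bounded_linear_adj2: "bounded_linear adj2"
  unfolding linear_conv_bounded_linear[symmetric]
  by (rule linearI) (simp_all add: adj2_def vec_eq_iff forall_2)

lemma of_class_linear_shift:
  fixes f :: "real \<Rightarrow> 'a::real_normed_vector" and h :: "'a \<Rightarrow> 'b::real_normed_vector"
  assumes h: "bounded_linear h" and f: "of_class r f" "on_circle f"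
  shows "of_class r (\<lambda>x. h (f (x + a)))"
proof (cases r)
  case (Diff d)
  have "times_cont_diff (enat k) (\<lambda>x. h (f (x + a)))" if "enat k \<le> d" for k
  proof -
    have "times_cont_diff (enat k) f" using f(1) that times_cont_diff_iff_finite[of d f] by (simp add: Diff)
    then obtain c where "\<And>\<beta> y. \<bar>\<beta>\<bar> \<le> 1 \<Longrightarrow> Ck_le k 0 c (\<lambda>p. f (y + \<beta> * p))"
      using Ck_le_affine_uniform[OF _ f(2) zero_le_one, of k 0] by blast
    from this[of 1 a] have c: "Ck_le k 0 c (\<lambda>p. f (p + a))" by (simp add: add.commute)
    obtain K where K: "\<And>x. norm (h x) \<le> K * norm x" "0 \<le> K"
      using bounded_linear.nonneg_bounded[OF h] by (metis mult.commute)
    from Ck_le_linear[OF h K c] show ?thesis by (simp add: Ck_le_def)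
  qed
  then show ?thesis using times_cont_diff_iff_finite by (auto simp: Diff)
next
  case Analytic
  show ?thesis unfolding Analytic of_class.simps real_analytic_def
  proof
    fix x
    obtain \<delta> c where \<delta>: "0 < \<delta>" and c: "\<And>y. \<bar>y - (x + a)\<bar> < \<delta> \<Longrightarrow> (\<lambda>m. (y - (x + a)) ^ m *\<^sub>R c m) sums f y"
      using f(1) unfolding Analytic of_class.simps real_analytic_def by meson
    show "\<exists>\<delta>>0. \<exists>c. \<forall>y. \<bar>y - x\<bar> < \<delta> \<longrightarrow> (\<lambda>m. (y - x) ^ m *\<^sub>R c m) sums h (f (y + a))"
    proof (intro exI[of _ \<delta>] conjI exI[of _ "\<lambda>m. h (c m)"] allI impI)
      fix y assume "\<bar>y - x\<bar> < \<delta>"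
      then have "(\<lambda>m. ((y + a) - (x + a)) ^ m *\<^sub>R c m) sums f (y + a)" by (intro c) simp
      from bounded_linear.sums[OF h this] show "(\<lambda>m. (y - x) ^ m *\<^sub>R h (c m)) sums h (f (y + a))"
        by (simp add: linear_simps[OF h] linear_scale[OF bounded_linear.linear[OF h]])
    qed (rule \<delta>)
  qed
qed

lemma cocycle_pow_Suc_right: "cocycle_pow \<alpha> A (Suc m) x = cocycle_pow \<alpha> A m (x + \<alpha>) ** A x"
proof (induction m)
  case (Suc m)
  have "cocycle_pow \<alpha> A (Suc (Suc m)) x = A (x + real (Suc m) * \<alpha>) ** cocycle_pow \<alpha> A (Suc m) x"
    by (rule cocycle_pow.simps(2))
  also have "\<dots> = A (x + real (Suc m) * \<alpha>) ** (cocycle_pow \<alpha> A m (x + \<alpha>) ** A x)" by (simp only: Suc)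
  also have "x + real (Suc m) * \<alpha> = (x + \<alpha>) + real m * \<alpha>" by (simp add: algebra_simps)
  finally show ?case by (simp add: matrix_mul_assoc)
qed simp

text \<open>
  Its iterates over the rotation by \<open>- \<alpha>\<close> are the negative iterates of \<open>A\<close>, and \<open>B\<close> conjugates it
  to rotations too.
\<close>

definition inverse_cocycle :: "real \<Rightarrow> (real \<Rightarrow> real^2^2) \<Rightarrow> real \<Rightarrow> real^2^2" where
  "inverse_cocycle \<alpha> A x = matrix_inv (A (x - \<alpha>))"

lemma cocycle_pow_inverse_cocycle:
  assumes "\<And>x. A x \<in> SL2"
  shows "cocycle_pow (- \<alpha>) (inverse_cocycle \<alpha> A) m x = matrix_inv (cocycle_pow \<alpha> A m (x - real m * \<alpha>))"
proof (induction m)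
  case 0
  have "matrix_inv (mat 1 :: real^2^2) = mat 1" using SL2_inverse(1)[OF SL2_one] by simp
  then show ?case by simp
next
  case (Suc m)
  let ?y = "x - real (Suc m) * \<alpha>"
  have "cocycle_pow (- \<alpha>) (inverse_cocycle \<alpha> A) (Suc m) x = matrix_inv (A ?y) ** matrix_inv (cocycle_pow \<alpha> A m (?y + \<alpha>))"
    by (simp only: cocycle_pow.simps Suc) (simp add: inverse_cocycle_def algebra_simps)
  also have "\<dots> = matrix_inv (cocycle_pow \<alpha> A m (?y + \<alpha>) ** A ?y)"
    by (rule SL2_inv_mult[symmetric]) (intro cocycle_pow_SL2 assms)+
  finally show ?case by (simp only: cocycle_pow_Suc_right)
qed

lemma cocycle_iter_cases:
  assumes "\<And>x. A x \<in> SL2"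
  shows "cocycle_iter \<alpha> A (int m) x = cocycle_pow \<alpha> A m x"
    and "cocycle_iter \<alpha> A (- int m) x = cocycle_pow (- \<alpha>) (inverse_cocycle \<alpha> A) m x"
proof -
  show "cocycle_iter \<alpha> A (int m) x = cocycle_pow \<alpha> A m x" by (simp add: cocycle_iter_def)
  have "matrix_inv (mat 1 :: real^2^2) = mat 1" using SL2_inverse(1)[OF SL2_one] by simp
  then show "cocycle_iter \<alpha> A (- int m) x = cocycle_pow (- \<alpha>) (inverse_cocycle \<alpha> A) m x"
    unfolding cocycle_pow_inverse_cocycle[OF assms] by (cases "m = 0") (auto simp: cocycle_iter_def)
qed

lemma rotation_matrix_inverse:
  assumes "rotation_matrix (M :: real^2^2)" shows "rotation_matrix (matrix_inv M)"
proof -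
  have M: "M \<in> SL2" "transpose M ** M = mat 1" using assms by (auto simp: SL2_def rotation_matrix_def orthogonal_matrix_def)
  have "transpose M ** (M ** matrix_inv M) = matrix_inv M" unfolding matrix_mul_assoc M(2) by simp
  then have "matrix_inv M = transpose M" by (simp add: SL2_inverse[OF M(1)])
  then show ?thesis using assms by (simp add: rotation_matrix_def det_transpose)
qed

text \<open>
  The exceptional set is fixed before the times and scales are chosen, so that the same base
  points and the same matrix \<open>B xs\<close> serve all sequences of times; a second application to the
  inverse cocycle shares \<open>B\<close> as well.
\<close>

theorem AE_renormalization_converges:
  fixes \<alpha> :: real and A B :: "real \<Rightarrow> real^2^2"
  assumes SL2: "\<And>x. A x \<in> SL2" and circ: "on_circle A" and reg: "of_class r A" and r: "\<forall>k. r = Diff k \<longrightarrow> 1 \<le> k"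
    and B: "on_circle B" "\<And>x. B x \<in> SL2" "B \<in> borel_measurable lebesgue"
    and int: "integrable (lebesgue_on {0..1}) (\<lambda>x. (norm (B x))\<^sup>2)"
    and conj: "AE x in lebesgue. rotation_matrix (B (x + \<alpha>) ** A x ** matrix_inv (B x))"
  shows "AE xs in lebesgue. \<forall>m \<beta>. \<beta> \<longlonglongrightarrow> 0 \<and> (\<forall>n. \<beta> n \<noteq> 0 \<and> real (m n) * \<bar>\<beta> n\<bar> \<le> 1 \<and>
      (\<exists>p::int. \<bar>real (m n) * \<alpha> - of_int p\<bar> \<le> \<bar>\<beta> n\<bar>)) \<longrightarrow>
    (\<exists>a b. bounded (range a) \<and> converges_to_one r
      (\<lambda>n x. Rot (- (a n * x + b n)) ** B xs ** cocycle_pow \<alpha> A (m n) (xs + \<beta> n * x) ** matrix_inv (B xs)))"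
proof -
  have "AE x in lebesgue. \<forall>k::nat. rotation_matrix (B (x + real k * \<alpha> + \<alpha>) ** A (x + real k * \<alpha>) ** matrix_inv (B (x + real k * \<alpha>)))"
    unfolding AE_all_countable by (intro allI AE_lebesgue_shift[OF conj])
  then have rot: "AE x in lebesgue. \<forall>j. rotation_matrix (B (x + real j * \<alpha>) ** cocycle_pow \<alpha> A j x ** matrix_inv (B x))"
    by eventually_elim (intro allI rotation_matrix_cocycle_pow B, blast)
  have sq: "(\<lambda>x. (norm (B x))\<^sup>2) \<in> borel_measurable lebesgue" using B(3) by measurable
  have sqc: "on_circle (\<lambda>x. (norm (B x))\<^sup>2)" using B(1) by (simp add: on_circle_def)
  have avg: "AE x in lebesgue. \<exists>S. \<forall>n. (\<Sum>k<n. (norm (B (x + real k * \<alpha>)))\<^sup>2) \<le> S * real n"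
    by (rule AE_bounded_averages[OF sq sqc _ int]) simp
  show ?thesis using rot avg AE_approx_continuous[OF B(3)]
  proof eventually_elim
    case (elim xs)
    obtain S where S: "\<And>n. (\<Sum>k<n. (norm (B (xs + real k * \<alpha>)))\<^sup>2) \<le> S * real n" using elim(2) by blast
    have pow: "(norm (cocycle_pow \<alpha> A k xs))\<^sup>2 \<le> 2 * (norm (B xs))\<^sup>2 * (norm (B (xs + real k * \<alpha>)))\<^sup>2" for k
    proof -
      let ?B = "B (xs + real k * \<alpha>)"
      let ?R = "?B ** cocycle_pow \<alpha> A k xs ** matrix_inv (B xs)"
      have R: "rotation_matrix ?R" using elim(1) by blast
      have "matrix_inv ?B ** ?R ** B xs = (matrix_inv ?B ** ?B) ** cocycle_pow \<alpha> A k xs ** (matrix_inv (B xs) ** B xs)"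
        by (simp only: matrix_mul_assoc)
      then have eq: "cocycle_pow \<alpha> A k xs = matrix_inv ?B ** ?R ** B xs" by (simp add: SL2_inverse[OF B(2)])
      have "norm (matrix_inv ?B ** ?R ** B xs) \<le> norm (matrix_inv ?B) * norm ?R * norm (B xs)"
        by (rule order_trans[OF norm_matrix_mult_le mult_right_mono[OF norm_matrix_mult_le norm_ge_zero]])
      also have "\<dots> = norm ?B * sqrt 2 * norm (B xs)"
        by (simp only: norm_SL2_inv[OF B(2)] norm_rotation_matrix_2[OF R])
      finally have "norm (cocycle_pow \<alpha> A k xs) \<le> norm ?B * sqrt 2 * norm (B xs)" by (simp only: eq[symmetric])
      then have "(norm (cocycle_pow \<alpha> A k xs))\<^sup>2 \<le> (norm ?B * sqrt 2 * norm (B xs))\<^sup>2" by (intro power_mono) auto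
      then show ?thesis by (simp add: power_mult_distrib mult_ac)
    qed
    have avgA: "(\<Sum>k<n. (norm (cocycle_pow \<alpha> A k xs))\<^sup>2) \<le> (2 * (norm (B xs))\<^sup>2 * S) * real n" for n
    proof -
      have "(\<Sum>k<n. (norm (cocycle_pow \<alpha> A k xs))\<^sup>2) \<le> (\<Sum>k<n. 2 * (norm (B xs))\<^sup>2 * (norm (B (xs + real k * \<alpha>)))\<^sup>2)"
        by (intro sum_mono pow)
      also have "\<dots> = 2 * (norm (B xs))\<^sup>2 * (\<Sum>k<n. (norm (B (xs + real k * \<alpha>)))\<^sup>2)" by (simp add: sum_distrib_left)
      also have "\<dots> \<le> 2 * (norm (B xs))\<^sup>2 * (S * real n)" by (intro mult_left_mono S) simp
      finally show ?thesis by (simp add: mult_ac)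
    qed
    show ?case
    proof (intro allI impI, elim conjE)
      fix m :: "nat \<Rightarrow> nat" and \<beta> :: "nat \<Rightarrow> real"
      assume \<beta>: "\<beta> \<longlonglongrightarrow> 0" and m: "\<forall>n. \<beta> n \<noteq> 0 \<and> real (m n) * \<bar>\<beta> n\<bar> \<le> 1 \<and> (\<exists>p::int. \<bar>real (m n) * \<alpha> - of_int p\<bar> \<le> \<bar>\<beta> n\<bar>)"
      then obtain p :: "nat \<Rightarrow> int" where p: "\<And>n. \<bar>real (m n) * \<alpha> - of_int (p n)\<bar> \<le> \<bar>\<beta> n\<bar>" by metis
      have per: "B (x + (real (m n) * \<alpha> - of_int (p n))) = B (x + real (m n) * \<alpha>)" for x n
        using periodic_int[OF B(1), of "x + real (m n) * \<alpha>" "- p n"] by (simp add: algebra_simps)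
      have near: "\<forall>\<^sub>F n in sequentially. \<exists>s. \<bar>s - t\<bar> < \<epsilon> \<and>
          rotation_matrix (B (xs + \<beta> n * s + real (m n) * \<alpha>) ** cocycle_pow \<alpha> A (m n) (xs + \<beta> n * s) ** matrix_inv (B (xs + \<beta> n * s))) \<and>
          dist (B (xs + \<beta> n * s)) (B xs) < \<epsilon> \<and> dist (B (xs + \<beta> n * s + real (m n) * \<alpha>)) (B xs) < \<epsilon>" if "0 < \<epsilon>" for t \<epsilon>
        using nearby_good_points[OF B(3) elim(3) rot \<beta> _ p that, of t] m
        unfolding per by (auto elim!: eventually_mono)
      interpret renormalized_orbit \<alpha> A B xs "2 * (norm (B xs))\<^sup>2 * S" m \<beta>
        by unfold_locales (use SL2 circ B avgA m \<beta> near in \<open>blast+\<close>)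
      show "\<exists>a b. bounded (range a) \<and> converges_to_one r
        (\<lambda>n x. Rot (- (a n * x + b n)) ** B xs ** cocycle_pow \<alpha> A (m n) (xs + \<beta> n * x) ** matrix_inv (B xs))"
      proof (cases r)
        case (Diff d)
        show ?thesis unfolding Diff by (rule convergence_Diff) (use reg r in \<open>simp_all add: Diff\<close>)
      next
        case Analytic
        show ?thesis unfolding Analytic by (rule convergence_Analytic) (use reg in \<open>simp add: Analytic\<close>)
      qed
    qed
  qed
qed

theorem theorem4p4:
  fixes \<alpha> :: real and r :: regularity and A :: "real \<Rightarrow> real^2^2"
  assumes "0 < \<alpha>" and "\<alpha> < 1" and "\<alpha> \<notin> \<rat>"
    and "\<And>k. r = Diff k \<Longrightarrow> 1 \<le> k"
    and "on_circle A" and "\<And>x. A x \<in> SL2" and "of_class r A"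
    and "L2_conj_rotations \<alpha> A"
  shows "AE xs in lebesgue. \<exists>B \<in> SL2. \<exists>a0 b0 a1 b1 :: nat \<Rightarrow> real.
    bounded (range a0) \<and> bounded (range a1) \<and>
    converges_in_class r
      (\<lambda>n x. Rot (- (a0 n * x + b0 n)) ** B ** renorm0 \<alpha> A xs n x ** matrix_inv B) (\<lambda>x. mat 1) \<and>
    converges_in_class r
      (\<lambda>n x. Rot (- (a1 n * x + b1 n)) ** B ** renorm1 \<alpha> A xs n x ** matrix_inv B) (\<lambda>x. mat 1)"
proof -
  note \<alpha> = assms(1-3) and r = assms(4) and circ = assms(5) and SL2 = assms(6) and reg = assms(7)
  obtain B where B: "on_circle B" "\<And>x. B x \<in> SL2" "B \<in> borel_measurable lebesgue"
    and int: "integrable (lebesgue_on {0..1}) (\<lambda>x. (norm (B x))\<^sup>2)"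
    and conj: "AE x in lebesgue. rotation_matrix (B (x + \<alpha>) ** A x ** matrix_inv (B x))"
    using assms(8) unfolding L2_conj_rotations_def by blast
  let ?A' = "inverse_cocycle \<alpha> A"
  have SL2': "?A' x \<in> SL2" for x unfolding inverse_cocycle_def by (rule SL2_matrix_inv[OF SL2])
  have circ': "on_circle ?A'"
    using circ unfolding on_circle_def inverse_cocycle_def by (metis add_diff_eq diff_add_eq)
  have "?A' = (\<lambda>x. adj2 (A (x + - \<alpha>)))" by (simp add: fun_eq_iff inverse_cocycle_def matrix_inv_eq_adj2[OF SL2])
  then have reg': "of_class r ?A'" using of_class_linear_shift[OF bounded_linear_adj2 reg circ, of "- \<alpha>"] by simp
  have conj': "AE x in lebesgue. rotation_matrix (B (x + - \<alpha>) ** ?A' x ** matrix_inv (B x))"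
    using AE_lebesgue_shift[OF conj, of "- \<alpha>"]
  proof eventually_elim
    case (elim x)
    then have "rotation_matrix (matrix_inv (B x ** A (x - \<alpha>) ** matrix_inv (B (x - \<alpha>))))"
      using rotation_matrix_inverse by simp
    then show ?case
      by (simp add: SL2_inv_mult SL2_mult SL2_matrix_inv SL2_inv_inv SL2 B(2) inverse_cocycle_def matrix_mul_assoc)
  qed
  define q where "q n = nat (cf_q_shifted \<alpha> n)" for n
  have q: "int (q n) = cf_q_shifted \<alpha> n" for n using cf_q_shifted_mono[OF \<alpha>, of n] by (simp add: q_def)
  have qr: "real (q n) = of_int (cf_q_shifted \<alpha> n)" for n by (metis of_int_of_nat_eq q)
  let ?\<beta> = "cf_gap \<alpha>"
  have \<beta>: "?\<beta> \<longlonglongrightarrow> 0" "0 < ?\<beta> n" for n using cf_gap_tendsto_0[OF \<alpha>] cf_gap_pos[OF \<alpha>] by auto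
  \<comment> \<open>The conditions under which times \<open>m n\<close> at scales \<open>cf_gap \<alpha> n\<close> satisfy the previous theorem.\<close>
  define adm where "adm \<theta> m \<longleftrightarrow> (\<forall>n. ?\<beta> n \<noteq> 0 \<and> real (m n) * \<bar>?\<beta> n\<bar> \<le> 1 \<and> (\<exists>p::int. \<bar>real (m n) * \<theta> - of_int p\<bar> \<le> \<bar>?\<beta> n\<bar>))"
    for \<theta> :: real and m :: "nat \<Rightarrow> nat"
  have adm: "adm \<alpha> (\<lambda>n. if P n then m n else 0)" "adm (- \<alpha>) (\<lambda>n. if P n then m n else 0)"
    if m: "\<And>n. real (m n) * ?\<beta> n \<le> 1" "\<And>n. \<exists>p::int. \<bar>real (m n) * \<alpha> - of_int p\<bar> \<le> ?\<beta> n" for m :: "nat \<Rightarrow> nat" and P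
  proof -
    have "\<exists>p::int. \<bar>real (if P n then m n else 0) * \<alpha> - of_int p\<bar> \<le> ?\<beta> n" for n
      using m(2)[of n] \<beta>(2)[of n] by (auto intro: exI[of _ 0] less_imp_le)
    moreover have "\<exists>p::int. \<bar>real (if P n then m n else 0) * (- \<alpha>) - of_int p\<bar> \<le> ?\<beta> n" for n
    proof -
      obtain p :: int where "\<bar>real (if P n then m n else 0) * \<alpha> - of_int p\<bar> \<le> ?\<beta> n" using calculation by blast
      then show ?thesis by (intro exI[of _ "- p"]) (simp add: abs_minus_commute)
    qed
    ultimately show "adm \<alpha> (\<lambda>n. if P n then m n else 0)" "adm (- \<alpha>) (\<lambda>n. if P n then m n else 0)"
      using m(1) \<beta>(2) by (auto simp: adm_def less_imp_neq[symmetric] abs_of_pos less_imp_le)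
  qed
  have m0: "real (q n) * ?\<beta> n \<le> 1" "\<exists>p::int. \<bar>real (q n) * \<alpha> - of_int p\<bar> \<le> ?\<beta> n" for n
    using cf_q_gap_le_1(1)[OF \<alpha>, of n] cf_q_dist_int[OF \<alpha>, of n] by (auto simp: qr intro!: exI[of _ "cf_p_shifted \<alpha> n"])
  have m1: "real (q (Suc n)) * ?\<beta> n \<le> 1" "\<exists>p::int. \<bar>real (q (Suc n)) * \<alpha> - of_int p\<bar> \<le> ?\<beta> n" for n
    using cf_q_gap_le_1(2)[OF \<alpha>, of n] cf_q_dist_int[OF \<alpha>, of "Suc n"] cf_gap_Suc_le[OF \<alpha>, of n]
    by (auto simp: qr simp del: cf_q_shifted.simps cf_p_shifted.simps intro!: exI[of _ "cf_p_shifted \<alpha> (Suc n)"])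
  have ren0: "renorm0 \<alpha> A xs n x = (if odd n then cocycle_pow \<alpha> A (q n) (xs + ?\<beta> n * x) else cocycle_pow (- \<alpha>) ?A' (q n) (xs + ?\<beta> n * x))" for xs n x
  proof -
    have "alt_sign (int n - 1) * cf_q \<alpha> (int n - 1) = (if odd n then int (q n) else - int (q n))"
      by (simp add: alt_sign_def cf_q_def q)
    then show ?thesis by (simp add: renorm0_def cf_gap_def cocycle_iter_cases[OF SL2])
  qed
  have ren1: "renorm1 \<alpha> A xs n x = (if even n then cocycle_pow \<alpha> A (q (Suc n)) (xs + ?\<beta> n * x) else cocycle_pow (- \<alpha>) ?A' (q (Suc n)) (xs + ?\<beta> n * x))" for xs n x
  proof -
    have "nat (int n + 1) = Suc n" by simp
    then have "alt_sign (int n) * cf_q \<alpha> (int n) = (if even n then int (q (Suc n)) else - int (q (Suc n)))"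
      by (simp add: alt_sign_def cf_q_def q del: cf_q_shifted.simps)
    then show ?thesis by (simp add: renorm1_def cf_gap_def cocycle_iter_cases[OF SL2])
  qed
  have r': "\<forall>k. r = Diff k \<longrightarrow> 1 \<le> k" using r by blast
  note forward = AE_renormalization_converges[OF SL2 circ reg r' B int conj]
  note backward = AE_renormalization_converges[OF SL2' circ' reg' r' B int conj']
  show ?thesis
    using forward backward
  proof eventually_elim
    case (elim xs)
    let ?C = "\<lambda>\<theta> A m a b. \<lambda>n x. Rot (- (a n * x + b n)) ** B xs ** cocycle_pow \<theta> A (m n) (xs + ?\<beta> n * x) ** matrix_inv (B xs)"
    have both: "\<exists>a b. bounded (range a) \<and> converges_in_class r (\<lambda>n x. Rot (- (a n * x + b n)) ** B xs **
        (if P n then cocycle_pow \<alpha> A (m n) (xs + ?\<beta> n * x) else cocycle_pow (- \<alpha>) ?A' (m n) (xs + ?\<beta> n * x)) ** matrix_inv (B xs)) (\<lambda>_. mat 1)"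
      if m: "\<And>n. real (m n) * ?\<beta> n \<le> 1" "\<And>n. \<exists>p::int. \<bar>real (m n) * \<alpha> - of_int p\<bar> \<le> ?\<beta> n" for m :: "nat \<Rightarrow> nat" and P
    proof -
      \<comment> \<open>The renormalizations alternate between forward and backward iterates; at the indices of the
        other direction the time 0 is admissible.\<close>
      let ?m = "\<lambda>n. if P n then m n else 0" and ?m' = "\<lambda>n. if \<not> P n then m n else 0"
      obtain a b where ab: "bounded (range a)" "converges_to_one r (?C \<alpha> A ?m a b)"
        using elim(1)[THEN spec, THEN spec, THEN mp, OF conjI[OF \<beta>(1) adm(1)[OF m, of P, unfolded adm_def]]] by (elim exE conjE) (rule that)
      obtain a' b' where ab': "bounded (range a')" "converges_to_one r (?C (- \<alpha>) ?A' ?m' a' b')"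
        using elim(2)[THEN spec, THEN spec, THEN mp, OF conjI[OF \<beta>(1) adm(2)[OF m, of "\<lambda>n. \<not> P n", unfolded adm_def]]] by (elim exE conjE) (rule that)
      let ?a = "\<lambda>n. if P n then a n else a' n" and ?b = "\<lambda>n. if P n then b n else b' n"
      have "bounded (range a \<union> range a')" using ab(1) ab'(1) by simp
      then have ba: "bounded (range ?a)" by (rule bounded_subset) auto
      have "converges_in_class r (\<lambda>n. if P n then ?C \<alpha> A ?m a b n else ?C (- \<alpha>) ?A' ?m' a' b' n) (\<lambda>_. mat 1)"
        by (intro converges_to_one_imp converges_to_one_interleave ab(2) ab'(2))
      also have "(\<lambda>n. if P n then ?C \<alpha> A ?m a b n else ?C (- \<alpha>) ?A' ?m' a' b' n) = (\<lambda>n x. Rot (- (?a n * x + ?b n)) ** B xs **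
        (if P n then cocycle_pow \<alpha> A (m n) (xs + ?\<beta> n * x) else cocycle_pow (- \<alpha>) ?A' (m n) (xs + ?\<beta> n * x)) ** matrix_inv (B xs))"
        by (simp add: fun_eq_iff)
      finally show ?thesis by (intro exI[of _ ?a] exI[of _ ?b] conjI ba)
    qed
    obtain a0 b0 where 0: "bounded (range a0)" "converges_in_class r (\<lambda>n x. Rot (- (a0 n * x + b0 n)) ** B xs ** renorm0 \<alpha> A xs n x ** matrix_inv (B xs)) (\<lambda>_. mat 1)"
      using both[of q odd, OF m0] unfolding ren0[symmetric] by blast
    obtain a1 b1 where 1: "bounded (range a1)" "converges_in_class r (\<lambda>n x. Rot (- (a1 n * x + b1 n)) ** B xs ** renorm1 \<alpha> A xs n x ** matrix_inv (B xs)) (\<lambda>_. mat 1)"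
      using both[of "\<lambda>n. q (Suc n)" even, OF m1] unfolding ren1[symmetric] by blast
    show ?case using B(2)[of xs] 0 1 by blast
  qed
qed

end
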